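(* Consider the panel change point model under the null hypothesis $H_0:\tau=T$, so $Y_{i,t}=\mu_i+\sigma\varepsilon_{i,t}$, $1\le i\le N$, $1\le t\le T$, with $T\ge4$ fixed and error vectors satisfying the conditions in the context. Let $\widehat{\tau}_N$ be an estimator of $\tau$, computed from $\mathbb{Y}=\{Y_{i,t}\}_{i,t=1}^{N,T}$ with values in $\{1,\ldots,T\}$, such that $\lim_{N\to\infty}\mathsf{P}[\widehat{\tau}_N=\tau]=1$ (where $\tau=T$), and suppose $\mathsf{E}\varepsilon_{1,t}^4<\infty$ for all $t\in\{1,\ldots,T\}$. Then the asymptotic distribution of $\mathcal{R}_N(T)$ as $N\to\infty$, i.e. the law of $$\max_{t=2,\ldots,T-2}\frac{\max_{s=1,\ldots,t}\left|X_s-\frac{s}{t}X_t\right|}{\max_{s=t,\ldots,T-1}\left|Z_s-\frac{T-s}{T-t}Z_t\right|},\qquad Z_t:=X_T-X_t,$$ and the asymptotic conditional distribution (weak limit in probability $\mathsf{P}$) of $\mathcal{R}_N^*(T)$ given $\mathbb{Y}$ as $N\to\infty$, i.e. the law of $$\max_{t=2,\ldots,T-2}\frac{\max_{s=1,\ldots,t}\left|\mathcal{X}_s-\frac{s}{t}\mathcal{X}_t\right|}{\max_{s=t,\ldots,T-1}\left|\mathcal{Z}_s-\frac{T-s}{T-t}\mathcal{Z}_t\right|},\qquad \mathcal{Z}_t:=\mathcal{X}_T-\mathcal{X}_t,$$ coincide. Here $[X_1,\ldots,X_T]^{\top}$ is zero-mean multivariate normal with symmetric covariance matrix $\Lambda=\{\lambda_{t,v}\}$,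 $\lambda_{t,t}=r(t)$, $\lambda_{t,v}=r(t)+R(t,v)$ for $t<v$; and $[\mathcal{X}_1,\ldots,\mathcal{X}_T]^{\top}$ is zero-mean multivariate normal with symmetric covariance matrix $\Gamma=\{\gamma_{t,v}\}$, where $\gamma_{t,T}=\gamma_{T,t}=0$ for all $t$, $\gamma_{t,t}=r(t)+\frac{t^2}{T^2}r(T)-\frac{2t}{T}[r(t)+R(t,T)]$ for $t<T$, and $\gamma_{t,v}=r(t)+R(t,v)+\frac{tv}{T^2}r(T)-\frac{v}{T}[r(t)+R(t,T)]-\frac{t}{T}[r(v)+R(v,T)]$ for $t<v<T$.
   Context: Panel change point model: $Y_{i,t}=\mu_i+\delta_i\mathcal{I}\{t>\tau\}+\sigma\varepsilon_{i,t}$, where $\sigma>0$ is an unknown parameter, $\mu_i,\delta_i$ are (non-random) real numbers, $\tau\in\{1,\ldots,T\}$ is the common change point ($\tau=T$ means no change), and $T$ is fixed (not depending on $N$). Conditions on the errors: the vectors $[\varepsilon_{i,1},\ldots,\varepsilon_{i,T}]^{\top}$, defined on a probability space $(\Omega,\mathcal{F},\mathsf{P})$, are iid for $i=1,\ldots,N$, with $\mathsf{E}\varepsilon_{i,t}=0$, $\mathsf{Var}\,\varepsilon_{i,t}=1$, and autocorrelation function $\rho_t=\mathsf{Corr}(\varepsilon_{i,s},\varepsilon_{i,s+t})=\mathsf{Cov}(\varepsilon_{i,s},\varepsilon_{i,s+t})$ for all $s\in\{1,\ldots,T-t\}$, not depending on $s$ (with $\rho_{-t}=\rho_t$). Correlation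 functions: $r(t)=\mathsf{Var}\sum_{s=1}^t\varepsilon_{i,s}=\sum_{|s|<t}(t-|s|)\rho_s$; $R(t,v)=\mathsf{Cov}\left(\sum_{s=1}^t\varepsilon_{i,s},\sum_{u=t+1}^v\varepsilon_{i,u}\right)=\sum_{s=1}^t\sum_{u=t+1}^v\rho_{u-s}$, $t<v$. Test statistic: $$\mathcal{R}_N(T)=\max_{t=2,\ldots,T-2}\frac{\max_{s=1,\ldots,t}\left|\sum_{i=1}^N\left[\sum_{r=1}^s\left(Y_{i,r}-\overline{Y}_{i,t}\right)\right]\right|}{\max_{s=t,\ldots,T-1}\left|\sum_{i=1}^N\left[\sum_{r=s+1}^T\left(Y_{i,r}-\widetilde{Y}_{i,t}\right)\right]\right|},$$ with $\overline{Y}_{i,t}=\frac1t\sum_{s=1}^tY_{i,s}$ and $\widetilde{Y}_{i,t}=\frac{1}{T-t}\sum_{s=t+1}^TY_{i,s}$. Residuals: $\widehat{e}_{i,t}:=Y_{i,t}-\overline{Y}_{i,\widehat{\tau}_N}$ if $t\le\widehat{\tau}_N$ and $\widehat{e}_{i,t}:=Y_{i,t}-\widetilde{Y}_{i,\widehat{\tau}_N}$ if $t>\widehat{\tau}_N$. Bootstrap: given $\mathbb{Y}$, the row vectors $[\widehat{e}_{i,1}^*,\ldots,\widehat{e}_{i,T}^*]$, $i=1,\ldots,N$, are drawn by resampling with replacement from the rows $\{[\widehat{e}_{j,1},\ldots,\widehat{e}_{j,T}]\}_{j=1}^N$ (i.e. conditionally iid, uniform on these $N$ rows). Put $\widehat{Y}_{i,t}^*:=\widehat{e}_{i,t}^*-\frac1N\sum_{j=1}^N\widehat{e}_{j,t}$.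 The bootstrap statistic $\mathcal{R}_N^*(T)$ is given by the formula for $\mathcal{R}_N(T)$ with every $Y_{i,t}$ replaced by $\widehat{Y}_{i,t}^*$ (and $\overline{Y}_{i,t},\widetilde{Y}_{i,t}$ replaced by $\frac1t\sum_{s=1}^t\widehat{Y}_{i,s}^*$ and $\frac1{T-t}\sum_{s=t+1}^T\widehat{Y}_{i,s}^*$). *)

theory Defs
  imports "HOL-Probability.Probability"
begin

section \<open>The panel change point model\<close>

text \<open>
  A panel is a function \<open>y\<close>, with \<open>y i t\<close> the observation of panel member \<open>i \<ge> 1\<close> at
  time \<open>t \<ge> 1\<close>. The sample of size \<open>N\<close> is its restriction to \<open>{1..N} \<times> {1..T}\<close>.
\<close>

definition panel_obs ::
  "(nat \<Rightarrow> real) \<Rightarrow> (nat \<Rightarrow> real) \<Rightarrow> nat \<Rightarrow> real \<Rightarrow> (nat \<Rightarrow> nat \<Rightarrow> 'a \<Rightarrow> real) \<Rightarrow> nat \<Rightarrow> nat \<Rightarrow> 'a \<Rightarrow> real"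
where
  "panel_obs \<mu> \<delta> \<tau> \<sigma> \<epsilon> i t \<omega> = \<mu> i + \<delta> i * (if t > \<tau> then 1 else 0) + \<sigma> * \<epsilon> i t \<omega>"

definition panel_data ::
  "nat \<Rightarrow> nat \<Rightarrow> (nat \<Rightarrow> nat \<Rightarrow> 'a \<Rightarrow> real) \<Rightarrow> 'a \<Rightarrow> nat \<Rightarrow> nat \<Rightarrow> real"
where
  "panel_data T N Y \<omega> = (\<lambda>i\<in>{1..N}. \<lambda>t\<in>{1..T}. Y i t \<omega>)"

abbreviation vec_space :: "nat \<Rightarrow> (nat \<Rightarrow> real) measure" where
  "vec_space T \<equiv> (\<Pi>\<^sub>M t\<in>{1..T}. (borel :: real measure))"

abbreviation panel_space :: "nat \<Rightarrow> nat \<Rightarrow> (nat \<Rightarrow> nat \<Rightarrow> real) measure" where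
  "panel_space T N \<equiv> (\<Pi>\<^sub>M i\<in>{1..N}. vec_space T)"

definition error_vector ::
  "nat \<Rightarrow> (nat \<Rightarrow> nat \<Rightarrow> 'a \<Rightarrow> real) \<Rightarrow> nat \<Rightarrow> 'a \<Rightarrow> nat \<Rightarrow> real"
where
  "error_vector T \<epsilon> i \<omega> = (\<lambda>t\<in>{1..T}. \<epsilon> i t \<omega>)"

definition covariance :: "'a measure \<Rightarrow> ('a \<Rightarrow> real) \<Rightarrow> ('a \<Rightarrow> real) \<Rightarrow> real" where
  "covariance M U V =
     prob_space.expectation M
       (\<lambda>\<omega>. (U \<omega> - prob_space.expectation M U) * (V \<omega> - prob_space.expectation M V))"

text \<open>
  \<open>\<rho> t\<close> is the autocorrelation at lag \<open>t \<ge> 0\<close>; as the errors have unit variance, it is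
  also the autocovariance.
\<close>

definition panel_errors ::
  "'a measure \<Rightarrow> nat \<Rightarrow> (nat \<Rightarrow> real) \<Rightarrow> (nat \<Rightarrow> nat \<Rightarrow> 'a \<Rightarrow> real) \<Rightarrow> bool"
where
  "panel_errors M T \<rho> \<epsilon> \<longleftrightarrow>
     prob_space.indep_vars M (\<lambda>_. vec_space T) (error_vector T \<epsilon>) {1..} \<and>
     (\<forall>i\<ge>1. distr M (vec_space T) (error_vector T \<epsilon> i) =
             distr M (vec_space T) (error_vector T \<epsilon> 1)) \<and>
     (\<forall>i\<ge>1. \<forall>t\<in>{1..T}. integrable M (\<epsilon> i t) \<and> prob_space.expectation M (\<epsilon> i t) = 0) \<and>
     (\<forall>i\<ge>1. \<forall>t\<in>{1..T}. prob_space.variance M (\<epsilon> i t) = 1) \<and>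
     (\<forall>i\<ge>1. \<forall>t<T. \<forall>s\<in>{1..T - t}. covariance M (\<epsilon> i s) (\<epsilon> i (s + t)) = \<rho> t)"

text \<open>
  The cumulative variance \<open>r(t)\<close> and covariance \<open>R(t,v)\<close>. They are the same for all panel
  members, so the first one is used.
\<close>

definition cum_var :: "'a measure \<Rightarrow> (nat \<Rightarrow> nat \<Rightarrow> 'a \<Rightarrow> real) \<Rightarrow> nat \<Rightarrow> real" where
  "cum_var M \<epsilon> t = prob_space.variance M (\<lambda>\<omega>. \<Sum>s=1..t. \<epsilon> 1 s \<omega>)"

definition cum_cov :: "'a measure \<Rightarrow> (nat \<Rightarrow> nat \<Rightarrow> 'a \<Rightarrow> real) \<Rightarrow> nat \<Rightarrow> nat \<Rightarrow> real" where
  "cum_cov M \<epsilon> t v =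
     covariance M (\<lambda>\<omega>. \<Sum>s=1..t. \<epsilon> 1 s \<omega>) (\<lambda>\<omega>. \<Sum>u=t+1..v. \<epsilon> 1 u \<omega>)"


section \<open>Test statistic and bootstrap\<close>

definition mean_upto :: "(nat \<Rightarrow> real) \<Rightarrow> nat \<Rightarrow> real" where
  "mean_upto x t = (\<Sum>s=1..t. x s) / real t"

definition mean_after :: "nat \<Rightarrow> (nat \<Rightarrow> real) \<Rightarrow> nat \<Rightarrow> real" where
  "mean_after T x t = (\<Sum>s=t+1..T. x s) / real (T - t)"

text \<open>
  A vanishing denominator makes the corresponding ratio \<open>0\<close>, both here and in
  \<open>limit_ratio\<close> below.
\<close>

definition ratio_stat :: "nat \<Rightarrow> nat \<Rightarrow> (nat \<Rightarrow> nat \<Rightarrow> real) \<Rightarrow> real" where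
  "ratio_stat T N y =
     (MAX t\<in>{2..T-2}.
        (MAX s\<in>{1..t}. \<bar>\<Sum>i=1..N. \<Sum>r=1..s. (y i r - mean_upto (y i) t)\<bar>) /
        (MAX s\<in>{t..T-1}. \<bar>\<Sum>i=1..N. \<Sum>r=s+1..T. (y i r - mean_after T (y i) t)\<bar>))"

definition residual :: "nat \<Rightarrow> nat \<Rightarrow> (nat \<Rightarrow> nat \<Rightarrow> real) \<Rightarrow> nat \<Rightarrow> nat \<Rightarrow> real" where
  "residual T \<theta> y i t =
     (if t \<le> \<theta> then y i t - mean_upto (y i) \<theta> else y i t - mean_after T (y i) \<theta>)"

text \<open>
  For a fixed residual panel \<open>e\<close>, \<open>N\<close> rows are drawn independently and uniformly from the
  rows \<open>e 1, \<dots>, e N\<close> and then centred by the column means of \<open>e\<close>.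
\<close>

definition bootstrap_rows :: "nat \<Rightarrow> (nat \<Rightarrow> nat \<Rightarrow> real) \<Rightarrow> (nat \<Rightarrow> nat \<Rightarrow> real) pmf" where
  "bootstrap_rows N e =
     Pi_pmf {1..N} (\<lambda>_. 0) (\<lambda>_. map_pmf (\<lambda>j. e j) (pmf_of_set {1..N}))"

definition bootstrap_panel :: "nat \<Rightarrow> (nat \<Rightarrow> nat \<Rightarrow> real) \<Rightarrow> (nat \<Rightarrow> nat \<Rightarrow> real) pmf" where
  "bootstrap_panel N e =
     map_pmf (\<lambda>e' i t. e' i t - (\<Sum>j=1..N. e j t) / real N) (bootstrap_rows N e)"

text \<open>
  The conditional law of the bootstrap statistic given that the sample equals \<open>y\<close>, where
  \<open>\<theta>\<close> is the value of the change point estimator at \<open>y\<close>.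
\<close>

definition bootstrap_law :: "nat \<Rightarrow> nat \<Rightarrow> nat \<Rightarrow> (nat \<Rightarrow> nat \<Rightarrow> real) \<Rightarrow> real measure" where
  "bootstrap_law T N \<theta> y =
     distr (measure_pmf (bootstrap_panel N (residual T \<theta> y))) borel (ratio_stat T N)"

text \<open>
  Convergence in probability of random laws \<open>K N \<omega>\<close> to a fixed law \<open>L\<close>, in the weak sense;
  for deterministic \<open>K\<close> this is \<open>weak_conv_m\<close>.
\<close>

definition weak_conv_in_prob ::
  "'a measure \<Rightarrow> (nat \<Rightarrow> 'a \<Rightarrow> real measure) \<Rightarrow> real measure \<Rightarrow> bool"
where
  "weak_conv_in_prob M K L \<longleftrightarrow>
     (\<forall>x. isCont (cdf L) x \<longrightarrow>
        (\<forall>\<eta>>0. (\<lambda>N. measure M {\<omega> \<in> space M. \<bar>cdf (K N \<omega>) x - cdf L x\<bar> > \<eta>})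
                 \<longlonglongrightarrow> 0))"


section \<open>Gaussian limits\<close>

definition normal_law :: "real \<Rightarrow> real \<Rightarrow> real measure" where
  "normal_law m s = (if s = 0 then return borel m else density lborel (normal_density m s))"

text \<open>
  A law on \<open>\<real>\<^sup>T\<close> is multivariate normal, possibly singular, if all linear combinations of
  the coordinates are normal, possibly degenerate.
\<close>

definition centred_normal :: "nat \<Rightarrow> (nat \<Rightarrow> nat \<Rightarrow> real) \<Rightarrow> (nat \<Rightarrow> real) measure \<Rightarrow> bool" where
  "centred_normal T C L \<longleftrightarrow>
     prob_space L \<and> sets L = sets (vec_space T) \<and>
     (\<forall>u. \<exists>m s. 0 \<le> s \<and> distr L borel (\<lambda>x. \<Sum>t=1..T. u t * x t) = normal_law m s) \<and>
     (\<forall>t\<in>{1..T}. prob_space.expectation L (\<lambda>x. x t) = 0) \<and>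
     (\<forall>t\<in>{1..T}. \<forall>v\<in>{1..T}. covariance L (\<lambda>x. x t) (\<lambda>x. x v) = C t v)"

text \<open>The limiting covariance matrices, with \<open>r\<close> and \<open>R\<close> as arguments.\<close>

definition Lambda_cov ::
  "(nat \<Rightarrow> real) \<Rightarrow> (nat \<Rightarrow> nat \<Rightarrow> real) \<Rightarrow> nat \<Rightarrow> nat \<Rightarrow> real"
where
  "Lambda_cov r R t v =
     (if t = v then r t else if t < v then r t + R t v else r v + R v t)"

definition Gamma_upper ::
  "(nat \<Rightarrow> real) \<Rightarrow> (nat \<Rightarrow> nat \<Rightarrow> real) \<Rightarrow> nat \<Rightarrow> nat \<Rightarrow> nat \<Rightarrow> real"
where
  "Gamma_upper r R T t v =
     r t + R t v + real t * real v / (real T)\<^sup>2 * r T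
       - real v / real T * (r t + R t T) - real t / real T * (r v + R v T)"

definition Gamma_cov ::
  "(nat \<Rightarrow> real) \<Rightarrow> (nat \<Rightarrow> nat \<Rightarrow> real) \<Rightarrow> nat \<Rightarrow> nat \<Rightarrow> nat \<Rightarrow> real"
where
  "Gamma_cov r R T t v =
     (if t = T \<or> v = T then 0
      else if t = v then
        r t + (real t)\<^sup>2 / (real T)\<^sup>2 * r T - 2 * real t / real T * (r t + R t T)
      else if t < v then Gamma_upper r R T t v
      else Gamma_upper r R T v t)"

definition limit_ratio :: "nat \<Rightarrow> (nat \<Rightarrow> real) \<Rightarrow> real" where
  "limit_ratio T x =
     (let z = (\<lambda>t. x T - x t) in
      MAX t\<in>{2..T-2}.
        (MAX s\<in>{1..t}. \<bar>x s - real s / real t * x t\<bar>) /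
        (MAX s\<in>{t..T-1}. \<bar>z s - real (T - s) / real (T - t) * z t\<bar>))"

end

theory Submission
  imports Defs
begin

text \<open>
  Both limits are laws of one functional of a Gaussian vector. The statistic depends on the panel
  only through the partial sums in time, added over the panel members: \<open>ratio_stat\<close> is \<open>limit_ratio\<close> of that vector
  (\<open>ratio_stat_limit_ratio\<close>). The functional \<open>limit_ratio\<close> ignores positive scale factors and linear
  trends (\<open>limit_ratio_affine\<close>), so the means \<open>\<mu>\<close>, the scale \<open>\<sigma>\<close> and the factor \<open>\<surd>N\<close> drop out. The residuals
  for the estimate \<open>T\<close> have as partial sums the bridges \<open>X\<^sub>s - (s/T) X\<^sub>T\<close> of the partial sums \<open>X\<^sub>s\<close>; their covariance matrix
  is \<open>\<Gamma>\<close> if that of \<open>X\<close> is \<open>\<Lambda>\<close>. A bridge differs from \<open>X\<close> only by a linear trend, and therefore the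
  two limit laws coincide.

  It remains to prove two central limit theorems and to map them through \<open>limit_ratio\<close>. Characteristic
  functions of projections are controlled by a quantitative Lyapunov bound (\<open>lyapunov_char_bound\<close>)
  that applies to the sample and, conditionally, to the resampled rows alike. Convergence of these
  characteristic functions implies convergence of the integrals of all bounded continuous functions on
  \<open>\<real>\<^sup>T\<close> (\<open>bounded_continuous_converge\<close>); the proof reduces this to the Levy continuity theorem on
  the line by tilting with positive weights, one coordinate after the other, and concludes with the
  Stone-Weierstrass theorem. The same theorem, applied to constant sequences, shows that a Gaussian law
  is determined by its projections, as far as the law of \<open>limit_ratio\<close> is concerned.

  The functional is discontinuous where a denominator vanishes, and the covariance may be
  singular. There is a dichotomy (\<open>limit_ratio_weak_conv\<close>): a denominator is the maximum of absolute
  values of linear forms. Either all of them have variance \<open>0\<close>, and then the denominator vanishes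
  almost surely in the limit and also for every sample and resample, so that the quotient is \<open>0\<close>
  almost surely by the convention for division; or some form has positive variance, and then the
  denominator is almost surely positive in the limit.

  For the bootstrap, the conditional laws are compared with their limit on the event that the
  empirical means and second moments are close to the true ones and the empirical
  fourth moments are of smaller order than \<open>\<surd>N\<close>. By the inequalities of Chebyshev and Markov this event
  has probability tending to \<open>1\<close> (\<open>atypical_negligible\<close>), and along any sequence of such realizations the
  deterministic triangular array theorem \<open>resampled_char_limit\<close> applies
  (\<open>bootstrap_limit_on_typical\<close>).
\<close>

section \<open>Characteristic functions determine weak convergence\<close>

text \<open>
  Normalizing the weight \<open>W\<close> turns the tilted measure into a probability measure, to whose image under \<open>X\<close>
  the Levy continuity theorem applies. The lower bound \<open>1\<close> keeps the normalizing constants away from \<open>0\<close>.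
\<close>

lemma tilted_levy_positive:
  fixes P :: "nat \<Rightarrow> 'b measure" and Q :: "'b measure" and W X :: "'b \<Rightarrow> real" and f :: "real \<Rightarrow> real"
  assumes prob: "\<And>k. prob_space (P k)" "prob_space Q"
    and sets: "\<And>k. sets (P k) = sets Q"
    and meas [measurable]: "W \<in> borel_measurable Q" "X \<in> borel_measurable Q"
    and W: "\<And>x. 1 \<le> W x" "\<And>x. W x \<le> B"
    and cos: "\<And>v. (\<lambda>k. \<integral>x. W x * cos (v * X x) \<partial>P k) \<longlonglongrightarrow> (\<integral>x. W x * cos (v * X x) \<partial>Q)"
    and sin: "\<And>v. (\<lambda>k. \<integral>x. W x * sin (v * X x) \<partial>P k) \<longlonglongrightarrow> (\<integral>x. W x * sin (v * X x) \<partial>Q)"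
    and f: "continuous_on UNIV f" "\<And>y. \<bar>f y\<bar> \<le> D"
  shows "(\<lambda>k. \<integral>x. W x * f (X x) \<partial>P k) \<longlonglongrightarrow> (\<integral>x. W x * f (X x) \<partial>Q)"
proof -
  define c where "c p = (\<integral>x. W x \<partial>p)" for p :: "'b measure"
  define tilt where "tilt p = distr (density p (\<lambda>x. ennreal (W x / c p))) borel X" for p
  have fm [measurable]: "f \<in> borel_measurable borel"
    using f(1) by (rule borel_measurable_continuous_onI)
  have facts: "c p \<ge> 1" "real_distribution (tilt p)"
      "\<And>g :: real \<Rightarrow> real. g \<in> borel_measurable borel \<Longrightarrow> (\<integral>y. g y \<partial>tilt p) = (\<integral>x. W x * g (X x) \<partial>p) / c p"
      "\<And>v. char (tilt p) v = Complex ((\<integral>x. W x * cos (v * X x) \<partial>p) / c p)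
                                     ((\<integral>x. W x * sin (v * X x) \<partial>p) / c p)"
    if p: "prob_space p" and s: "sets p = sets Q" for p
  proof -
    interpret prob_space p by fact
    note [measurable_cong] = s
    have int: "integrable p W"
      by (rule integrable_const_bound[where B = B]) (use W in \<open>auto intro!: AE_I2 simp: abs_of_nonneg order.trans[OF zero_le_one]\<close>)
    have "1 = (\<integral>x. (1::real) \<partial>p)" by (simp add: prob_space)
    also have "\<dots> \<le> c p"
      unfolding c_def by (intro integral_mono int) (use W in auto)
    finally show c1: "c p \<ge> 1" .
    have pos: "W x / c p \<ge> 0" for x using W(1)[of x] c1 by simp
    have "emeasure (density p (\<lambda>x. ennreal (W x / c p))) (space p) = (\<integral>\<^sup>+x. ennreal (W x / c p) \<partial>p)"
      by (subst emeasure_density) (auto intro!: nn_integral_cong)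
    also have "\<dots> = ennreal (\<integral>x. W x / c p \<partial>p)"
      using int pos by (intro nn_integral_eq_integral) auto
    also have "(\<integral>x. W x / c p \<partial>p) = 1"
      using c1 by (simp add: c_def)
    finally have pd: "prob_space (density p (\<lambda>x. ennreal (W x / c p)))"
      by (intro prob_spaceI) simp
    then show rd: "real_distribution (tilt p)"
      unfolding tilt_def by (intro prob_space.real_distribution_distr) auto
    show I: "(\<integral>y. g y \<partial>tilt p) = (\<integral>x. W x * g (X x) \<partial>p) / c p"
      if [measurable]: "g \<in> borel_measurable borel" for g :: "real \<Rightarrow> real"
      unfolding tilt_def
      by (subst integral_distr, simp, simp, subst integral_density) (use pos in auto)
    show "char (tilt p) v = Complex ((\<integral>x. W x * cos (v * X x) \<partial>p) / c p)
                                     ((\<integral>x. W x * sin (v * X x) \<partial>p) / c p)" for v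
    proof -
      interpret t: real_distribution "tilt p" by (rule rd)
      have i: "integrable (tilt p) (\<lambda>x. iexp (v * x))"
        by (intro t.integrable_const_bound[where B=1]) auto
      have "Re (char (tilt p) v) = (\<integral>y. cos (v * y) \<partial>tilt p)"
        "Im (char (tilt p) v) = (\<integral>y. sin (v * y) \<partial>tilt p)"
        unfolding char_def integral_Re[OF i, symmetric] integral_Im[OF i, symmetric]
        by (simp_all add: Re_exp Im_exp)
      then show ?thesis by (simp add: complex_eq_iff I)
    qed
  qed
  have cl: "(\<lambda>k. c (P k)) \<longlonglongrightarrow> c Q"
    using cos[of 0] by (simp add: c_def)
  have c0: "c Q \<noteq> 0" using facts(1)[OF prob(2)] by simp
  have "weak_conv_m (\<lambda>k. tilt (P k)) (tilt Q)"
  proof (rule levy_continuity)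
    show "(\<lambda>k. char (tilt (P k)) t) \<longlonglongrightarrow> char (tilt Q) t" for t
      unfolding facts(4)[OF prob(1) sets] facts(4)[OF prob(2) refl]
      by (intro tendsto_intros tendsto_Complex cos sin cl c0)
  qed (use facts prob sets in auto)
  then have "(\<lambda>k. \<integral>y. f y \<partial>tilt (P k)) \<longlonglongrightarrow> (\<integral>y. f y \<partial>tilt Q)"
    by (rule weak_conv_imp_integral_bdd_continuous_conv[rotated 2, where B = D])
       (use facts prob sets f in \<open>auto simp: continuous_on_eq_continuous_at\<close>)
  then have "(\<lambda>k. c (P k) * (\<integral>y. f y \<partial>tilt (P k))) \<longlonglongrightarrow> c Q * (\<integral>y. f y \<partial>tilt Q)"
    by (intro tendsto_mult cl)
  moreover have "c (P k) * (\<integral>y. f y \<partial>tilt (P k)) = (\<integral>x. W x * f (X x) \<partial>P k)" for k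
    using facts(1)[OF prob(1) sets, of k] by (simp add: facts(3)[OF prob(1) sets fm])
  moreover have "c Q * (\<integral>y. f y \<partial>tilt Q) = (\<integral>x. W x * f (X x) \<partial>Q)"
    using c0 by (simp add: facts(3)[OF prob(2) refl fm])
  ultimately show ?thesis by simp
qed

text \<open>
  A bounded weight becomes at least \<open>1\<close> by adding a constant, whose contribution is subtracted again.
\<close>

lemma tilted_levy:
  fixes P :: "nat \<Rightarrow> 'b measure" and Q :: "'b measure" and w X :: "'b \<Rightarrow> real" and f :: "real \<Rightarrow> real"
  assumes prob: "\<And>k. prob_space (P k)" "prob_space Q"
    and sets: "\<And>k. sets (P k) = sets Q"
    and meas [measurable]: "w \<in> borel_measurable Q" "X \<in> borel_measurable Q"
    and w: "\<And>x. \<bar>w x\<bar> \<le> B"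
    and cos: "\<And>v. (\<lambda>k. \<integral>x. cos (v * X x) \<partial>P k) \<longlonglongrightarrow> (\<integral>x. cos (v * X x) \<partial>Q)"
      "\<And>v. (\<lambda>k. \<integral>x. w x * cos (v * X x) \<partial>P k) \<longlonglongrightarrow> (\<integral>x. w x * cos (v * X x) \<partial>Q)"
    and sin: "\<And>v. (\<lambda>k. \<integral>x. sin (v * X x) \<partial>P k) \<longlonglongrightarrow> (\<integral>x. sin (v * X x) \<partial>Q)"
      "\<And>v. (\<lambda>k. \<integral>x. w x * sin (v * X x) \<partial>P k) \<longlonglongrightarrow> (\<integral>x. w x * sin (v * X x) \<partial>Q)"
    and f: "continuous_on UNIV f" "\<And>y. \<bar>f y\<bar> \<le> D"
  shows "(\<lambda>k. \<integral>x. w x * f (X x) \<partial>P k) \<longlonglongrightarrow> (\<integral>x. w x * f (X x) \<partial>Q)"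
proof -
  note [measurable_cong] = sets
  have fm [measurable]: "f \<in> borel_measurable borel"
    using f(1) by (rule borel_measurable_continuous_onI)
  have int: "integrable p (\<lambda>x. w x * g (X x))" "integrable p (\<lambda>x. g (X x))"
    if "prob_space p" and s: "sets p = sets Q" and [measurable]: "g \<in> borel_measurable borel"
      and "\<And>y. \<bar>g y\<bar> \<le> C" for p and g :: "real \<Rightarrow> real" and C
  proof -
    note [measurable_cong] = s
    interpret prob_space p by fact
    show "integrable p (\<lambda>x. w x * g (X x))"
      by (rule integrable_const_bound[where B = "B * C"])
        (use w that(4) in \<open>auto intro!: AE_I2 mult_mono simp: abs_mult intro: order.trans[OF abs_ge_zero]\<close>)
    show "integrable p (\<lambda>x. g (X x))"
      by (rule integrable_const_bound[where B = C]) (use that(4) in \<open>auto\<close>)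
  qed
  define b where "b = B + 1"
  have split: "(\<integral>x. (w x + b) * g (X x) \<partial>p) = (\<integral>x. w x * g (X x) \<partial>p) + b * (\<integral>x. g (X x) \<partial>p)"
    if "prob_space p" "sets p = sets Q" "g \<in> borel_measurable borel"
      and "\<And>y. \<bar>g y\<bar> \<le> C" for p and g :: "real \<Rightarrow> real" and C
    using int[OF that] by (simp add: distrib_right)
  have "(\<lambda>k. \<integral>x. (w x + b) * f (X x) \<partial>P k) \<longlonglongrightarrow> (\<integral>x. (w x + b) * f (X x) \<partial>Q)"
  proof (rule tilted_levy_positive[OF prob sets _ _ _ _ _ _ f, where B = "B + b"])
    show "1 \<le> w x + b" "w x + b \<le> B + b" for x
      using w[of x] by (auto simp: b_def)
    show "(\<lambda>k. \<integral>x. (w x + b) * cos (v * X x) \<partial>P k) \<longlonglongrightarrow> (\<integral>x. (w x + b) * cos (v * X x) \<partial>Q)" for v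
      by (subst (1 2) split[where g = "\<lambda>y. cos (v * y)" and C = 1])
        (auto intro!: tendsto_intros cos prob sets)
    show "(\<lambda>k. \<integral>x. (w x + b) * sin (v * X x) \<partial>P k) \<longlonglongrightarrow> (\<integral>x. (w x + b) * sin (v * X x) \<partial>Q)" for v
      by (subst (1 2) split[where g = "\<lambda>y. sin (v * y)" and C = 1])
        (auto intro!: tendsto_intros sin prob sets)
  qed auto
  moreover have "(\<lambda>k. \<integral>x. 1 * f (X x) \<partial>P k) \<longlonglongrightarrow> (\<integral>x. 1 * f (X x) \<partial>Q)"
    by (rule tilted_levy_positive[OF prob sets _ _ _ _ _ _ f, where B = 1])
      (auto intro: cos sin)
  ultimately have "(\<lambda>k. (\<integral>x. (w x + b) * f (X x) \<partial>P k) - b * (\<integral>x. 1 * f (X x) \<partial>P k))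
      \<longlonglongrightarrow> (\<integral>x. (w x + b) * f (X x) \<partial>Q) - b * (\<integral>x. 1 * f (X x) \<partial>Q)"
    by (intro tendsto_intros)
  then show ?thesis
    using split[OF prob(1) sets fm f(2)] split[OF prob(2) refl fm f(2)] by simp
qed

definition lin :: "nat \<Rightarrow> (nat \<Rightarrow> real) \<Rightarrow> (nat \<Rightarrow> real) \<Rightarrow> real" where
  "lin T u x = (\<Sum>t=1..T. u t * x t)"

lemma measurable_lin [measurable]: "lin T u \<in> borel_measurable (vec_space T)"
  unfolding lin_def[abs_def] by measurable

lemma lin_upd:
  assumes "a \<in> {1..T}" shows "lin T (u(a := u a + v)) x = lin T u x + v * x a"
proof -
  have "lin T (u(a := u a + v)) x = (\<Sum>t=1..T. u t * x t + (if t = a then v * x a else 0))"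
    unfolding lin_def by (intro sum.cong) (auto simp: distrib_right)
  then show ?thesis using assms by (simp add: sum.distrib lin_def)
qed

lemma lin_0 [simp]: "lin T (\<lambda>_. 0) x = 0" by (simp add: lin_def)

text \<open>
  Induction over the coordinates that carry a general function: the product of the functions
  already treated and the cosine is the weight in \<open>tilted_levy\<close>, and a further cosine in the new coordinate merges
  with the old one by the product-to-sum formula, which only changes the coefficients \<open>u\<close>.
\<close>

lemma product_weights_converge:
  fixes P :: "nat \<Rightarrow> (nat \<Rightarrow> real) measure"
  assumes prob: "\<And>k. prob_space (P k)" "prob_space Q"
    and sets: "\<And>k. sets (P k) = sets (vec_space T)" "sets Q = sets (vec_space T)"
    and conv: "\<And>u c. (\<lambda>k. \<integral>x. cos (lin T u x + c) \<partial>P k) \<longlonglongrightarrow> (\<integral>x. cos (lin T u x + c) \<partial>Q)"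
    and "finite J" "J \<subseteq> {1..T}"
    and g: "\<And>t. continuous_on UNIV (g t)" "\<And>t y. \<bar>g t y\<bar> \<le> D"
  shows "(\<lambda>k. \<integral>x. (\<Prod>t\<in>J. g t (x t)) * cos (lin T u x + c) \<partial>P k)
     \<longlonglongrightarrow> (\<integral>x. (\<Prod>t\<in>J. g t (x t)) * cos (lin T u x + c) \<partial>Q)"
  using \<open>finite J\<close> \<open>J \<subseteq> {1..T}\<close>
proof (induction J arbitrary: u c rule: finite_induct)
  case empty
  then show ?case using conv by simp
next
  case (insert a J)
  note [measurable_cong] = sets
  have gm [measurable]: "g t \<in> borel_measurable borel" for t
    using g(1) by (rule borel_measurable_continuous_onI)
  define h where "h x = (\<Prod>t\<in>J. g t (x t))" for x :: "nat \<Rightarrow> real"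
  have [measurable]: "h \<in> borel_measurable (vec_space T)"
    using insert.prems unfolding h_def[abs_def] by (intro borel_measurable_prod measurable_compose[OF _ gm] measurable_component_singleton) auto
  have am [measurable]: "(\<lambda>x. x a) \<in> borel_measurable (vec_space T)"
    using insert.prems by (intro measurable_component_singleton) simp
  have aT: "a \<in> {1..T}" using insert.prems by simp
  have hD: "\<bar>h x\<bar> \<le> D ^ card J" for x
    unfolding h_def abs_prod prod_constant[symmetric] using g(2) by (intro prod_mono) auto
  have hc: "\<bar>h x * cos y\<bar> \<le> D ^ card J" for x y
    using mult_mono[OF hD[of x] abs_cos_le_one[of y]] order.trans[OF abs_ge_zero hD] by (simp add: abs_mult)
  have IH: "(\<lambda>k. \<integral>x. h x * cos (lin T u x + c) \<partial>P k) \<longlonglongrightarrow> (\<integral>x. h x * cos (lin T u x + c) \<partial>Q)" for u c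
    unfolding h_def using insert by auto
  have int: "integrable p (\<lambda>x. h x * cos (lin T u x + c))"
    if "prob_space p" "sets p = sets (vec_space T)" for p u c
  proof -
    interpret prob_space p by fact
    note [measurable_cong] = that(2)
    show ?thesis
      using hc by (intro integrable_const_bound[where B = "D ^ card J"]) auto
  qed
  have prodform: "h x * cos (lin T u x + c) * cos (v * x a + d) =
      (h x * cos (lin T (u(a := u a + v)) x + (c + d)) + h x * cos (lin T (u(a := u a + (- v))) x + (c - d))) / 2"
    for x u c v d
    unfolding lin_upd[OF aT] by (simp add: cos_times_cos algebra_simps)
  have weighted: "(\<lambda>k. \<integral>x. h x * cos (lin T u x + c) * cos (v * x a + d) \<partial>P k)
      \<longlonglongrightarrow> (\<integral>x. h x * cos (lin T u x + c) * cos (v * x a + d) \<partial>Q)" for v d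
    unfolding prodform using int[OF prob(1) sets(1)] int[OF prob(2) sets(2)]
    by (auto intro!: tendsto_intros IH simp del: fun_upd_apply)
  have plain: "(\<lambda>k. \<integral>x. cos (v * x a + d) \<partial>P k) \<longlonglongrightarrow> (\<integral>x. cos (v * x a + d) \<partial>Q)" for v d
    using conv[of "(\<lambda>_. 0)(a := v)" d] lin_upd[OF aT, of "\<lambda>_. 0" v] by simp
  \<comment> \<open>A sine is a cosine with another phase, so that cosines with arbitrary phase suffice.\<close>
  have sin_cos: "sin y = cos (y + (- (pi / 2)))" for y :: real
    by (simp add: cos_diff)
  have "(\<lambda>k. \<integral>x. (h x * cos (lin T u x + c)) * g a (x a) \<partial>P k)
      \<longlonglongrightarrow> (\<integral>x. (h x * cos (lin T u x + c)) * g a (x a) \<partial>Q)"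
  proof (rule tilted_levy[where B = "D ^ card J", OF prob _ _ _ _ _ _ _ _ g])
    show "\<bar>h x * cos (lin T u x + c)\<bar> \<le> D ^ card J" for x
      by (rule hc)
  qed (use sets plain[where d = 0] plain[where d = "- (pi/2)"] weighted[where d = 0] weighted[where d = "- (pi/2)"] in \<open>auto simp: sin_cos\<close>)
  then show ?case
    using insert by (simp add: h_def mult_ac)
qed

definition cube :: "nat \<Rightarrow> real \<Rightarrow> (nat \<Rightarrow> real) set" where
  "cube T r = PiE {1..T} (\<lambda>_. {-r..r})"

text \<open>
  Clipping turns a continuous function into a bounded one without changing it on the cube.
\<close>

definition clip :: "nat \<Rightarrow> real \<Rightarrow> (nat \<Rightarrow> real) \<Rightarrow> nat \<Rightarrow> real" where
  "clip T r x = (\<lambda>t\<in>{1..T}. max (- r) (min r (x t)))"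

lemma clip_in_cube: "r \<ge> 0 \<Longrightarrow> clip T r x \<in> cube T r"
  by (auto simp: clip_def cube_def)

lemma clip_id: "x \<in> cube T r \<Longrightarrow> clip T r x = x"
  by (auto simp: clip_def cube_def PiE_iff extensional_def fun_eq_iff min_absorb2 max_absorb2)

text \<open>
  The cube is a product over all indices, with one point at the indices outside \<open>{1..T}\<close>, so
  Tychonoff's theorem applies.
\<close>

lemma compact_cube: "compact (cube T r)"
proof -
  have "cube T r = PiE UNIV (\<lambda>t. if t \<in> {1..T} then {-r..r} else {undefined})"
    by (auto simp: cube_def PiE_iff extensional_def split: if_splits) 
  moreover have "compactin (product_topology (\<lambda>i::nat. euclidean :: real topology) UNIV)
      (PiE UNIV (\<lambda>t. if t \<in> {1..T} then {-r..r} else {undefined}))"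
    by (subst compactin_PiE) (auto simp: compactin_euclidean_iff)
  ultimately show ?thesis
    by (simp add: euclidean_product_topology compactin_euclidean_iff)
qed

text \<open>
  The algebra for the Stone-Weierstrass theorem. Its members need not be bounded, but composed with
  \<open>clip\<close> they have convergent integrals by \<open>product_weights_converge\<close>.
\<close>

inductive_set product_sums :: "nat \<Rightarrow> ((nat \<Rightarrow> real) \<Rightarrow> real) set" for T where
  prod: "(\<And>t. continuous_on UNIV (g t)) \<Longrightarrow> (\<lambda>x. c * (\<Prod>t=1..T. g t (x t))) \<in> product_sums T"
| add: "F \<in> product_sums T \<Longrightarrow> G \<in> product_sums T \<Longrightarrow> (\<lambda>x. F x + G x) \<in> product_sums T"

lemma product_sums_mult:
  assumes "F \<in> product_sums T" "G \<in> product_sums T"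
  shows "(\<lambda>x. F x * G x) \<in> product_sums T"
  using assms(2)
proof induction
  case (prod h d)
  show ?case using assms(1)
  proof induction
    case (prod g c)
    have "(\<lambda>x. (c * (\<Prod>t=1..T. g t (x t))) * (d * (\<Prod>t=1..T. h t (x t)))) =
        (\<lambda>x. (c * d) * (\<Prod>t=1..T. g t (x t) * h t (x t)))"
      by (simp add: prod.distrib mult_ac)
    moreover have "\<dots> \<in> product_sums T"
      using prod \<open>\<And>t. continuous_on UNIV (h t)\<close>
      by (intro product_sums.prod[where g = "\<lambda>t y. g t y * h t y"] continuous_intros)
    ultimately show ?case by simp
  next
    case (add F G)
    then show ?case by (simp add: distrib_right product_sums.add)
  qed
next
  case (add G H)
  then show ?case by (simp add: distrib_left product_sums.add)
qed

lemma product_sums_continuous: "F \<in> product_sums T \<Longrightarrow> continuous_on UNIV F"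
proof (induction rule: product_sums.induct)
  case (prod g c)
  have "continuous_on UNIV (\<lambda>x :: nat \<Rightarrow> real. g t (x t))" for t
    using continuous_on_compose2[OF prod(1)[of t] continuous_on_product_coordinates[of t]] by simp
  then show ?case by (intro continuous_intros)
qed (intro continuous_intros)

lemma product_sums_ring: "function_ring_on (product_sums T) (cube T r)"
proof
  show "compact (cube T r)" by (rule compact_cube)
  show "continuous_on (cube T r) f" if "f \<in> product_sums T" for f
    using product_sums_continuous[OF that] by (rule continuous_on_subset) simp
  show "(\<lambda>x. f x + g x) \<in> product_sums T" "(\<lambda>x. f x * g x) \<in> product_sums T"
    if "f \<in> product_sums T" "g \<in> product_sums T" for f g
    using that by (auto intro: product_sums.add product_sums_mult)
  show "(\<lambda>_. c) \<in> product_sums T" for c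
    using product_sums.prod[of "\<lambda>_ _. 1" c T] by simp
  fix x y assume "x \<in> cube T r" "y \<in> cube T r" "x \<noteq> y"
  then obtain t where t: "t \<in> {1..T}" "x t \<noteq> y t"
    unfolding cube_def by (meson PiE_ext)
  have "continuous_on UNIV (\<lambda>y :: real. if s = t then y else 1)" for s
    by (cases "s = t") auto
  then have "(\<lambda>x. 1 * (\<Prod>s=1..T. (if s = t then x s else 1))) \<in> product_sums T"
    by (rule product_sums.prod[where g = "\<lambda>s y. if s = t then y else 1"])
  then have "(\<lambda>x. x t) \<in> product_sums T"
    using t by (simp add: prod.delta)
  then show "\<exists>f\<in>product_sums T. f x \<noteq> f y"
    using t(2) by (intro bexI[where x = "\<lambda>x. x t"])
qed

lemma clip_bounded_measurable:
  assumes "F \<in> product_sums T"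
  shows "(\<lambda>x. F (clip T r x)) \<in> borel_measurable (vec_space T)"
    and "r \<ge> 0 \<Longrightarrow> \<exists>D. \<forall>x. \<bar>F (clip T r x)\<bar> \<le> D"
proof -
  show "(\<lambda>x. F (clip T r x)) \<in> borel_measurable (vec_space T)"
    using assms
  proof induction
    case (prod g c)
    have [measurable]: "g t \<in> borel_measurable borel" for t
      using prod by (rule borel_measurable_continuous_onI)
    have "(\<lambda>x. c * (\<Prod>t=1..T. g t (max (- r) (min r (x t))))) \<in> borel_measurable (vec_space T)"
      by measurable
    also have "(\<lambda>x. c * (\<Prod>t=1..T. g t (max (- r) (min r (x t))))) =
        (\<lambda>x. c * (\<Prod>t=1..T. g t (clip T r x t)))"
      by (simp add: clip_def)
    finally show ?case .
  qed measurable
  assume "r \<ge> 0"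
  have "compact (F ` cube T r)"
    using product_sums_continuous[OF assms]
    by (intro compact_continuous_image compact_cube) (rule continuous_on_subset, auto)
  then show "\<exists>D. \<forall>x. \<bar>F (clip T r x)\<bar> \<le> D"
    using clip_in_cube[OF \<open>r \<ge> 0\<close>] compact_imp_bounded[of "F ` cube T r"]
    unfolding bounded_iff real_norm_def by blast
qed

lemma product_sums_converge:
  fixes P :: "nat \<Rightarrow> (nat \<Rightarrow> real) measure"
  assumes prob: "\<And>k. prob_space (P k)" "prob_space Q"
    and sets: "\<And>k. sets (P k) = sets (vec_space T)" "sets Q = sets (vec_space T)"
    and conv: "\<And>u c. (\<lambda>k. \<integral>x. cos (lin T u x + c) \<partial>P k) \<longlonglongrightarrow> (\<integral>x. cos (lin T u x + c) \<partial>Q)"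
    and r: "r \<ge> 0" and "F \<in> product_sums T"
  shows "(\<lambda>k. \<integral>x. F (clip T r x) \<partial>P k) \<longlonglongrightarrow> (\<integral>x. F (clip T r x) \<partial>Q)"
  using \<open>F \<in> product_sums T\<close>
proof induction
  case (prod g c)
  have "\<exists>D. \<forall>y. \<bar>g t (max (- r) (min r y))\<bar> \<le> D" for t
  proof -
    have "bounded (g t ` {-r..r})"
      by (intro compact_imp_bounded compact_continuous_image continuous_on_subset[OF prod[of t]]) auto
    then obtain D where D: "\<forall>y\<in>{-r..r}. \<bar>g t y\<bar> \<le> D"
      by (auto simp: bounded_iff)
    have "\<forall>y. \<bar>g t (max (- r) (min r y))\<bar> \<le> D" using r D by auto
    then show ?thesis ..
  qed
  then obtain D where D: "\<And>t y. \<bar>g t (max (- r) (min r y))\<bar> \<le> D t" by metis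
  \<comment> \<open>One bound for all indices is required, hence the factors with index outside \<open>{1..T}\<close> are
    replaced by 0.\<close>
  have DE: "\<bar>if t \<in> {1..T} then g t (max (- r) (min r y)) else 0\<bar> \<le> (\<Sum>t=1..T. \<bar>D t\<bar>)" for t y
  proof (cases "t \<in> {1..T}")
    case True
    have "\<bar>g t (max (- r) (min r y))\<bar> \<le> \<bar>D t\<bar>" using D[of t y] by linarith
    also have "\<dots> \<le> (\<Sum>t=1..T. \<bar>D t\<bar>)" using True by (intro member_le_sum) auto
    finally show ?thesis using True by simp
  next
    case False
    then show ?thesis by (auto intro!: sum_nonneg)
  qed
  have cg: "continuous_on UNIV (\<lambda>y. if t \<in> {1..T} then g t (max (- r) (min r y)) else 0)" for t
    by (cases "t \<in> {1..T}")
      (auto intro!: continuous_intros continuous_on_compose2[OF prod[of t]] continuous_on_max continuous_on_min)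
  have "(\<lambda>k. \<integral>x. (\<Prod>t\<in>{1..T}. if t \<in> {1..T} then g t (max (- r) (min r (x t))) else 0) * cos (lin T (\<lambda>_. 0) x + 0) \<partial>P k)
      \<longlonglongrightarrow> (\<integral>x. (\<Prod>t\<in>{1..T}. if t \<in> {1..T} then g t (max (- r) (min r (x t))) else 0) * cos (lin T (\<lambda>_. 0) x + 0) \<partial>Q)"
    by (rule product_weights_converge[OF prob sets conv _ _ cg DE]) auto
  then have "(\<lambda>k. c * \<integral>x. (\<Prod>t\<in>{1..T}. g t (clip T r x t)) \<partial>P k)
      \<longlonglongrightarrow> c * (\<integral>x. (\<Prod>t\<in>{1..T}. g t (clip T r x t)) \<partial>Q)"
    by (intro tendsto_intros) (simp add: clip_def cong: prod.cong_simp)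
  then show ?case by simp
next
  case (add F G)
  have int: "integrable p (\<lambda>x. H (clip T r x))" if p: "prob_space p" "sets p = sets (vec_space T)" and H: "H \<in> product_sums T" for p H
  proof -
    interpret prob_space p by fact
    obtain D where "\<forall>x. \<bar>H (clip T r x)\<bar> \<le> D" using clip_bounded_measurable(2)[OF H r] by blast
    then show ?thesis
      using clip_bounded_measurable(1)[OF H, of r] p(2)
      by (intro integrable_const_bound[where B = D]) (auto cong: measurable_cong_sets)
  qed
  show ?case
    using add int prob sets by (auto simp: intro!: tendsto_add)
qed

text \<open>
  The pattern of all truncation arguments below: the error terms converge, and their limit can be made small.
\<close>

lemma tendsto_by_approximation:
  fixes a :: "nat \<Rightarrow> real"
  assumes "\<And>e. e > 0 \<Longrightarrow> \<exists>b b' c c'. b \<longlonglongrightarrow> b' \<and> c \<longlonglongrightarrow> c' \<and> c' < e \<and>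
      (\<forall>k. \<bar>a k - b k\<bar> \<le> c k) \<and> \<bar>a' - b'\<bar> \<le> c'"
  shows "a \<longlonglongrightarrow> a'"
proof (rule tendstoI)
  fix e :: real assume e: "e > 0"
  then have "e / 3 > 0" by simp
  from assms[OF this] obtain b b' c c' where
    *: "b \<longlonglongrightarrow> b'" "c \<longlonglongrightarrow> c'" "c' < e / 3" "\<And>k. \<bar>a k - b k\<bar> \<le> c k" "\<bar>a' - b'\<bar> \<le> c'"
    by blast
  have "eventually (\<lambda>k. c k < e / 3) sequentially"
    using order_tendstoD(2)[OF *(2,3)] .
  moreover have "eventually (\<lambda>k. dist (b k) b' < e / 3) sequentially"
    using tendstoD[OF *(1) \<open>e / 3 > 0\<close>] .
  ultimately show "eventually (\<lambda>k. dist (a k) a' < e) sequentially"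
  proof eventually_elim
    case (elim k)
    then show ?case
      using *(3) *(4)[of k] *(5) unfolding dist_real_def by linarith
  qed
qed

text \<open>
  The continuity theorem in dimension \<open>T\<close>. On a large cube, \<open>f\<close> is uniformly close to a member of
  \<open>product_sums\<close>. Outside of it, the clipped approximation is still bounded, and the mass
  outside is controlled by the continuous functions \<open>out\<close> of single coordinates, so no separate
  tightness argument is needed.
\<close>

lemma bounded_continuous_converge:
  fixes P :: "nat \<Rightarrow> (nat \<Rightarrow> real) measure" and f :: "(nat \<Rightarrow> real) \<Rightarrow> real"
  assumes prob: "\<And>k. prob_space (P k)" "prob_space Q"
    and sets: "\<And>k. sets (P k) = sets (vec_space T)" "sets Q = sets (vec_space T)"
    and conv: "\<And>u c. (\<lambda>k. \<integral>x. cos (lin T u x + c) \<partial>P k) \<longlonglongrightarrow> (\<integral>x. cos (lin T u x + c) \<partial>Q)"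
    and f: "continuous_on UNIV f" "f \<in> borel_measurable (vec_space T)" "\<And>x. \<bar>f x\<bar> \<le> B"
  shows "(\<lambda>k. \<integral>x. f x \<partial>P k) \<longlonglongrightarrow> (\<integral>x. f x \<partial>Q)"
proof (rule tendsto_by_approximation)
  fix e0 :: real assume "e0 > 0"
  have B: "B \<ge> 0" using f(3)[of undefined] by linarith
  \<comment> \<open>The total error is at most e inside the cube and 2 * B + 1 times the mass outside of it,
    which is at most e.\<close>
  define e where "e = min 1 (e0 / (2 * (2 * B + 2)))"
  have e: "e > 0" "e \<le> 1" "e + (2 * B + 1) * e < e0"
  proof -
    show "e > 0" "e \<le> 1" using \<open>e0 > 0\<close> B by (auto simp: e_def)
    have "2 * (2 * B + 2) * e \<le> 2 * (2 * B + 2) * (e0 / (2 * (2 * B + 2)))"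
      using B by (intro mult_left_mono) (auto simp: e_def)
    also have "\<dots> = e0" using B by simp
    finally have "2 * (e + (2 * B + 1) * e) \<le> e0" by (simp add: algebra_simps)
    moreover have "0 < e + (2 * B + 1) * e" using B \<open>e > 0\<close> by (simp add: add_pos_nonneg)
    ultimately show "e + (2 * B + 1) * e < e0"
      by (simp only: mult_2 flip: not_le)
  qed
  \<comment> \<open>A continuous function between the indicators of the sets where |y| is at least r + 1 and at least r.\<close>
  define \<psi> where "\<psi> r y = max 0 (min 1 (\<bar>y\<bar> - r))" for r y :: real
  have psi01: "0 \<le> \<psi> r y" "\<psi> r y \<le> 1" for r y by (auto simp: \<psi>_def)
  define out where "out r x = (\<Sum>t=1..T. \<psi> r (x t))" for r and x :: "nat \<Rightarrow> real"
  have psim [measurable]: "\<psi> r \<in> borel_measurable borel" for r unfolding \<psi>_def[abs_def] by measurable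
  have outm [measurable]: "out r \<in> borel_measurable (vec_space T)" for r
    unfolding out_def[abs_def] by measurable
  note [measurable_cong] = sets
  note [measurable] = f(2)
  have bound: "integrable p h" if "prob_space p" "sets p = sets (vec_space T)"
     "h \<in> borel_measurable (vec_space T)" "\<And>x. \<bar>h x\<bar> \<le> C" for p and h :: "_ \<Rightarrow> real" and C
  proof -
    interpret prob_space p by fact
    show ?thesis using that(2,3,4)
      by (intro integrable_const_bound[where B = C]) (auto cong: measurable_cong_sets)
  qed
  have outb: "\<bar>out r x\<bar> \<le> real T" for r x
  proof -
    have "\<bar>out r x\<bar> = out r x" unfolding out_def by (intro abs_of_nonneg sum_nonneg psi01)
    also have "\<dots> \<le> (\<Sum>t=1..T. 1)" unfolding out_def by (intro sum_mono psi01)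
    finally show ?thesis by simp
  qed
  have "(\<lambda>n. \<integral>x. out (real n) x \<partial>Q) \<longlonglongrightarrow> (\<integral>x. 0 \<partial>Q)"
  proof (rule integral_dominated_convergence[where w = "\<lambda>_. real T"])
    interpret prob_space Q by (rule prob)
    show "integrable Q (\<lambda>_. real T)" by simp
    show "AE x in Q. (\<lambda>n. out (real n) x) \<longlonglongrightarrow> 0"
    proof (rule AE_I2)
      fix x
      have "(\<lambda>n. \<psi> (real n) y) \<longlonglongrightarrow> 0" for y
      proof (rule tendsto_eventually)
        have "eventually (\<lambda>n. real n \<ge> \<bar>y\<bar>) sequentially"
          using filterlim_real_sequentially by (simp add: filterlim_at_top)
        then show "eventually (\<lambda>n. \<psi> (real n) y = 0) sequentially"
          by eventually_elim (auto simp: \<psi>_def)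
      qed
      then have "(\<lambda>n. out (real n) x) \<longlonglongrightarrow> (\<Sum>t=1..T. 0)"
        unfolding out_def by (intro tendsto_sum)
      then show "(\<lambda>n. out (real n) x) \<longlonglongrightarrow> 0" by simp
    qed
  qed (use outb in auto)
  then have "eventually (\<lambda>n. (\<integral>x. out (real n) x \<partial>Q) < e) sequentially"
    using order_tendstoD(2)[of _ 0 _ e] e by simp
  then obtain n where n: "(\<integral>x. out (real n) x \<partial>Q) < e"
    by (auto simp: eventually_sequentially)
  define r where "r = real n + 1"
  have r: "r \<ge> 0" by (simp add: r_def)
  have outside: "1 \<le> out (real n) x" if "x \<in> space (vec_space T)" "x \<notin> cube T r" for x
  proof -
    from that obtain t where t: "t \<in> {1..T}" "\<bar>x t\<bar> > r"
      by (auto simp: cube_def space_PiM PiE_iff)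
    then have "1 = \<psi> (real n) (x t)" by (auto simp: \<psi>_def r_def)
    also have "\<dots> \<le> out (real n) x"
      unfolding out_def using t psi01 by (intro member_le_sum) auto
    finally show ?thesis .
  qed
  interpret ring: function_ring_on "product_sums T" "cube T r" by (rule product_sums_ring)
  obtain F where F: "F \<in> product_sums T" "\<And>x. x \<in> cube T r \<Longrightarrow> \<bar>f x - F x\<bar> < e"
    using ring.Stone_Weierstrass_basic[OF continuous_on_subset[OF f(1)] \<open>e > 0\<close>] by auto
  define G where "G x = F (clip T r x)" for x
  have Gm [measurable]: "G \<in> borel_measurable (vec_space T)"
    unfolding G_def[abs_def] by (rule clip_bounded_measurable[OF F(1)])
  have Gb: "\<bar>G x\<bar> \<le> B + 1" for x
    using F(2)[OF clip_in_cube[OF r, of T x]] f(3)[of "clip T r x"] e by (auto simp: G_def)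
  have close: "\<bar>f x - G x\<bar> \<le> e + (2 * B + 1) * out (real n) x" if x: "x \<in> space (vec_space T)" for x
  proof (cases "x \<in> cube T r")
    case True
    have "0 \<le> out (real n) x" unfolding out_def by (intro sum_nonneg psi01)
    then show ?thesis using F(2)[OF True] B clip_id[OF True] by (auto simp: G_def add_increasing2)
  next
    case False
    have "\<bar>f x - G x\<bar> \<le> (2 * B + 1) * 1" using f(3)[of x] Gb[of x] by auto
    also have "\<dots> \<le> (2 * B + 1) * out (real n) x" using outside[OF x False] B by (intro mult_left_mono) auto
    finally show ?thesis using e by simp
  qed
  have est: "\<bar>(\<integral>x. f x \<partial>p) - (\<integral>x. G x \<partial>p)\<bar> \<le> e + (2 * B + 1) * (\<integral>x. out (real n) x \<partial>p)"
    if p: "prob_space p" "sets p = sets (vec_space T)" for p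
  proof -
    interpret prob_space p by fact
    note i = bound[OF p f(2,3)] bound[OF p Gm Gb] bound[OF p outm outb]
    have sp: "space p = space (vec_space T)" using p(2) by (rule sets_eq_imp_space_eq)
    have "\<bar>(\<integral>x. f x \<partial>p) - (\<integral>x. G x \<partial>p)\<bar> = \<bar>\<integral>x. f x - G x \<partial>p\<bar>"
      using i by simp
    also have "\<dots> \<le> (\<integral>x. \<bar>f x - G x\<bar> \<partial>p)" by (rule integral_abs_bound)
    also have "\<dots> \<le> (\<integral>x. e + (2 * B + 1) * out (real n) x \<partial>p)"
      using i close sp by (intro integral_mono) auto
    also have "\<dots> = e + (2 * B + 1) * (\<integral>x. out (real n) x \<partial>p)"
      using i by (simp add: prob_space)
    finally show ?thesis .
  qed
  have outconv: "(\<lambda>k. \<integral>x. out (real n) x \<partial>P k) \<longlonglongrightarrow> (\<integral>x. out (real n) x \<partial>Q)"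
  proof -
    have one: "(\<lambda>k. \<integral>x. \<psi> (real n) (x t) \<partial>P k) \<longlonglongrightarrow> (\<integral>x. \<psi> (real n) (x t) \<partial>Q)"
      if t: "t \<in> {1..T}" for t
    proof -
      have "(\<lambda>k. \<integral>x. (\<Prod>t\<in>{t}. \<psi> (real n) (x t)) * cos (lin T (\<lambda>_. 0) x + 0) \<partial>P k)
        \<longlonglongrightarrow> (\<integral>x. (\<Prod>t\<in>{t}. \<psi> (real n) (x t)) * cos (lin T (\<lambda>_. 0) x + 0) \<partial>Q)"
        by (rule product_weights_converge[OF prob sets conv, where D = 1])
           (use t psi01 in \<open>auto simp: \<psi>_def intro!: continuous_intros continuous_on_max continuous_on_min\<close>)
      then show ?thesis by simp
    qed
    have i: "integrable p (\<lambda>x. \<psi> (real n) (x t))" 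
      if "prob_space p" "sets p = sets (vec_space T)" "t \<in> {1..T}" for p t
      by (rule bound[OF that(1,2), where C = 1]) (use that(3) psi01 in auto)
    show ?thesis
      unfolding out_def using one i prob sets
      by (subst (1 2) Bochner_Integration.integral_sum) (auto intro!: tendsto_sum)
  qed
  have "(2 * B + 1) * (\<integral>x. out (real n) x \<partial>Q) \<le> (2 * B + 1) * e"
    using n B by (intro mult_left_mono) auto
  then show "\<exists>b b' c c'. b \<longlonglongrightarrow> b' \<and> c \<longlonglongrightarrow> c' \<and> c' < e0 \<and>
      (\<forall>k. \<bar>(\<integral>x. f x \<partial>P k) - b k\<bar> \<le> c k) \<and> \<bar>(\<integral>x. f x \<partial>Q) - b'\<bar> \<le> c'"
    using est[OF prob(1) sets(1)] est[OF prob(2) sets(2)] e(3)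
      product_sums_converge[OF prob sets conv r F(1)]
    by (intro exI[of _ "\<lambda>k. \<integral>x. G x \<partial>P k"] exI[of _ "\<integral>x. G x \<partial>Q"]
        exI[of _ "\<lambda>k. e + (2 * B + 1) * (\<integral>x. out (real n) x \<partial>P k)"]
        exI[of _ "e + (2 * B + 1) * (\<integral>x. out (real n) x \<partial>Q)"] conjI allI tendsto_intros outconv)
       (auto simp: G_def)
qed

section \<open>Gaussian laws and their characteristic functions\<close>

lemma char_normal_law:
  assumes "s \<ge> 0"
  shows "char (normal_law 0 s) t = exp (- (s * t)\<^sup>2 / 2)"
proof (cases "s = 0")
  case True
  then show ?thesis by (simp add: normal_law_def char_def integral_return)
next
  case False
  interpret real_distribution std_normal_distribution by (rule real_dist_normal_dist)
  have "distributed std_normal_distribution lborel (\<lambda>x. x) std_normal_density"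
    by (auto simp: distributed_def normal_density_nonneg distr_id2)
  then have "distributed std_normal_distribution lborel (\<lambda>x. 0 + s * x) (normal_density (0 + s * 0) (\<bar>s\<bar> * 1))"
    by (rule normal_density_affine) (use False in auto)
  then have "distr std_normal_distribution lborel (\<lambda>x. s * x) = density lborel (normal_density 0 s)"
    using assms by (simp add: distributed_def)
  then have *: "normal_law 0 s = distr std_normal_distribution borel (\<lambda>x. s * x)"
    using False by (simp add: normal_law_def cong: distr_cong)
  have "char (normal_law 0 s) t = char std_normal_distribution (s * t)"
    unfolding * char_def by (subst integral_distr) (auto simp: mult_ac)
  then show ?thesis by (simp add: char_std_normal_distribution)
qed

lemma real_distribution_normal_law: "real_distribution (normal_law m s)" if "s \<ge> 0"
  using that prob_space_normal_density[of s m] prob_space_return[of m borel]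
  by (auto simp: normal_law_def real_distribution_def real_distribution_axioms_def)

text \<open>
  Centred normal laws described by the variances \<open>q u\<close> of the projections, which is all that the
  limit theorems use; \<open>q\<close> is a quadratic form in the applications.
\<close>

definition gaussian_law :: "nat \<Rightarrow> ((nat \<Rightarrow> real) \<Rightarrow> real) \<Rightarrow> (nat \<Rightarrow> real) measure \<Rightarrow> bool" where
  "gaussian_law T q L \<longleftrightarrow> prob_space L \<and> sets L = sets (vec_space T) \<and>
     (\<forall>u. 0 \<le> q u \<and> distr L borel (lin T u) = normal_law 0 (sqrt (q u)))"

text \<open>
  The multivariate characteristic function at \<open>u\<close>, as the value at \<open>1\<close> of the characteristic
  function of the projection along \<open>u\<close>.
\<close>

definition char_fun :: "nat \<Rightarrow> (nat \<Rightarrow> real) measure \<Rightarrow> (nat \<Rightarrow> real) \<Rightarrow> complex" where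
  "char_fun T p u = char (distr p borel (lin T u)) 1"

lemma char_fun_gaussian: "gaussian_law T q L \<Longrightarrow> char_fun T L u = exp (- q u / 2)"
  by (simp add: char_fun_def gaussian_law_def char_normal_law)

lemma char_fun_integral:
  assumes "sets p = sets (vec_space T)"
  shows "char_fun T p u = (\<integral>x. iexp (lin T u x) \<partial>p)"
proof -
  have [measurable]: "lin T u \<in> borel_measurable p"
    using measurable_lin assms by (simp cong: measurable_cong_sets)
  show ?thesis unfolding char_fun_def char_def by (subst integral_distr) auto
qed

lemma integral_cos_char_fun:
  assumes "prob_space p" "sets p = sets (vec_space T)"
  shows "(\<integral>x. cos (lin T u x + c) \<partial>p) = Re (cis c * char_fun T p u)"
proof -
  interpret prob_space p by fact
  have [measurable]: "lin T u \<in> borel_measurable p"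
    using measurable_lin assms(2) by (simp cong: measurable_cong_sets)
  have int: "integrable p (\<lambda>x. cis c * iexp (lin T u x))"
    by (intro integrable_const_bound[where B = 1]) (auto simp: norm_mult)
  have "cis c * char_fun T p u = (\<integral>x. cis c * iexp (lin T u x) \<partial>p)"
    using char_fun_integral[OF assms(2)] by simp
  then have "Re (cis c * char_fun T p u) = (\<integral>x. Re (cis c * iexp (lin T u x)) \<partial>p)"
    by (simp only: integral_Re[OF int])
  also have "\<dots> = (\<integral>x. cos (lin T u x + c) \<partial>p)"
    by (simp add: cos_add Re_exp Im_exp cis_conv_exp[symmetric] mult_ac)
  finally show ?thesis by simp
qed

lemma gaussian_degenerate:
  assumes "gaussian_law T q L" "q u = 0"
  shows "AE x in L. lin T u x = 0"
proof -
  interpret prob_space L using assms by (simp add: gaussian_law_def)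
  have [measurable]: "lin T u \<in> borel_measurable L"
    using measurable_lin assms(1) by (simp add: gaussian_law_def cong: measurable_cong_sets)
  have "AE y in distr L borel (lin T u). y = 0"
  proof -
    have *: "distr L borel (lin T u) = return borel 0"
      using assms unfolding gaussian_law_def normal_law_def by (metis real_sqrt_zero)
    show ?thesis unfolding * by (simp add: AE_return)
  qed
  then show ?thesis by (subst (asm) AE_distr_iff) auto
qed

lemma gaussian_nondegenerate:
  assumes "gaussian_law T q L" "q u \<noteq> 0"
  shows "AE x in L. lin T u x \<noteq> 0"
proof -
  have [measurable]: "lin T u \<in> borel_measurable L"
    using measurable_lin assms(1) by (simp add: gaussian_law_def cong: measurable_cong_sets)
  have "AE y in distr L borel (lin T u). y \<noteq> 0"
  proof -
    have *: "distr L borel (lin T u) = density lborel (normal_density 0 (sqrt (q u)))"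
      using assms unfolding gaussian_law_def normal_law_def by (metis real_sqrt_eq_zero_cancel_iff)
    show ?thesis
      unfolding * using AE_lborel_singleton[of "0 :: real"] by (auto simp: AE_density)
  qed
  then show ?thesis by (subst (asm) AE_distr_iff) auto
qed

section \<open>Weak convergence of the ratio\<close>

definition numer :: "nat \<Rightarrow> (nat \<Rightarrow> real) \<Rightarrow> real" where
  "numer t x = (MAX s\<in>{1..t}. \<bar>x s - real s / real t * x t\<bar>)"

text \<open>
  The linear forms \<open>Z\<^sub>s - ((T-s)/(T-t)) Z\<^sub>t\<close> with \<open>Z\<^sub>s = X\<^sub>T - X\<^sub>s\<close> in the denominator of the ratio.
\<close>

definition tail_dev :: "nat \<Rightarrow> nat \<Rightarrow> nat \<Rightarrow> (nat \<Rightarrow> real) \<Rightarrow> real" where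
  "tail_dev T t s x = (x T - x s) - real (T - s) / real (T - t) * (x T - x t)"

definition denom :: "nat \<Rightarrow> nat \<Rightarrow> (nat \<Rightarrow> real) \<Rightarrow> real" where
  "denom T t x = (MAX s\<in>{t..T-1}. \<bar>tail_dev T t s x\<bar>)"

lemma limit_ratio_eq: "limit_ratio T x = (MAX t\<in>{2..T-2}. numer t x / denom T t x)"
  by (simp add: limit_ratio_def numer_def denom_def tail_dev_def)

definition tail_coeff :: "nat \<Rightarrow> nat \<Rightarrow> nat \<Rightarrow> nat \<Rightarrow> real" where
  "tail_coeff T t s v = (let c = real (T - s) / real (T - t) in
     (if v = T then 1 - c else 0) - (if v = s then 1 else 0) + (if v = t then c else 0))"

lemma lin_tail_coeff:
  assumes "t \<in> {2..T-2}" "s \<in> {t..T-1}"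
  shows "lin T (tail_coeff T t s) x = tail_dev T t s x"
proof -
  define c where "c = real (T - s) / real (T - t)"
  have "lin T (tail_coeff T t s) x =
      (\<Sum>v=1..T. (if v = T then (1 - c) * x T else 0) - (if v = s then x s else 0) + (if v = t then c * x t else 0))"
    unfolding lin_def by (intro sum.cong) (auto simp: tail_coeff_def c_def[symmetric] Let_def algebra_simps)
  also have "\<dots> = (1 - c) * x T - x s + c * x t"
  proof -
    have "s \<in> {1..T}" "t \<in> {1..T}" "T \<in> {1..T}" using assms by auto
    then show ?thesis by (simp only: sum.distrib sum_subtractf sum.delta finite_atLeastAtMost if_True)
  qed
  finally show ?thesis by (simp add: tail_dev_def c_def[symmetric] algebra_simps)
qed

lemma continuous_on_MAX:
  fixes f :: "'i \<Rightarrow> 'c :: topological_space \<Rightarrow> real"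
  assumes "finite A" "A \<noteq> {}" "\<And>i. i \<in> A \<Longrightarrow> continuous_on S (f i)"
  shows "continuous_on S (\<lambda>x. MAX i\<in>A. f i x)"
  using assms
proof (induction A rule: finite_ne_induct)
  case (insert i A)
  then have "(\<lambda>x. MAX i\<in>insert i A. f i x) = (\<lambda>x. max (f i x) (MAX i\<in>A. f i x))"
    by (auto simp: fun_eq_iff)
  with insert show ?case by (auto intro!: continuous_on_max)
qed simp

lemma measurable_MAX:
  fixes f :: "'i \<Rightarrow> 'c \<Rightarrow> real"
  assumes "finite A" "A \<noteq> {}" "\<And>i. i \<in> A \<Longrightarrow> f i \<in> borel_measurable M"
  shows "(\<lambda>x. MAX i\<in>A. f i x) \<in> borel_measurable M"
  using assms
proof (induction A rule: finite_ne_induct)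
  case (insert i A)
  then have "(\<lambda>x. MAX i\<in>insert i A. f i x) = (\<lambda>x. max (f i x) (MAX i\<in>A. f i x))"
    by (auto simp: fun_eq_iff)
  with insert show ?case by (auto intro!: borel_measurable_max)
qed simp

lemma continuous_numer: "t \<ge> 1 \<Longrightarrow> continuous_on UNIV (numer t)"
  unfolding numer_def[abs_def] by (intro continuous_on_MAX continuous_intros) auto

lemma continuous_denom: "t \<in> {2..T-2} \<Longrightarrow> continuous_on UNIV (denom T t)"
  unfolding denom_def[abs_def] tail_dev_def by (intro continuous_on_MAX continuous_intros) auto

lemma measurable_numer: "t \<in> {2..T-2} \<Longrightarrow> numer t \<in> borel_measurable (vec_space T)"
  unfolding numer_def[abs_def]
  by (intro measurable_MAX borel_measurable_abs borel_measurable_diff borel_measurable_times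
      borel_measurable_const measurable_component_singleton) auto

lemma measurable_denom: "t \<in> {2..T-2} \<Longrightarrow> denom T t \<in> borel_measurable (vec_space T)"
  unfolding denom_def[abs_def] tail_dev_def
  by (intro measurable_MAX borel_measurable_abs borel_measurable_diff borel_measurable_times
      borel_measurable_const measurable_component_singleton) auto

lemma measurable_limit_ratio: "T \<ge> 4 \<Longrightarrow> limit_ratio T \<in> borel_measurable (vec_space T)"
  unfolding limit_ratio_eq[abs_def]
  by (intro measurable_MAX borel_measurable_divide measurable_numer measurable_denom) auto

lemma denom_ge: "t \<in> {2..T-2} \<Longrightarrow> s \<in> {t..T-1} \<Longrightarrow> \<bar>tail_dev T t s x\<bar> \<le> denom T t x"
  unfolding denom_def by (auto intro: Max_ge)

lemma denom_zero:
  assumes "t \<in> {2..T-2}" "\<And>s. s \<in> {t..T-1} \<Longrightarrow> tail_dev T t s x = 0"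
  shows "denom T t x = 0"
proof -
  have "t \<in> {t..T-1}" using assms(1) by auto
  then have "(\<lambda>s. \<bar>tail_dev T t s x\<bar>) ` {t..T-1} = {0}" using assms(2) by (simp cong: image_cong_simp) auto
  then show ?thesis unfolding denom_def by simp
qed

text \<open>
  A version of the ratio that is continuous everywhere: \<open>D\<close> is meant to be the set of those \<open>t\<close> whose denominator
  does not vanish almost surely in the limit, and the denominators are kept above \<open>1/m\<close>.
\<close>

definition trunc_ratio :: "nat \<Rightarrow> nat set \<Rightarrow> real \<Rightarrow> (nat \<Rightarrow> real) \<Rightarrow> real" where
  "trunc_ratio T D m x = (MAX t\<in>{2..T-2}. if t \<in> D then numer t x / max (denom T t x) (1 / m) else 0)"

text \<open>
  A continuous upper bound for the indicator of the event that a denominator in \<open>D\<close> is at most \<open>1/m\<close>.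
\<close>

definition denom_small :: "nat \<Rightarrow> nat set \<Rightarrow> real \<Rightarrow> (nat \<Rightarrow> real) \<Rightarrow> real" where
  "denom_small T D m x = (\<Sum>t\<in>D. max 0 (min 1 (2 - m * denom T t x)))"

text \<open>
  The hypothesis \<open>degenerate\<close> demands that a linear form in a denominator that vanishes almost surely in the limit
  also vanishes almost surely along the sequence. Then the quotients with vanishing denominators are
  \<open>0\<close> throughout. The other denominators are almost surely positive in the limit, so \<open>limit_ratio\<close> differs from the
  continuous \<open>trunc_ratio\<close> only on events whose probability is small in the limit, and by weak
  convergence also along the sequence.
\<close>

lemma limit_ratio_weak_conv:
  fixes P :: "nat \<Rightarrow> (nat \<Rightarrow> real) measure"
  assumes T: "T \<ge> 4"
    and P: "\<And>k. prob_space (P k)" "\<And>k. sets (P k) = sets (vec_space T)"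
    and Q: "gaussian_law T q Q"
    and conv: "\<And>u. (\<lambda>k. char_fun T (P k) u) \<longlonglongrightarrow> char_fun T Q u"
    and degenerate: "\<And>k t s. t \<in> {2..T-2} \<Longrightarrow> s \<in> {t..T-1} \<Longrightarrow> q (tail_coeff T t s) = 0 \<Longrightarrow>
       AE x in P k. tail_dev T t s x = 0"
  shows "weak_conv_m (\<lambda>k. distr (P k) borel (limit_ratio T)) (distr Q borel (limit_ratio T))"
proof -
  have Q': "prob_space Q" "sets Q = sets (vec_space T)" using Q by (auto simp: gaussian_law_def)
  define D where "D = {t\<in>{2..T-2}. \<exists>s\<in>{t..T-1}. q (tail_coeff T t s) \<noteq> 0}"
  have D: "D \<subseteq> {2..T-2}" "finite D" by (auto simp: D_def)
  have degQ: "AE x in Q. \<forall>t\<in>{2..T-2} - D. denom T t x = 0"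
  proof (rule AE_ball_countable')
    fix t assume t: "t \<in> {2..T-2} - D"
    have "AE x in Q. \<forall>s\<in>{t..T-1}. lin T (tail_coeff T t s) x = 0"
      using t by (intro AE_ball_countable' gaussian_degenerate[OF Q]) (auto simp: D_def)
    then show "AE x in Q. denom T t x = 0"
      by eventually_elim (use t in \<open>auto intro!: denom_zero simp: lin_tail_coeff[symmetric]\<close>)
  qed auto
  have degP: "AE x in P k. \<forall>t\<in>{2..T-2} - D. denom T t x = 0" for k
  proof (rule AE_ball_countable')
    fix t assume t: "t \<in> {2..T-2} - D"
    have "AE x in P k. \<forall>s\<in>{t..T-1}. tail_dev T t s x = 0"
      using t by (intro AE_ball_countable' degenerate) (auto simp: D_def)
    then show "AE x in P k. denom T t x = 0"
      by eventually_elim (use t in \<open>auto intro!: denom_zero\<close>)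
  qed auto
  have nondeg: "AE x in Q. \<forall>t\<in>D. denom T t x > 0"
  proof (rule AE_ball_countable')
    fix t assume t: "t \<in> D"
    then obtain s where s: "s \<in> {t..T-1}" "q (tail_coeff T t s) \<noteq> 0" by (auto simp: D_def)
    have t': "t \<in> {2..T-2}" using t D by auto
    show "AE x in Q. denom T t x > 0"
      using gaussian_nondegenerate[OF Q s(2)]
    proof eventually_elim
      case (elim x)
      then have "\<bar>tail_dev T t s x\<bar> > 0" using lin_tail_coeff[OF t' s(1)] by simp
      then show ?case using denom_ge[OF t' s(1), of x] by linarith
    qed
  qed (use D countable_finite in auto)
  have conv': "(\<lambda>k. \<integral>x. cos (lin T u x + c) \<partial>P k) \<longlonglongrightarrow> (\<integral>x. cos (lin T u x + c) \<partial>Q)" for u c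
    unfolding integral_cos_char_fun[OF P] integral_cos_char_fun[OF Q'] by (intro tendsto_intros conv)
  have nzm [measurable]: "denom_small T D m \<in> borel_measurable (vec_space T)" for m
    unfolding denom_small_def[abs_def]
    by (intro borel_measurable_sum borel_measurable_max borel_measurable_min borel_measurable_diff
        borel_measurable_times borel_measurable_const measurable_denom) (use D in auto)
  have nzc: "continuous_on UNIV (denom_small T D m)" for m
    unfolding denom_small_def[abs_def]
    by (intro continuous_intros continuous_on_max continuous_on_min continuous_denom) (use D in auto)
  have nz0: "0 \<le> denom_small T D m x" for m x unfolding denom_small_def by (intro sum_nonneg) auto
  have nzb: "\<bar>denom_small T D m x\<bar> \<le> real (card D)" for m x
    using nz0[of m x] sum_bounded_above[of D "\<lambda>t. max 0 (min 1 (2 - m * denom T t x))" 1]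
    by (simp add: denom_small_def)
  have trm [measurable]: "trunc_ratio T D m \<in> borel_measurable (vec_space T)" for m
  proof -
    have "(\<lambda>x. if t \<in> D then numer t x / max (denom T t x) (1 / m) else 0) \<in> borel_measurable (vec_space T)"
      if "t \<in> {2..T-2}" for t
      using measurable_numer[OF that] measurable_denom[OF that] by (cases "t \<in> D") auto
    then show ?thesis
      unfolding trunc_ratio_def[abs_def] using T by (intro measurable_MAX) auto
  qed
  have trc: "continuous_on UNIV (trunc_ratio T D m)" if "m > 0" for m
  proof -
    have "continuous_on UNIV (\<lambda>x. if t \<in> D then numer t x / max (denom T t x) (1 / m) else 0)"
      if "t \<in> {2..T-2}" for t
    proof -
      have "max (denom T t x) (1 / m) \<noteq> 0" for x
        using \<open>m > 0\<close> less_max_iff_disj[of 0 "denom T t x" "1 / m"] by auto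
      then show ?thesis
        using that by (cases "t \<in> D") (auto intro!: continuous_intros continuous_on_max continuous_numer continuous_denom)
    qed
    then show ?thesis
      unfolding trunc_ratio_def[abs_def] using T by (intro continuous_on_MAX) auto
  qed
  have main: "(\<lambda>k. \<integral>x. g (limit_ratio T x) \<partial>P k) \<longlonglongrightarrow> (\<integral>x. g (limit_ratio T x) \<partial>Q)"
    if g: "continuous_on UNIV g" "\<And>y. \<bar>g y\<bar> \<le> 1" for g :: "real \<Rightarrow> real"
  proof (rule tendsto_by_approximation)
    fix e :: real assume e: "e > 0"
    have gm [measurable]: "g \<in> borel_measurable borel"
      using g(1) by (rule borel_measurable_continuous_onI)
    have "(\<lambda>n. \<integral>x. denom_small T D (real n) x \<partial>Q) \<longlonglongrightarrow> (\<integral>x. 0 \<partial>Q)"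
    proof (rule integral_dominated_convergence[where w = "\<lambda>_. real (card D)"])
      interpret prob_space Q by (rule Q')
      show "integrable Q (\<lambda>_. real (card D))" by simp
      show "AE x in Q. (\<lambda>n. denom_small T D (real n) x) \<longlonglongrightarrow> 0"
        using nondeg
      proof eventually_elim
        case (elim x)
        have "(\<lambda>n. max 0 (min 1 (2 - real n * denom T t x))) \<longlonglongrightarrow> 0" if "t \<in> D" for t
        proof (rule tendsto_eventually)
          have "filterlim (\<lambda>n. real n * denom T t x) at_top sequentially"
            using elim that by (intro filterlim_at_top_mult_tendsto_pos[OF tendsto_const _ filterlim_real_sequentially]) auto
          then have "eventually (\<lambda>n. real n * denom T t x \<ge> 2) sequentially"
            by (simp add: filterlim_at_top)
          then show "eventually (\<lambda>n. max 0 (min 1 (2 - real n * denom T t x)) = 0) sequentially"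
            by eventually_elim auto
        qed
        then have "(\<lambda>n. denom_small T D (real n) x) \<longlonglongrightarrow> (\<Sum>t\<in>D. 0)"
          unfolding denom_small_def by (intro tendsto_sum)
        then show ?case by simp
      qed
    qed (use nzb Q' nzm in \<open>auto cong: measurable_cong_sets\<close>)
    then have "eventually (\<lambda>n. (\<integral>x. denom_small T D (real n) x \<partial>Q) < e / 2) sequentially"
      using order_tendstoD(2)[of _ 0 _ "e / 2"] e by simp
    moreover have "eventually (\<lambda>n. n \<ge> 1) sequentially" by (rule eventually_ge_at_top)
    ultimately have "eventually (\<lambda>n. n \<ge> 1 \<and> (\<integral>x. denom_small T D (real n) x \<partial>Q) < e / 2) sequentially"
      by eventually_elim auto
    then obtain n where n: "n \<ge> 1" "(\<integral>x. denom_small T D (real n) x \<partial>Q) < e / 2"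
      by (auto simp: eventually_sequentially)
    define h where "h x = g (trunc_ratio T D (real n) x)" for x
    have hm [measurable]: "h \<in> borel_measurable (vec_space T)"
      unfolding h_def[abs_def] by measurable
    have hc: "continuous_on UNIV h"
      unfolding h_def[abs_def] using n
      by (intro continuous_on_compose2[OF g(1)] trc) auto
    have est: "\<bar>(\<integral>x. g (limit_ratio T x) \<partial>p) - (\<integral>x. h x \<partial>p)\<bar> \<le> 2 * (\<integral>x. denom_small T D (real n) x \<partial>p)"
      if p: "prob_space p" "sets p = sets (vec_space T)" and deg: "AE x in p. \<forall>t\<in>{2..T-2} - D. denom T t x = 0" for p
    proof -
      interpret prob_space p by (rule p)
      note [measurable_cong] = p(2)
      note [measurable] = measurable_limit_ratio[OF T]
      have i: "integrable p (\<lambda>x. g (limit_ratio T x))" "integrable p h" "integrable p (denom_small T D (real n))"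
        by (intro integrable_const_bound[where B = 1], use g in simp, measurable)
           (intro integrable_const_bound[where B = 1], use g in \<open>simp add: h_def\<close>, measurable,
            intro integrable_const_bound[where B = "real (card D)"], use nzb in simp, measurable)
      have "\<bar>(\<integral>x. g (limit_ratio T x) \<partial>p) - (\<integral>x. h x \<partial>p)\<bar> = \<bar>\<integral>x. g (limit_ratio T x) - h x \<partial>p\<bar>"
        using i by simp
      also have "\<dots> \<le> (\<integral>x. \<bar>g (limit_ratio T x) - h x\<bar> \<partial>p)" by (rule integral_abs_bound)
      also have "\<dots> \<le> (\<integral>x. 2 * denom_small T D (real n) x \<partial>p)"
      proof (rule integral_mono_AE)
        show "AE x in p. \<bar>g (limit_ratio T x) - h x\<bar> \<le> 2 * denom_small T D (real n) x"
          using deg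
        proof eventually_elim
          case (elim x)
          show ?case
          proof (cases "\<exists>t\<in>D. denom T t x \<le> 1 / real n")
            case True
            then obtain t where t: "t \<in> D" "denom T t x \<le> 1 / real n" by blast
            have "real n * denom T t x \<le> 1" using t(2) n by (simp add: field_simps)
            then have "1 = max 0 (min 1 (2 - real n * denom T t x))" by simp
            also have "\<dots> \<le> denom_small T D (real n) x"
              unfolding denom_small_def using t(1) D by (intro member_le_sum) auto
            finally show ?thesis
              using g(2)[of "limit_ratio T x"] g(2)[of "trunc_ratio T D (real n) x"] unfolding h_def by linarith
          next
            case False
            have "limit_ratio T x = trunc_ratio T D (real n) x"
              unfolding limit_ratio_eq trunc_ratio_def
              using False elim by (intro arg_cong[where f = Max] image_cong) (auto simp: max_def)
            then show ?thesis using nz0[of "real n" x] by (simp add: h_def)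
          qed
        qed
      qed (use i in auto)
      also have "\<dots> = 2 * (\<integral>x. denom_small T D (real n) x \<partial>p)" by simp
      finally show ?thesis .
    qed
    have "(\<lambda>k. \<integral>x. h x \<partial>P k) \<longlonglongrightarrow> (\<integral>x. h x \<partial>Q)"
      by (rule bounded_continuous_converge[OF P(1) Q'(1) P(2) Q'(2) conv' hc hm, where B = 1]) (simp add: h_def g)
    moreover have "(\<lambda>k. \<integral>x. denom_small T D (real n) x \<partial>P k) \<longlonglongrightarrow> (\<integral>x. denom_small T D (real n) x \<partial>Q)"
      by (rule bounded_continuous_converge[OF P(1) Q'(1) P(2) Q'(2) conv' nzc nzm nzb])
    ultimately show "\<exists>b b' c c'. b \<longlonglongrightarrow> b' \<and> c \<longlonglongrightarrow> c' \<and> c' < e \<and>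
      (\<forall>k. \<bar>(\<integral>x. g (limit_ratio T x) \<partial>P k) - b k\<bar> \<le> c k) \<and> \<bar>(\<integral>x. g (limit_ratio T x) \<partial>Q) - b'\<bar> \<le> c'"
      using est[OF P degP] est[OF Q' degQ] n(2)
      by (intro exI[of _ "\<lambda>k. \<integral>x. h x \<partial>P k"] exI[of _ "\<integral>x. h x \<partial>Q"]
        exI[of _ "\<lambda>k. 2 * (\<integral>x. denom_small T D (real n) x \<partial>P k)"]
        exI[of _ "2 * (\<integral>x. denom_small T D (real n) x \<partial>Q)"] conjI allI tendsto_intros) auto
  qed
  have rd: "real_distribution (distr p borel (limit_ratio T))"
    and ch: "char (distr p borel (limit_ratio T)) v =
      Complex (\<integral>x. cos (v * limit_ratio T x) \<partial>p) (\<integral>x. sin (v * limit_ratio T x) \<partial>p)"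
    if p: "prob_space p" "sets p = sets (vec_space T)" for p v
  proof -
    interpret prob_space p by (rule p)
    note [measurable_cong] = p(2)
    note [measurable] = measurable_limit_ratio[OF T]
    show "real_distribution (distr p borel (limit_ratio T))" by (rule real_distribution_distr) measurable
    have i: "integrable p (\<lambda>x. iexp (v * limit_ratio T x))"
      by (intro integrable_const_bound[where B = 1]) auto
    have "char (distr p borel (limit_ratio T)) v = (\<integral>x. iexp (v * limit_ratio T x) \<partial>p)"
      unfolding char_def by (subst integral_distr) auto
    moreover have "Re \<dots> = (\<integral>x. cos (v * limit_ratio T x) \<partial>p)" "Im \<dots> = (\<integral>x. sin (v * limit_ratio T x) \<partial>p)"
      unfolding integral_Re[OF i, symmetric] integral_Im[OF i, symmetric] by (simp_all add: Re_exp Im_exp)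
    ultimately show "char (distr p borel (limit_ratio T)) v =
      Complex (\<integral>x. cos (v * limit_ratio T x) \<partial>p) (\<integral>x. sin (v * limit_ratio T x) \<partial>p)"
      by (simp add: complex_eq_iff)
  qed
  show ?thesis
  proof (rule levy_continuity[OF rd[OF P] rd[OF Q']])
    show "(\<lambda>k. char (distr (P k) borel (limit_ratio T)) v) \<longlonglongrightarrow> char (distr Q borel (limit_ratio T)) v" for v
      unfolding ch[OF P] ch[OF Q']
      by (intro tendsto_Complex main[where g = "\<lambda>y. cos (v * y)"] main[where g = "\<lambda>y. sin (v * y)"] continuous_intros) auto
  qed
qed

section \<open>Moments and existence of Gaussian laws\<close>

lemma normal_law_moments:
  assumes "s \<ge> 0"
  shows "integrable (normal_law m s) (\<lambda>y. y)" "integrable (normal_law m s) (\<lambda>y. y\<^sup>2)"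
    and "(\<integral>y. y \<partial>normal_law m s) = m" "(\<integral>y. y\<^sup>2 \<partial>normal_law m s) = m\<^sup>2 + s\<^sup>2"
proof -
  have "integrable (normal_law m s) (\<lambda>y. y) \<and> integrable (normal_law m s) (\<lambda>y. y\<^sup>2) \<and>
    (\<integral>y. y \<partial>normal_law m s) = m \<and> (\<integral>y. y\<^sup>2 \<partial>normal_law m s) = m\<^sup>2 + s\<^sup>2"
  proof (cases "s = 0")
    case False
    then have s: "s > 0" using assms by simp
    interpret prob_space "density lborel (normal_density m s)" by (rule prob_space_normal_density[OF s])
    let ?N = "density lborel (normal_density m s)"
    have d: "distributed ?N lborel (\<lambda>y. y) (normal_density m s)"
      by (auto simp: distributed_def normal_density_nonneg distr_id2)
    have i1: "integrable ?N (\<lambda>y. (y - m) ^ k)" for k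
      using integrable_normal_moment[OF s, of m k]
      by (subst integrable_density) (auto simp: normal_density_nonneg)
    have "integrable ?N (\<lambda>y. (y - m) ^ 1 + m)" "integrable ?N (\<lambda>y. (y - m) ^ 2 + 2 * m * (y - m) ^ 1 + m\<^sup>2)"
      by (intro Bochner_Integration.integrable_add integrable_mult_right i1 integrable_const)+
    moreover have "(y - m) ^ 2 + 2 * m * (y - m) ^ 1 + m\<^sup>2 = y\<^sup>2" for y
      by (simp add: power2_eq_square algebra_simps)
    ultimately have i: "integrable ?N (\<lambda>y. y)" "integrable ?N (\<lambda>y. y\<^sup>2)" by simp_all
    have e: "(\<integral>y. y \<partial>?N) = m" using normal_distributed_expectation[OF s d] by simp
    have "s\<^sup>2 = (\<integral>y. (y - m)\<^sup>2 \<partial>?N)" using normal_distributed_variance[OF s d] e by simp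
    also have "\<dots> = (\<integral>y. y\<^sup>2 \<partial>?N) - m\<^sup>2"
      using variance_eq[OF i] e by simp
    finally show ?thesis using i e s by (simp add: normal_law_def)
  qed (auto simp: normal_law_def integral_return intro!: integrableI_bounded simp: nn_integral_return)
  then show "integrable (normal_law m s) (\<lambda>y. y)" "integrable (normal_law m s) (\<lambda>y. y\<^sup>2)"
    "(\<integral>y. y \<partial>normal_law m s) = m" "(\<integral>y. y\<^sup>2 \<partial>normal_law m s) = m\<^sup>2 + s\<^sup>2"
    by auto
qed

definition quad :: "nat \<Rightarrow> (nat \<Rightarrow> nat \<Rightarrow> real) \<Rightarrow> (nat \<Rightarrow> real) \<Rightarrow> real" where
  "quad T C u = (\<Sum>t=1..T. \<Sum>v=1..T. u t * u v * C t v)"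

definition coord_coeff :: "nat \<Rightarrow> nat \<Rightarrow> real" where "coord_coeff t v = (if v = t then 1 else 0)"

lemma lin_coord: "t \<in> {1..T} \<Longrightarrow> lin T (coord_coeff t) x = x t"
  by (simp add: lin_def coord_coeff_def if_distrib[of "\<lambda>y. y * _"] cong: if_cong)

lemma lin_coord_fun: "t \<in> {1..T} \<Longrightarrow> lin T (coord_coeff t) = (\<lambda>x. x t)"
  by (auto simp: lin_coord)

lemma lin_add: "lin T (\<lambda>t. u t + w t) x = lin T u x + lin T w x"
  by (simp add: lin_def distrib_right sum.distrib)

lemma quad_lin: "quad T C u = lin T u (\<lambda>t. lin T u (C t))"
  by (simp add: quad_def lin_def sum_distrib_left mult_ac)

text \<open>
  Products of projections are integrable by polarization, as squares of projections are.
\<close>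

lemma normal_projections_moments:
  assumes L: "prob_space L" "sets L = sets (vec_space T)"
    and proj: "\<And>u. \<exists>m s. 0 \<le> s \<and> distr L borel (lin T u) = normal_law m s"
  shows "integrable L (lin T u)" "integrable L (\<lambda>x. lin T u x * lin T w x)"
proof -
  have [measurable]: "lin T u \<in> borel_measurable L" for u
    using measurable_lin L(2) by (simp cong: measurable_cong_sets)
  have i: "integrable L (lin T u)" "integrable L (\<lambda>x. (lin T u x)\<^sup>2)" for u
  proof -
    obtain m s where s: "0 \<le> s" "distr L borel (lin T u) = normal_law m s" using proj by blast
    show "integrable L (lin T u)" "integrable L (\<lambda>x. (lin T u x)\<^sup>2)"
      using normal_law_moments(1,2)[OF s(1), of m] unfolding s(2)[symmetric]
      by (simp_all add: integrable_distr_eq)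
  qed
  show "integrable L (lin T u)" by (rule i)
  have "integrable L (\<lambda>x. ((lin T (\<lambda>t. u t + w t) x)\<^sup>2 - (lin T u x)\<^sup>2 - (lin T w x)\<^sup>2) / 2)"
    by (intro Bochner_Integration.integrable_diff i integrable_divide)
  then show "integrable L (\<lambda>x. lin T u x * lin T w x)"
    by (simp add: lin_add power2_eq_square algebra_simps)
qed

text \<open>
  The mean and the variance of a projection are determined by linearity, and with them its normal law. The
  moments have to be shown to exist first, because integrals of non-integrable functions are \<open>0\<close> by
  convention.
\<close>

lemma centred_normal_gaussian_law:
  assumes "centred_normal T C L"
  shows "gaussian_law T (quad T C) L"
proof -
  have L: "prob_space L" "sets L = sets (vec_space T)" using assms by (auto simp: centred_normal_def)
  interpret prob_space L by (rule L)
  have [measurable]: "lin T u \<in> borel_measurable L" for u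
    using measurable_lin L(2) by (simp cong: measurable_cong_sets)
  have proj: "\<exists>m s. 0 \<le> s \<and> distr L borel (lin T u) = normal_law m s" for u
    using assms by (auto simp: centred_normal_def lin_def[abs_def])
  note int = normal_projections_moments[OF L proj]
  have int1: "integrable L (\<lambda>x. x t)" if "t \<in> {1..T}" for t
    using int(1)[of "coord_coeff t"] that by (simp only: lin_coord_fun)
  have int2: "integrable L (\<lambda>x. x t * x v)" if "t \<in> {1..T}" "v \<in> {1..T}" for t v
    using int(2)[of "coord_coeff t" "coord_coeff v"] that by (simp add: lin_coord)
  have mean: "(\<integral>x. x t \<partial>L) = 0" if "t \<in> {1..T}" for t
    using assms that by (auto simp: centred_normal_def)
  have cov: "(\<integral>x. x t * x v \<partial>L) = C t v" if "t \<in> {1..T}" "v \<in> {1..T}" for t v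
    using assms that mean by (auto simp: centred_normal_def covariance_def)
  show ?thesis
    unfolding gaussian_law_def
  proof (intro conjI L allI)
    fix u
    obtain m s where s: "0 \<le> s" "distr L borel (lin T u) = normal_law m s" using proj by blast
    have "m = (\<integral>x. lin T u x \<partial>L)"
      using normal_law_moments(3)[OF s(1), of m] unfolding s(2)[symmetric] by (simp add: integral_distr)
    also have "\<dots> = (\<Sum>t=1..T. u t * (\<integral>x. x t \<partial>L))"
      unfolding lin_def using int1 by (subst Bochner_Integration.integral_sum) auto
    also have "\<dots> = 0" using mean by simp
    finally have m: "m = 0" .
    have "s\<^sup>2 = (\<integral>x. (lin T u x)\<^sup>2 \<partial>L)"
      using normal_law_moments(4)[OF s(1), of m] unfolding s(2)[symmetric] using m by (simp add: integral_distr)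
    also have "\<dots> = (\<integral>x. (\<Sum>t=1..T. \<Sum>v=1..T. u t * u v * (x t * x v)) \<partial>L)"
      by (simp add: lin_def power2_eq_square sum_product mult_ac)
    also have "\<dots> = (\<Sum>t=1..T. (\<integral>x. (\<Sum>v=1..T. u t * u v * (x t * x v)) \<partial>L))"
      by (intro Bochner_Integration.integral_sum Bochner_Integration.integrable_sum integrable_mult_right int2)
    also have "\<dots> = (\<Sum>t=1..T. \<Sum>v=1..T. (\<integral>x. u t * u v * (x t * x v) \<partial>L))"
      by (intro sum.cong refl Bochner_Integration.integral_sum integrable_mult_right int2)
    also have "\<dots> = quad T C u" unfolding quad_def by (intro sum.cong refl) (simp add: cov)
    finally have q: "quad T C u = s\<^sup>2" ..
    then show "0 \<le> quad T C u" by simp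
    show "distr L borel (lin T u) = normal_law 0 (sqrt (quad T C u))"
      using s m q by simp
  qed
qed

lemma quad_coord: "t \<in> {1..T} \<Longrightarrow> quad T C (coord_coeff t) = C t t"
  by (simp add: quad_lin lin_coord)

lemma quad_coord_add:
  assumes "t \<in> {1..T}" "v \<in> {1..T}"
  shows "quad T C (\<lambda>r. coord_coeff t r + coord_coeff v r) = C t t + C t v + C v t + C v v"
  using assms by (simp add: quad_lin lin_coord lin_add)

text \<open>
  The covariances are recovered from the variances of sums of two coordinates.
\<close>

lemma gaussian_law_centred_normal:
  assumes G: "gaussian_law T (quad T C) L"
    and sym: "\<And>t v. t \<in> {1..T} \<Longrightarrow> v \<in> {1..T} \<Longrightarrow> C t v = C v t"
  shows "centred_normal T C L"
proof -
  have L: "prob_space L" "sets L = sets (vec_space T)"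
    and nonneg: "\<And>u. 0 \<le> quad T C u"
    and distr: "\<And>u. distr L borel (lin T u) = normal_law 0 (sqrt (quad T C u))"
    using G by (auto simp: gaussian_law_def)
  interpret prob_space L by (rule L)
  have [measurable]: "lin T u \<in> borel_measurable L" for u
    using measurable_lin L(2) by (simp cong: measurable_cong_sets)
  have proj: "\<exists>m s. 0 \<le> s \<and> distr L borel (lin T u) = normal_law m s" for u
    using distr nonneg by (intro exI[of _ 0] exI[of _ "sqrt (quad T C u)"]) simp
  note int = normal_projections_moments[OF L proj]
  have mean: "(\<integral>x. lin T u x \<partial>L) = 0" for u
    using normal_law_moments(3)[of "sqrt (quad T C u)" 0] nonneg
    unfolding distr[symmetric] by (simp add: integral_distr)
  have var: "(\<integral>x. (lin T u x)\<^sup>2 \<partial>L) = quad T C u" for u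
    using normal_law_moments(4)[of "sqrt (quad T C u)" 0] nonneg
    unfolding distr[symmetric] by (simp add: integral_distr)
  have cov: "(\<integral>x. x t * x v \<partial>L) = C t v" if tv: "t \<in> {1..T}" "v \<in> {1..T}" for t v
  proof -
    note i = int(2)[of "coord_coeff t" "coord_coeff t"] int(2)[of "coord_coeff v" "coord_coeff v"] int(2)[of "coord_coeff t" "coord_coeff v"]
    have "quad T C (\<lambda>r. coord_coeff t r + coord_coeff v r) = (\<integral>x. x t * x t + x v * x v + 2 * (x t * x v) \<partial>L)"
      unfolding var[symmetric] using tv by (simp add: lin_add lin_coord power2_eq_square algebra_simps)
    also have "\<dots> = (\<integral>x. x t * x t \<partial>L) + (\<integral>x. x v * x v \<partial>L) + 2 * (\<integral>x. x t * x v \<partial>L)"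
      using i tv by (simp add: lin_coord)
    also have "(\<integral>x. x t * x t \<partial>L) = C t t"
      using var[of "coord_coeff t"] tv by (simp add: lin_coord quad_coord power2_eq_square)
    also have "(\<integral>x. x v * x v \<partial>L) = C v v"
      using var[of "coord_coeff v"] tv by (simp add: lin_coord quad_coord power2_eq_square)
    finally show ?thesis using sym[OF tv] tv by (simp add: quad_coord_add)
  qed
  show ?thesis
    unfolding centred_normal_def
  proof (intro conjI L allI ballI)
    show "\<exists>m s. 0 \<le> s \<and> distr L borel (\<lambda>x. \<Sum>t=1..T. u t * x t) = normal_law m s" for u
      using proj[of u] by (simp add: lin_def[abs_def])
    show mean': "(\<integral>x. x t \<partial>L) = 0" if "t \<in> {1..T}" for t
      using mean[of "coord_coeff t"] that by (simp add: lin_coord)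
    show "covariance L (\<lambda>x. x t) (\<lambda>x. x v) = C t v" if "t \<in> {1..T}" "v \<in> {1..T}" for t v
      using cov that mean' by (simp add: covariance_def)
  qed
qed

text \<open>
  Homogeneity of the quadratic form gives the characteristic function of each projection on the whole line.
\<close>

lemma gaussian_lawI:
  assumes L: "prob_space L" "sets L = sets (vec_space T)"
    and nonneg: "\<And>u. 0 \<le> quad T C u"
    and char_fun: "\<And>u. char_fun T L u = exp (- quad T C u / 2)"
  shows "gaussian_law T (quad T C) L"
  unfolding gaussian_law_def
proof (intro conjI L allI nonneg)
  fix u
  interpret prob_space L by (rule L)
  have [measurable]: "lin T u \<in> borel_measurable L" for u
    using measurable_lin L(2) by (simp cong: measurable_cong_sets)
  have "char (distr L borel (lin T u)) s = char (normal_law 0 (sqrt (quad T C u))) s" for s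
  proof -
    have lin: "lin T (\<lambda>t. s * u t) x = s * lin T u x" for x
      by (simp add: lin_def sum_distrib_left mult_ac)
    have "char (distr L borel (lin T u)) s = char_fun T L (\<lambda>t. s * u t)"
      unfolding char_fun_def char_def by (subst (1 2) integral_distr) (auto simp: lin)
    also have "\<dots> = exp (- (s\<^sup>2 * quad T C u) / 2)"
      unfolding char_fun by (simp add: quad_def sum_distrib_left power2_eq_square mult_ac)
    finally show ?thesis
      using nonneg by (simp add: char_normal_law power_mult_distrib mult_ac)
  qed
  then show "distr L borel (lin T u) = normal_law 0 (sqrt (quad T C u))"
    by (intro Levy_uniqueness real_distribution_normal_law) (auto simp: nonneg)
qed

text \<open>
  Induction on the index set by Schur complements. If the pivot \<open>C p p\<close> is \<open>0\<close>, positivity forces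
  its whole row to vanish, and the formulas for a positive pivot remain correct with division by
  \<open>0\<close> read as \<open>0\<close>.
\<close>

lemma cholesky:
  fixes C :: "'i \<Rightarrow> 'i \<Rightarrow> real"
  assumes "finite I"
    and "\<And>u. 0 \<le> (\<Sum>i\<in>I. \<Sum>j\<in>I. u i * u j * C i j)"
    and "\<And>i j. i \<in> I \<Longrightarrow> j \<in> I \<Longrightarrow> C i j = C j i"
  shows "\<exists>A. \<forall>i\<in>I. \<forall>j\<in>I. C i j = (\<Sum>k\<in>I. A i k * A j k)"
  using assms
proof (induction I arbitrary: C rule: finite_induct)
  case (insert p I)
  have expand: "(\<Sum>i\<in>insert p I. \<Sum>j\<in>insert p I. u i * u j * C i j) =
      (u p)\<^sup>2 * C p p + 2 * u p * (\<Sum>j\<in>I. u j * C p j) + (\<Sum>i\<in>I. \<Sum>j\<in>I. u i * u j * C i j)" for u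
  proof -
    have "(\<Sum>i\<in>I. u i * u p * C i p) = u p * (\<Sum>j\<in>I. u j * C p j)"
      unfolding sum_distrib_left using insert.prems(2) by (intro sum.cong) auto
    moreover have "(\<Sum>j\<in>I. u p * u j * C p j) = u p * (\<Sum>j\<in>I. u j * C p j)"
      by (simp add: sum_distrib_left mult_ac)
    ultimately show ?thesis
      using insert.hyps by (simp add: sum.distrib power2_eq_square algebra_simps)
  qed
  have pp: "0 \<le> C p p"
  proof -
    define u where "u i = (if i = p then 1 else 0 :: real)" for i
    have "u p = 1" "\<And>i. i \<in> I \<Longrightarrow> u i = 0" using insert.hyps by (auto simp: u_def)
    then show ?thesis using insert.prems(1)[of u] unfolding expand by (simp cong: sum.cong)
  qed
  have null: "C p j = 0" if "C p p = 0" "j \<in> I" for j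
  proof (rule ccontr)
    assume nz: "C p j \<noteq> 0"
    \<comment> \<open>A multiple of the pivot coordinate that makes the form negative.\<close>
    define x where "x = - (C j j + 1) / (2 * C p j)"
    define u where "u i = (if i = p then x else if i = j then 1 else 0)" for i
    have up: "u p = x" by (simp add: u_def)
    have uI: "\<And>i. i \<in> I \<Longrightarrow> u i = (if i = j then 1 else 0)" using insert.hyps by (auto simp: u_def)
    have "(\<Sum>i\<in>I. u i * C p i) = (\<Sum>i\<in>I. if i = j then C p i else 0)"
      by (intro sum.cong) (auto simp: uI)
    moreover have "(\<Sum>i\<in>I. \<Sum>k\<in>I. u i * u k * C i k) = (\<Sum>i\<in>I. if i = j then (\<Sum>k\<in>I. if k = j then C i k else 0) else 0)"
      by (intro sum.cong) (auto simp: uI intro!: sum.cong)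
    ultimately have "0 \<le> 2 * x * C p j + C j j"
      using insert.prems(1)[of u] insert.hyps that unfolding expand up by simp
    moreover have "2 * x * C p j = - (C j j + 1)" using nz by (simp add: x_def)
    ultimately show False by linarith
  qed
  define C' where "C' i j = C i j - C p i * C p j / C p p" for i j
  have "\<exists>A. \<forall>i\<in>I. \<forall>j\<in>I. C' i j = (\<Sum>k\<in>I. A i k * A j k)"
  proof (rule insert.IH)
    show "C' i j = C' j i" if "i \<in> I" "j \<in> I" for i j
      using insert.prems(2)[of i j] that by (simp add: C'_def)
    show "0 \<le> (\<Sum>i\<in>I. \<Sum>j\<in>I. u i * u j * C' i j)" for u
    proof -
      define S where "S = (\<Sum>j\<in>I. u j * C p j)"
      \<comment> \<open>The minimizer of the form over the pivot coordinate; completing the square gives the Schur complement.\<close>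
      define w where "w = u(p := - S / C p p)"
      have wI: "\<And>i. i \<in> I \<Longrightarrow> w i = u i" and wp: "w p = - S / C p p"
        using insert.hyps by (auto simp: w_def)
      have "(\<Sum>i\<in>I. \<Sum>j\<in>I. u i * u j * C' i j) = (\<Sum>i\<in>I. \<Sum>j\<in>I. u i * u j * C i j) - S * S / C p p"
        unfolding S_def sum_product sum_divide_distrib
        by (simp add: C'_def sum_subtractf[symmetric] algebra_simps)
      also have "\<dots> = (\<Sum>i\<in>insert p I. \<Sum>j\<in>insert p I. w i * w j * C i j)"
        unfolding expand using pp
        by (cases "C p p = 0") (auto simp: wI wp S_def[symmetric] power2_eq_square cong: sum.cong)
      finally show ?thesis using insert.prems(1)[of w] by simp
    qed
  qed
  then obtain A where A: "\<And>i j. i \<in> I \<Longrightarrow> j \<in> I \<Longrightarrow> C' i j = (\<Sum>k\<in>I. A i k * A j k)" by blast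
  define B where "B i k = (if k = p then C p i / sqrt (C p p) else if i = p then 0 else A i k)" for i k
  have "C i j = (\<Sum>k\<in>insert p I. B i k * B j k)" if ij: "i \<in> insert p I" "j \<in> insert p I" for i j
  proof -
    have BI: "(\<Sum>k\<in>I. B i k * B j k) = (\<Sum>k\<in>I. if i = p \<or> j = p then 0 else A i k * A j k)"
      using insert.hyps by (intro sum.cong) (auto simp: B_def)
    have Bp: "B i p * B j p = C p i * C p j / C p p"
      using pp by (simp add: B_def)
    show ?thesis
    proof (cases "i = p \<or> j = p")
      case True
      then have "C p i * C p j / C p p = C i j"
        using null ij insert.prems(2)[of i j] by (cases "C p p = 0") auto
      then show ?thesis using insert.hyps BI Bp True by simp
    next
      case False
      then show ?thesis using insert.hyps BI Bp A[of i j] ij by (simp add: C'_def)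
    qed
  qed
  then show ?case by blast
qed simp

text \<open>
  The image of independent standard normal variables under a Cholesky factor.
\<close>

lemma gaussian_law_exists:
  assumes nonneg: "\<And>u. 0 \<le> quad T C u"
    and sym: "\<And>t v. t \<in> {1..T} \<Longrightarrow> v \<in> {1..T} \<Longrightarrow> C t v = C v t"
  shows "\<exists>L. gaussian_law T (quad T C) L"
proof -
  have "\<exists>A. \<forall>i\<in>{1..T}. \<forall>j\<in>{1..T}. C i j = (\<Sum>k\<in>{1..T}. A i k * A j k)"
    by (rule cholesky) (use nonneg sym in \<open>auto simp: quad_def\<close>)
  then obtain A where A: "\<And>t v. t \<in> {1..T} \<Longrightarrow> v \<in> {1..T} \<Longrightarrow> C t v = (\<Sum>k=1..T. A t k * A v k)" by blast
  let ?N = "\<lambda>_ :: nat. std_normal_distribution"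
  interpret N: real_distribution "std_normal_distribution" by (rule real_dist_normal_dist)
  interpret product_prob_space ?N "{1..T}" by standard
  interpret P: prob_space "PiM {1..T} ?N" by (rule prob_space_PiM) (rule N.prob_space_axioms)
  have sP [measurable_cong]: "sets (PiM {1..T} ?N) = sets (vec_space T)"
    by (intro sets_PiM_cong) auto
  define X where "X z = (\<lambda>t\<in>{1..T}. \<Sum>k=1..T. A t k * z k)" for z :: "nat \<Rightarrow> real"
  have mX [measurable]: "X \<in> measurable (PiM {1..T} ?N) (vec_space T)"
    unfolding X_def[abs_def] by measurable
  define L where "L = distr (PiM {1..T} ?N) (vec_space T) X"
  have "gaussian_law T (quad T C) L"
  proof (rule gaussian_lawI[OF _ _ nonneg])
    show "prob_space L" unfolding L_def by (rule P.prob_space_distr) measurable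
    show sL: "sets L = sets (vec_space T)" by (simp add: L_def)
    fix u
    have ml: "(\<lambda>x. iexp (lin T u x)) \<in> borel_measurable (vec_space T)" by measurable
    define b where "b k = (\<Sum>t=1..T. u t * A t k)" for k
    have lX: "lin T u (X z) = (\<Sum>k=1..T. b k * z k)" for z
    proof -
      have "lin T u (X z) = (\<Sum>t=1..T. \<Sum>k=1..T. u t * A t k * z k)"
        unfolding lin_def X_def by (intro sum.cong) (auto simp: sum_distrib_left mult_ac)
      also have "\<dots> = (\<Sum>k=1..T. b k * z k)"
        unfolding b_def sum_distrib_right by (rule sum.swap)
      finally show ?thesis .
    qed
    have "char_fun T L u = (\<integral>z. iexp (lin T u (X z)) \<partial>PiM {1..T} ?N)"
      unfolding char_fun_integral[OF sL] unfolding L_def by (rule integral_distr[OF mX ml])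
    also have "\<dots> = (\<integral>z. (\<Prod>k=1..T. iexp (b k * z k)) \<partial>PiM {1..T} ?N)"
      by (simp add: lX exp_sum[symmetric] sum_distrib_left)
    also have "\<dots> = (\<Prod>k=1..T. (\<integral>y. iexp (b k * y) \<partial>std_normal_distribution))"
      by (intro product_integral_prod N.integrable_const_bound[where B = 1]) auto
    also have "\<dots> = (\<Prod>k=1..T. exp (- (b k)\<^sup>2 / 2))"
      using char_std_normal_distribution unfolding char_def fun_eq_iff of_real_prod by (intro prod.cong refl) blast
    also have "\<dots> = exp (- (\<Sum>k=1..T. (b k)\<^sup>2) / 2)"
      by (simp add: exp_sum[symmetric] sum_divide_distrib sum_negf)
    also have "(\<Sum>k=1..T. (b k)\<^sup>2) = quad T C u"
    proof -
      have "quad T C u = (\<Sum>t=1..T. \<Sum>v=1..T. \<Sum>k=1..T. (u t * A t k) * (u v * A v k))"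
        unfolding quad_def by (intro sum.cong refl) (simp add: A sum_distrib_left mult_ac)
      also have "\<dots> = (\<Sum>t=1..T. \<Sum>k=1..T. \<Sum>v=1..T. (u t * A t k) * (u v * A v k))"
        by (intro sum.cong refl sum.swap)
      also have "\<dots> = (\<Sum>k=1..T. \<Sum>t=1..T. \<Sum>v=1..T. (u t * A t k) * (u v * A v k))"
        by (rule sum.swap)
      also have "\<dots> = (\<Sum>k=1..T. (b k)\<^sup>2)"
        by (simp add: b_def power2_eq_square sum_product)
      finally show ?thesis ..
    qed
    finally show "char_fun T L u = exp (- quad T C u / 2)" by simp
  qed
  then show ?thesis ..
qed

section \<open>A Lyapunov bound, a weak law and resampling\<close>

lemma exp_neg_quadratic_bound:
  fixes x :: real assumes "x \<ge> 0" shows "\<bar>exp (- x) - (1 - x)\<bar> \<le> x\<^sup>2"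
proof -
  have "1 - x \<le> exp (- x)" using exp_ge_add_one_self[of "- x"] by simp
  moreover have "exp (- x) \<le> 1 - x + x\<^sup>2"
  proof -
    have "exp (- x) \<le> 1 / (1 + x)"
      using exp_ge_add_one_self[of x] assms by (simp add: exp_minus inverse_eq_divide frac_le)
    also have "1 / (1 + x) \<le> 1 - x + x\<^sup>2"
    proof -
      have "1 \<le> (1 - x + x\<^sup>2) * (1 + x)"
        using assms by (simp add: algebra_simps power2_eq_square)
      then show ?thesis using assms by (simp add: divide_le_eq)
    qed
    finally show ?thesis .
  qed
  ultimately show ?thesis by simp
qed

lemma abs_power_le_1_plus_power4:
  fixes x :: real assumes "k \<le> 4" shows "\<bar>x\<bar> ^ k \<le> 1 + x ^ 4"
proof (cases "\<bar>x\<bar> \<le> 1")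
  case True
  have "\<bar>x\<bar> ^ k \<le> 1" using True by (intro power_le_one) auto
  then show ?thesis by (simp add: add_increasing2)
next
  case False
  then have "\<bar>x\<bar> ^ k \<le> \<bar>x\<bar> ^ 4" using assms by (intro power_increasing) auto
  then show ?thesis by (simp add: power_even_abs)
qed

lemma (in prob_space) integrable_power4_imp:
  fixes X :: "'a \<Rightarrow> real"
  assumes "random_variable borel X" "integrable M (\<lambda>x. X x ^ 4)" "k \<le> 4"
  shows "integrable M (\<lambda>x. \<bar>X x\<bar> ^ k)" "integrable M (\<lambda>x. X x ^ k)"
proof -
  note [measurable] = assms(1)
  have i: "integrable M (\<lambda>x. 1 + X x ^ 4)" using assms(2) by simp
  show "integrable M (\<lambda>x. \<bar>X x\<bar> ^ k)" "integrable M (\<lambda>x. X x ^ k)"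
    by (rule Bochner_Integration.integrable_bound[OF i]; 
        use abs_power_le_1_plus_power4[OF assms(3)] in \<open>auto simp: power_abs abs_of_nonneg\<close>)+
qed

text \<open>
  An explicit bound, valid for each \<open>N\<close> and each law, because it has to be applied to the random
  empirical laws of the bootstrap. It also covers the variance \<open>0\<close>. Both characteristic functions have
  absolute value at most \<open>1\<close>, so the distance of the \<open>N\<close>-th powers is at most \<open>N\<close> times the distance of the
  functions at \<open>1/\<surd>N\<close>, which is of order \<open>N\<^sup>-\<^sup>3\<^sup>/\<^sup>2\<close> by Taylor expansion.
\<close>

lemma (in prob_space) lyapunov_char_bound:
  fixes X :: "'a \<Rightarrow> real"
  assumes rv [measurable]: "random_variable borel X" and int: "integrable M (\<lambda>x. X x ^ 4)"
    and mean: "expectation X = 0" and N: "N \<ge> 1"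
  defines "v \<equiv> expectation (\<lambda>x. (X x)\<^sup>2)"
  shows "cmod (char (distr M borel X) (1 / sqrt (real N)) ^ N - of_real (exp (- v / 2)))
    \<le> (1 + expectation (\<lambda>x. X x ^ 4)) / sqrt (real N) + v\<^sup>2 / real N"
proof -
  define t where "t = 1 / sqrt (real N)"
  have t: "t > 0" "t\<^sup>2 = 1 / real N" using N by (auto simp: t_def power_divide)
  note i = integrable_power4_imp[OF rv int]
  have i1: "integrable M X" and i2: "integrable M (\<lambda>x. (X x)\<^sup>2)" and i3: "integrable M (\<lambda>x. \<bar>X x\<bar> ^ 3)"
    using i(2)[of 1] i(2)[of 2] i(1)[of 3] by simp_all
  have v0: "v \<ge> 0" unfolding v_def by simp
  have third: "expectation (\<lambda>x. \<bar>X x\<bar> ^ 3) \<le> 1 + expectation (\<lambda>x. X x ^ 4)"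
  proof -
    have "expectation (\<lambda>x. \<bar>X x\<bar> ^ 3) \<le> expectation (\<lambda>x. 1 + X x ^ 4)"
      using i3 int abs_power_le_1_plus_power4[of 3] by (intro integral_mono) auto
    then show ?thesis using int by (simp add: prob_space)
  qed
  interpret D: real_distribution "distr M borel X" by (rule real_distribution_distr) simp
  define \<phi> where "\<phi> = char (distr M borel X) t"
  define w where "w = exp (- (v / (2 * real N)))"
  have "cmod (\<phi> - (1 - t^2 * v / 2)) \<le> (t^2 / 6) * expectation (\<lambda>x. min (6 * (X x)^2) (\<bar>t\<bar> * \<bar>X x\<bar>^3))"
    unfolding \<phi>_def by (rule char_approx3'[OF rv i1 i2 mean]) (simp_all add: mean v_def)
  also have "\<dots> \<le> (t^2 / 6) * (t * (1 + expectation (\<lambda>x. X x ^ 4)))"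
  proof (rule mult_left_mono)
    have "expectation (\<lambda>x. min (6 * (X x)^2) (\<bar>t\<bar> * \<bar>X x\<bar>^3)) \<le> expectation (\<lambda>x. t * \<bar>X x\<bar>^3)"
      using i2 i3 t by (intro integral_mono integrable_min integrable_mult_right) auto
    also have "\<dots> = t * expectation (\<lambda>x. \<bar>X x\<bar> ^ 3)" by simp
    also have "\<dots> \<le> t * (1 + expectation (\<lambda>x. X x ^ 4))" using third t by (intro mult_left_mono) auto
    finally show "expectation (\<lambda>x. min (6 * (X x)^2) (\<bar>t\<bar> * \<bar>X x\<bar>^3)) \<le> t * (1 + expectation (\<lambda>x. X x ^ 4))" .
  qed simp
  finally have a: "cmod (\<phi> - (1 - t^2 * v / 2)) \<le> (t^2 / 6) * (t * (1 + expectation (\<lambda>x. X x ^ 4)))" .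
  have "\<bar>w - (1 - v / (2 * real N))\<bar> \<le> (v / (2 * real N))\<^sup>2"
    unfolding w_def using v0 by (intro exp_neg_quadratic_bound) simp
  have b: "cmod ((1 - t^2 * v / 2) - of_real w) \<le> (v / (2 * real N))\<^sup>2"
  proof -
    have "(1 - t^2 * v / 2) - complex_of_real w = of_real ((1 - v / (2 * real N)) - w)"
      by (simp add: t)
    also have "cmod \<dots> = \<bar>w - (1 - v / (2 * real N))\<bar>"
      unfolding norm_of_real by (rule abs_minus_commute)
    finally show ?thesis using \<open>\<bar>w - (1 - v / (2 * real N))\<bar> \<le> (v / (2 * real N))\<^sup>2\<close> by simp
  qed
  have "0 \<le> w" "w \<le> 1" using v0 by (simp_all add: w_def)
  then have "cmod (\<phi> ^ N - of_real w ^ N) \<le> real N * cmod (\<phi> - of_real w)"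
    unfolding \<phi>_def by (intro norm_power_diff D.cmod_char_le_1) simp
  also have "\<dots> \<le> real N * ((t^2 / 6) * (t * (1 + expectation (\<lambda>x. X x ^ 4))) + (v / (2 * real N))\<^sup>2)"
    using norm_triangle_le[OF add_mono[OF a b]] by (intro mult_left_mono) simp_all
  also have "\<dots> = t * (1 + expectation (\<lambda>x. X x ^ 4)) / 6 + v\<^sup>2 / real N / 4"
    unfolding t(2) using N by (simp add: power2_eq_square field_simps)
  also have "\<dots> \<le> t * (1 + expectation (\<lambda>x. X x ^ 4)) + v\<^sup>2 / real N"
  proof (rule add_mono)
    have shrink: "y / 6 \<le> y" "y / 4 \<le> y" if "y \<ge> 0" for y :: real using that by simp_all
    show "t * (1 + expectation (\<lambda>x. X x ^ 4)) / 6 \<le> t * (1 + expectation (\<lambda>x. X x ^ 4))"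
      using t by (intro shrink) simp
    show "v\<^sup>2 / real N / 4 \<le> v\<^sup>2 / real N" by (intro shrink) simp
  qed
  finally have "cmod (\<phi> ^ N - of_real w ^ N) \<le> t * (1 + expectation (\<lambda>x. X x ^ 4)) + v\<^sup>2 / real N" .
  moreover have "(of_real w :: complex) ^ N = of_real (exp (- v / 2))"
    using N by (simp add: w_def exp_of_nat_mult[symmetric] flip: of_real_power)
  ultimately show ?thesis by (simp add: \<phi>_def t_def)
qed

lemma (in prob_space) second_moment_indep_sum:
  fixes Z :: "'i \<Rightarrow> 'a \<Rightarrow> real"
  assumes "finite I" "indep_vars (\<lambda>_. borel) Z I"
    and "\<And>i. i \<in> I \<Longrightarrow> integrable M (\<lambda>x. (Z i x)\<^sup>2)" "\<And>i. i \<in> I \<Longrightarrow> expectation (Z i) = 0"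
  shows "integrable M (\<lambda>x. (\<Sum>i\<in>I. Z i x)\<^sup>2) \<and>
    expectation (\<lambda>x. (\<Sum>i\<in>I. Z i x)\<^sup>2) = (\<Sum>i\<in>I. expectation (\<lambda>x. (Z i x)\<^sup>2))"
  using assms
proof (induction I rule: finite_induct)
  case (insert j I)
  have rv: "random_variable borel (Z i)" if "i \<in> insert j I" for i
    using insert.prems(1) that by (auto simp: indep_vars_def)
  have sub: "indep_vars (\<lambda>_. borel) Z I" using insert.prems(1) by (rule indep_vars_subset) auto
  have IH: "integrable M (\<lambda>x. (\<Sum>i\<in>I. Z i x)\<^sup>2)"
    "expectation (\<lambda>x. (\<Sum>i\<in>I. Z i x)\<^sup>2) = (\<Sum>i\<in>I. expectation (\<lambda>x. (Z i x)\<^sup>2))"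
    using insert.IH[OF sub] insert.prems by auto
  have i1: "integrable M (Z i)" if "i \<in> insert j I" for i
    using rv[OF that] insert.prems(2)[OF that] by (rule square_integrable_imp_integrable)
  have iS: "integrable M (\<lambda>x. \<Sum>i\<in>I. Z i x)" using i1 by auto
  have ind: "indep_var borel (Z j) borel (\<lambda>x. \<Sum>i\<in>I. Z i x)"
    using insert.hyps insert.prems(1) by (intro indep_vars_sum) auto
  have cross: "integrable M (\<lambda>x. Z j x * (\<Sum>i\<in>I. Z i x))"
    "expectation (\<lambda>x. Z j x * (\<Sum>i\<in>I. Z i x)) = 0"
    using indep_var_integrable[OF ind i1 iS] indep_var_lebesgue_integral[OF ind i1 iS] insert.prems(3)[of j] by auto
  have eq: "(\<Sum>i\<in>insert j I. Z i x)\<^sup>2 = (Z j x)\<^sup>2 + 2 * (Z j x * (\<Sum>i\<in>I. Z i x)) + (\<Sum>i\<in>I. Z i x)\<^sup>2" for x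
    using insert.hyps by (simp add: power2_eq_square algebra_simps)
  show ?case
    unfolding eq using insert.hyps insert.prems(2)[of j] cross IH by simp
qed simp

definition emp_mean :: "nat \<Rightarrow> (nat \<Rightarrow> real) \<Rightarrow> real" where
  "emp_mean N f = (\<Sum>j=1..N. f j) / real N"

text \<open>
  Chebyshev's inequality, as the variance of the empirical mean is of order \<open>1/N\<close>.
\<close>

lemma (in prob_space) weak_law:
  fixes Z :: "nat \<Rightarrow> 'a \<Rightarrow> real"
  assumes indep: "indep_vars (\<lambda>_. borel) Z {1..}"
    and int: "\<And>i. i \<ge> 1 \<Longrightarrow> integrable M (\<lambda>x. (Z i x)\<^sup>2)"
    and mean: "\<And>i. i \<ge> 1 \<Longrightarrow> expectation (Z i) = m"
    and sq: "\<And>i. i \<ge> 1 \<Longrightarrow> expectation (\<lambda>x. (Z i x)\<^sup>2) = s"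
    and d: "d > 0"
  shows "(\<lambda>N. prob {x\<in>space M. d \<le> \<bar>emp_mean N (\<lambda>j. Z j x) - m\<bar>}) \<longlonglongrightarrow> 0"
proof (rule tendsto_sandwich[where f = "\<lambda>_. 0"])
  show "(\<lambda>N. (s - m\<^sup>2) / d\<^sup>2 / real N) \<longlonglongrightarrow> 0" by real_asymp
  show "eventually (\<lambda>N. prob {x\<in>space M. d \<le> \<bar>emp_mean N (\<lambda>j. Z j x) - m\<bar>} \<le> (s - m\<^sup>2) / d\<^sup>2 / real N) sequentially"
    using eventually_ge_at_top[of 1]
  proof eventually_elim
    case (elim N)
    define W where "W i x = Z i x - m" for i x
    have rv [measurable]: "random_variable borel (Z i)" if "i \<ge> 1" for i
      using indep that by (auto simp: indep_vars_def)
    have i1: "integrable M (Z i)" if "i \<ge> 1" for i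
      using rv[OF that] int[OF that] by (rule square_integrable_imp_integrable)
    have W1: "indep_vars (\<lambda>_. borel) W {1..N}"
      unfolding W_def
      by (rule indep_vars_compose2[where Y = "\<lambda>_ y. y - m", OF indep_vars_subset[OF indep]]) auto
    have sqW: "(W i x)\<^sup>2 = (Z i x)\<^sup>2 - 2 * m * Z i x + m\<^sup>2" for i x
      by (simp add: W_def power2_eq_square algebra_simps)
    have W2: "integrable M (\<lambda>x. (W i x)\<^sup>2)" "expectation (W i) = 0" "expectation (\<lambda>x. (W i x)\<^sup>2) = s - m\<^sup>2"
      if "i \<ge> 1" for i
      unfolding sqW using i1[OF that] int[OF that] mean[OF that] sq[OF that]
      by (auto simp: W_def[abs_def] prob_space power2_eq_square)
    have sum: "integrable M (\<lambda>x. (\<Sum>i=1..N. W i x)\<^sup>2)"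
      "expectation (\<lambda>x. (\<Sum>i=1..N. W i x)\<^sup>2) = real N * (s - m\<^sup>2)"
      using second_moment_indep_sum[OF _ W1] W2 by auto
    have set: "{x\<in>space M. d \<le> \<bar>emp_mean N (\<lambda>j. Z j x) - m\<bar>} = {x\<in>space M. (d * real N)\<^sup>2 \<le> (\<Sum>i=1..N. W i x)\<^sup>2}"
    proof -
      have "d \<le> \<bar>emp_mean N (\<lambda>j. Z j x) - m\<bar> \<longleftrightarrow> (d * real N)\<^sup>2 \<le> (\<Sum>i=1..N. W i x)\<^sup>2" for x
      proof -
        have "emp_mean N (\<lambda>j. Z j x) - m = (\<Sum>i=1..N. W i x) / real N"
          using elim by (simp add: emp_mean_def W_def sum_subtractf field_simps)
        then have "d \<le> \<bar>emp_mean N (\<lambda>j. Z j x) - m\<bar> \<longleftrightarrow> \<bar>d * real N\<bar> \<le> \<bar>\<Sum>i=1..N. W i x\<bar>"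
          using elim d by (simp only:) (simp add: pos_le_divide_eq abs_mult)
        then show ?thesis unfolding abs_le_square_iff .
      qed
      then show ?thesis by simp
    qed
    have "prob {x\<in>space M. (d * real N)\<^sup>2 \<le> (\<Sum>i=1..N. W i x)\<^sup>2} \<le> real N * (s - m\<^sup>2) / (d * real N)\<^sup>2"
      unfolding sum(2)[symmetric]
      by (rule integral_Markov_inequality_measure[where A = "{}"]) (use sum(1) d elim in \<open>simp_all\<close>)
    also have "\<dots> = (s - m\<^sup>2) / d\<^sup>2 / real N"
      using elim by (simp add: power2_eq_square)
    finally show ?case unfolding set .
  qed
qed (auto intro!: always_eventually)

lemma (in prob_space) char_fun_indep_sum:
  assumes indep: "indep_vars (\<lambda>_. borel) Z {1..N}"
    and D: "\<And>i. i \<in> {1..N} \<Longrightarrow> distr M borel (Z i) = D"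
    and S [measurable]: "S \<in> measurable M (vec_space T)"
    and lin: "\<And>\<omega>. \<omega> \<in> space M \<Longrightarrow> lin T u (S \<omega>) = (\<Sum>i=1..N. Z i \<omega>) / sqrt (real N)"
  shows "char_fun T (distr M (vec_space T) S) u = char D (1 / sqrt (real N)) ^ N"
proof -
  have [measurable]: "random_variable borel (Z i)" if "i \<in> {1..N}" for i
    using indep that by (auto simp: indep_vars_def)
  have ml: "(\<lambda>x. iexp (lin T u x)) \<in> borel_measurable (vec_space T)" by measurable
  have "char_fun T (distr M (vec_space T) S) u = (\<integral>\<omega>. iexp (lin T u (S \<omega>)) \<partial>M)"
    by (subst char_fun_integral, simp) (rule integral_distr[OF S ml])
  also have "\<dots> = (\<integral>\<omega>. iexp (1 / sqrt (real N) * (\<Sum>i=1..N. Z i \<omega>)) \<partial>M)"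
    by (intro Bochner_Integration.integral_cong refl) (simp add: lin)
  also have "\<dots> = char (distr M borel (\<lambda>\<omega>. \<Sum>i=1..N. Z i \<omega>)) (1 / sqrt (real N))"
    unfolding char_def by (subst integral_distr) auto
  also have "\<dots> = char D (1 / sqrt (real N)) ^ N"
    by (subst char_distr_sum[OF indep]) (simp add: D)
  finally show ?thesis .
qed

text \<open>
  Each coordinate is bounded by the largest one, whose fourth power is at most the sum of all.
\<close>

lemma lin_power4_bound: "(lin T c x) ^ 4 \<le> (\<Sum>t=1..T. \<bar>c t\<bar>) ^ 4 * (\<Sum>t=1..T. x t ^ 4)"
proof (cases "T = 0")
  case False
  then have "Max ((\<lambda>t. \<bar>x t\<bar>) ` {1..T}) \<in> (\<lambda>t. \<bar>x t\<bar>) ` {1..T}" by (intro Max_in) auto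
  then obtain m where m: "m \<in> {1..T}" "Max ((\<lambda>t. \<bar>x t\<bar>) ` {1..T}) = \<bar>x m\<bar>" by auto
  then have m2: "\<bar>x t\<bar> \<le> \<bar>x m\<bar>" if "t \<in> {1..T}" for t
    using that Max_ge[of "(\<lambda>t. \<bar>x t\<bar>) ` {1..T}" "\<bar>x t\<bar>"] by simp
  have "\<bar>lin T c x\<bar> \<le> (\<Sum>t=1..T. \<bar>c t\<bar> * \<bar>x m\<bar>)"
    unfolding lin_def using m2 by (intro order.trans[OF sum_abs] sum_mono) (simp add: abs_mult mult_left_mono)
  then have "\<bar>lin T c x\<bar> ^ 4 \<le> ((\<Sum>t=1..T. \<bar>c t\<bar>) * \<bar>x m\<bar>) ^ 4"
    by (intro power_mono) (auto simp: sum_distrib_right)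
  also have "\<dots> = (\<Sum>t=1..T. \<bar>c t\<bar>) ^ 4 * x m ^ 4" by (simp add: power_mult_distrib power_even_abs)
  also have "\<dots> \<le> (\<Sum>t=1..T. \<bar>c t\<bar>) ^ 4 * (\<Sum>t=1..T. x t ^ 4)"
    using m(1) by (intro mult_left_mono member_le_sum) (auto intro!: zero_le_power sum_nonneg)
  finally show ?thesis by (simp add: power_even_abs)
qed (simp add: lin_def)

lemma emp_mean_lin: "emp_mean N (\<lambda>j. lin T c (x j)) = lin T c (\<lambda>t. emp_mean N (\<lambda>j. x j t))"
  unfolding emp_mean_def lin_def sum_divide_distrib sum_distrib_left
  by (subst sum.swap) simp

lemma emp_mean_lin_square: "emp_mean N (\<lambda>j. (lin T c (x j))\<^sup>2) = quad T (\<lambda>t v. emp_mean N (\<lambda>j. x j t * x j v)) c"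
proof -
  have "(\<Sum>j=1..N. (lin T c (x j))\<^sup>2) = (\<Sum>j=1..N. \<Sum>t=1..T. \<Sum>v=1..T. c t * c v * (x j t * x j v))"
    by (simp add: lin_def power2_eq_square sum_product mult_ac)
  also have "\<dots> = (\<Sum>t=1..T. \<Sum>j=1..N. \<Sum>v=1..T. c t * c v * (x j t * x j v))"
    by (rule sum.swap)
  also have "\<dots> = (\<Sum>t=1..T. \<Sum>v=1..T. \<Sum>j=1..N. c t * c v * (x j t * x j v))"
    by (intro sum.cong refl sum.swap)
  finally show ?thesis
    by (simp add: emp_mean_def quad_def sum_distrib_left sum_divide_distrib)
qed

lemma emp_mean_nonneg: "(\<And>j. 0 \<le> f j) \<Longrightarrow> 0 \<le> emp_mean N f"
  by (simp add: emp_mean_def sum_nonneg)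

lemma emp_mean_mono: "(\<And>j. f j \<le> g j) \<Longrightarrow> emp_mean N f \<le> emp_mean N g"
  by (simp add: emp_mean_def divide_right_mono sum_mono)

lemma emp_mean_add: "emp_mean N (\<lambda>j. f j + g j) = emp_mean N f + emp_mean N g"
  by (simp add: emp_mean_def sum.distrib add_divide_distrib)

lemma emp_mean_cmult: "emp_mean N (\<lambda>j. c * f j) = c * emp_mean N f"
  by (simp add: emp_mean_def sum_distrib_left)

lemma emp_mean_sum: "emp_mean N (\<lambda>j. \<Sum>t\<in>A. f t j) = (\<Sum>t\<in>A. emp_mean N (f t))"
  unfolding emp_mean_def sum_divide_distrib by (rule sum.swap)

lemma emp_mean_const: "N \<ge> 1 \<Longrightarrow> emp_mean N (\<lambda>j. c) = c"
  by (simp add: emp_mean_def)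

lemma expectation_uniform: "N \<ge> 1 \<Longrightarrow> measure_pmf.expectation (pmf_of_set {1..N}) f = emp_mean N f"
  by (subst integral_pmf_of_set) (auto simp: emp_mean_def)

lemma power4_diff_le: "(p - q) ^ 4 \<le> 8 * p ^ 4 + 8 * q ^ 4" for p q :: real
proof -
  have sq: "(p - q)\<^sup>2 \<le> 2 * (p\<^sup>2 + q\<^sup>2)"
    using zero_le_power2[of "p + q"] by (simp add: power2_eq_square algebra_simps)
  have sq2: "(p\<^sup>2 + q\<^sup>2)\<^sup>2 \<le> 2 * (p ^ 4 + q ^ 4)"
    using zero_le_power2[of "p\<^sup>2 - q\<^sup>2"] by (simp add: power2_eq_square power4_eq_xxxx algebra_simps)
  have "(p - q) ^ 4 = ((p - q)\<^sup>2)\<^sup>2" by simp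
  also have "\<dots> \<le> (2 * (p\<^sup>2 + q\<^sup>2))\<^sup>2" using sq by (intro power_mono) auto
  also have "\<dots> = 4 * (p\<^sup>2 + q\<^sup>2)\<^sup>2" unfolding power_mult_distrib by simp
  finally show ?thesis using sq2 by simp
qed

text \<open>
  A central limit theorem for rows drawn with replacement from the rows of an array \<open>x n\<close> and centred, without
  any randomness in the array. The variance of a resampled row is the empirical
  variance of the linear form, which converges by the assumptions on the first two empirical moments;
  the fourth empirical moment only has to be of smaller order than \<open>\<surd>N\<close>.
\<close>

lemma resampled_char_limit:
  fixes N :: "nat \<Rightarrow> nat" and x :: "nat \<Rightarrow> nat \<Rightarrow> nat \<Rightarrow> real"
  assumes N: "\<And>n. N n \<ge> 1" "filterlim N at_top sequentially"
    and m1: "\<And>t. t \<in> {1..T} \<Longrightarrow> (\<lambda>n. emp_mean (N n) (\<lambda>j. x n j t)) \<longlonglongrightarrow> 0"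
    and m2: "\<And>t v. t \<in> {1..T} \<Longrightarrow> v \<in> {1..T} \<Longrightarrow> (\<lambda>n. emp_mean (N n) (\<lambda>j. x n j t * x n j v)) \<longlonglongrightarrow> C t v"
    and m4: "\<And>t. t \<in> {1..T} \<Longrightarrow> (\<lambda>n. emp_mean (N n) (\<lambda>j. x n j t ^ 4) / sqrt (real (N n))) \<longlonglongrightarrow> 0"
  shows "(\<lambda>n. char (distr (measure_pmf (pmf_of_set {1..N n})) borel
        (\<lambda>j. lin T c (x n j) - emp_mean (N n) (\<lambda>j. lin T c (x n j)))) (1 / sqrt (real (N n))) ^ N n)
    \<longlonglongrightarrow> of_real (exp (- quad T C c / 2))"
proof -
  define a where "a n = emp_mean (N n) (\<lambda>j. lin T c (x n j))" for n
  define X where "X n j = lin T c (x n j) - a n" for n j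
  define v where "v n = emp_mean (N n) (\<lambda>j. (X n j)\<^sup>2)" for n
  define K where "K = (\<Sum>t=1..T. \<bar>c t\<bar>) ^ 4"
  have a: "a \<longlonglongrightarrow> 0"
  proof -
    have "(\<lambda>n. lin T c (\<lambda>t. emp_mean (N n) (\<lambda>j. x n j t))) \<longlonglongrightarrow> (\<Sum>t=1..T. c t * 0)"
      unfolding lin_def by (intro tendsto_sum tendsto_mult tendsto_const m1)
    then show ?thesis unfolding a_def emp_mean_lin by simp
  qed
  have v_eq: "v n = quad T (\<lambda>t v. emp_mean (N n) (\<lambda>j. x n j t * x n j v)) c - (a n)\<^sup>2" for n
  proof -
    have "v n = emp_mean (N n) (\<lambda>j. (lin T c (x n j))\<^sup>2 + ((- 2 * a n) * lin T c (x n j) + (a n)\<^sup>2))"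
      unfolding v_def X_def by (intro arg_cong[where f = "emp_mean (N n)"]) (auto simp: power2_eq_square algebra_simps)
    also have "\<dots> = emp_mean (N n) (\<lambda>j. (lin T c (x n j))\<^sup>2) - (a n)\<^sup>2"
      unfolding emp_mean_add emp_mean_cmult emp_mean_const[OF N(1)] by (simp add: a_def power2_eq_square)
    finally show ?thesis by (simp add: emp_mean_lin_square)
  qed
  have v: "v \<longlonglongrightarrow> quad T C c"
  proof -
    have "(\<lambda>n. quad T (\<lambda>t v. emp_mean (N n) (\<lambda>j. x n j t * x n j v)) c - (a n)\<^sup>2) \<longlonglongrightarrow> quad T C c - 0\<^sup>2"
      unfolding quad_def by (intro tendsto_intros a m2)
    then show ?thesis unfolding v_eq by simp
  qed
  have four: "emp_mean (N n) (\<lambda>j. X n j ^ 4) \<le> 8 * (K * (\<Sum>t=1..T. emp_mean (N n) (\<lambda>j. x n j t ^ 4)) + (a n) ^ 4)" for n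
  proof -
    have "X n j ^ 4 \<le> 8 * (K * (\<Sum>t=1..T. x n j t ^ 4)) + 8 * (a n) ^ 4" for j
    proof -
      show ?thesis
        using power4_diff_le[of "lin T c (x n j)" "a n"] lin_power4_bound[of T c "x n j"]
        unfolding X_def K_def by linarith
    qed
    then have "emp_mean (N n) (\<lambda>j. X n j ^ 4) \<le> emp_mean (N n) (\<lambda>j. 8 * (K * (\<Sum>t=1..T. x n j t ^ 4)) + 8 * (a n) ^ 4)"
      by (rule emp_mean_mono)
    then show ?thesis
      unfolding emp_mean_add emp_mean_cmult emp_mean_sum emp_mean_const[OF N(1)] by simp
  qed
  define b where "b n = (1 + 8 * (K * (\<Sum>t=1..T. emp_mean (N n) (\<lambda>j. x n j t ^ 4)) + (a n) ^ 4)) / sqrt (real (N n)) + (v n)\<^sup>2 / real (N n)" for n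
  have rN: "(\<lambda>n. 1 / sqrt (real (N n))) \<longlonglongrightarrow> 0" "(\<lambda>n. 1 / real (N n)) \<longlonglongrightarrow> 0"
  proof -
    have "(\<lambda>k. 1 / sqrt (real k)) \<longlonglongrightarrow> 0" "(\<lambda>k. 1 / real k) \<longlonglongrightarrow> 0" by real_asymp+
    then show "(\<lambda>n. 1 / sqrt (real (N n))) \<longlonglongrightarrow> 0" "(\<lambda>n. 1 / real (N n)) \<longlonglongrightarrow> 0"
      using N(2) by (auto intro: filterlim_compose)
  qed
  have b0: "b \<longlonglongrightarrow> 0"
  proof -
    have "(\<lambda>n. (1 + 8 * (a n) ^ 4) * (1 / sqrt (real (N n))) + 8 * K * (\<Sum>t=1..T. emp_mean (N n) (\<lambda>j. x n j t ^ 4) / sqrt (real (N n)))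
        + (v n)\<^sup>2 * (1 / real (N n))) \<longlonglongrightarrow> (1 + 8 * 0 ^ 4) * 0 + 8 * K * (\<Sum>t=1..T. 0) + (quad T C c)\<^sup>2 * 0"
      by (intro tendsto_intros a v rN m4)
    moreover have "(1 + 8 * (a n) ^ 4) * (1 / sqrt (real (N n))) + 8 * K * (\<Sum>t=1..T. emp_mean (N n) (\<lambda>j. x n j t ^ 4) / sqrt (real (N n)))
        + (v n)\<^sup>2 * (1 / real (N n)) = b n" for n
      unfolding b_def sum_divide_distrib[symmetric] by (simp add: add_divide_distrib distrib_right)
    ultimately show ?thesis by simp
  qed
  define \<phi> where "\<phi> n = char (distr (measure_pmf (pmf_of_set {1..N n})) borel (X n)) (1 / sqrt (real (N n))) ^ N n" for n
  have bound: "cmod (\<phi> n - of_real (exp (- v n / 2))) \<le> b n" for n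
  proof -
    have fin: "finite (set_pmf (pmf_of_set {1..N n}))" using N(1)[of n] by simp
    have "emp_mean (N n) (X n) = 0"
      unfolding X_def diff_conv_add_uminus emp_mean_add emp_mean_const[OF N(1)] by (simp add: a_def)
    then have "measure_pmf.expectation (pmf_of_set {1..N n}) (X n) = 0"
      using expectation_uniform[OF N(1)] by simp
    from measure_pmf.lyapunov_char_bound[OF _ integrable_measure_pmf_finite[OF fin] this N(1)]
    have "cmod (\<phi> n - of_real (exp (- v n / 2))) \<le> (1 + emp_mean (N n) (\<lambda>j. X n j ^ 4)) / sqrt (real (N n)) + (v n)\<^sup>2 / real (N n)"
      unfolding expectation_uniform[OF N(1)] v_def[symmetric] \<phi>_def by simp
    also have "\<dots> \<le> b n"
      unfolding b_def using four[of n] by (intro add_mono divide_right_mono) auto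
    finally show ?thesis .
  qed
  have "(\<lambda>n. \<phi> n - of_real (exp (- v n / 2))) \<longlonglongrightarrow> 0"
    by (rule Lim_null_comparison[OF _ b0]) (use bound in auto)
  moreover have "(\<lambda>n. complex_of_real (exp (- v n / 2))) \<longlonglongrightarrow> of_real (exp (- quad T C c / 2))"
    by (intro tendsto_intros v) auto
  ultimately have "(\<lambda>n. (\<phi> n - of_real (exp (- v n / 2))) + complex_of_real (exp (- v n / 2))) \<longlonglongrightarrow> 0 + of_real (exp (- quad T C c / 2))"
    by (rule tendsto_add)
  then show ?thesis by (simp add: \<phi>_def X_def[abs_def] a_def)
qed

section \<open>Partial sums, bridges and the ratio statistic\<close>

definition cum :: "(nat \<Rightarrow> real) \<Rightarrow> nat \<Rightarrow> real" where
  "cum x s = (\<Sum>r=1..s. x r)"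

definition bridge :: "nat \<Rightarrow> (nat \<Rightarrow> real) \<Rightarrow> nat \<Rightarrow> real" where
  "bridge T x s = x s - real s / real T * x T"

text \<open>
  The adjoints of the linear maps \<open>cum\<close> and \<open>bridge\<close>: they carry linear forms of the image back to linear forms of the argument.
\<close>

definition cum_coeff :: "nat \<Rightarrow> (nat \<Rightarrow> real) \<Rightarrow> nat \<Rightarrow> real" where
  "cum_coeff T u t = (\<Sum>s=t..T. u s)"

definition bridge_coeff :: "nat \<Rightarrow> (nat \<Rightarrow> real) \<Rightarrow> nat \<Rightarrow> real" where
  "bridge_coeff T u t = u t - (if t = T then (\<Sum>s=1..T. u s * real s) / real T else 0)"

lemma lin_cum: "lin T u (cum x) = lin T (cum_coeff T u) x"
proof -
  have "lin T u (cum x) = (\<Sum>s=1..T. \<Sum>r=1..T. if r \<le> s then u s * x r else 0)"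
    unfolding lin_def cum_def sum_distrib_left
    by (intro sum.cong refl sum.mono_neutral_cong_left) auto
  also have "\<dots> = (\<Sum>r=1..T. \<Sum>s=1..T. if r \<le> s then u s * x r else 0)"
    by (rule sum.swap)
  also have "\<dots> = lin T (cum_coeff T u) x"
    unfolding lin_def cum_coeff_def sum_distrib_right
    by (intro sum.cong refl sum.mono_neutral_cong_right) auto
  finally show ?thesis .
qed

lemma lin_bridge:
  assumes "T \<ge> 1" shows "lin T u (bridge T x) = lin T (bridge_coeff T u) x"
proof -
  have "lin T (bridge_coeff T u) x =
      (\<Sum>t=1..T. u t * x t - (if t = T then (\<Sum>s=1..T. u s * real s) / real T * x T else 0))"
    unfolding lin_def bridge_coeff_def by (intro sum.cong refl) (auto simp: left_diff_distrib)
  also have "\<dots> = (\<Sum>t=1..T. u t * x t) - (\<Sum>s=1..T. u s * real s) / real T * x T"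
    using assms by (simp add: sum_subtractf)
  also have "\<dots> = lin T u (bridge T x)"
    by (simp add: lin_def bridge_def sum_subtractf sum_distrib_left sum_distrib_right sum_divide_distrib right_diff_distrib mult_ac)
  finally show ?thesis ..
qed

lemma Max_cmult:
  fixes f :: "'i \<Rightarrow> real"
  assumes "finite A" "A \<noteq> {}" "c \<ge> 0"
  shows "(MAX i\<in>A. c * f i) = c * (MAX i\<in>A. f i)"
  using mono_Max_commute[of "\<lambda>y. c * y" "f ` A"] assms
  by (simp add: image_image mono_def mult_left_mono)

lemma numer_affine:
  assumes "t \<ge> 1" "c \<ge> 0"
  shows "numer t (\<lambda>s. c * x s + a * real s) = c * numer t x"
proof -
  have "\<bar>(c * x s + a * real s) - real s / real t * (c * x t + a * real t)\<bar> = c * \<bar>x s - real s / real t * x t\<bar>" for s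
  proof -
    have "(c * x s + a * real s) - real s / real t * (c * x t + a * real t) = c * (x s - real s / real t * x t)"
      using assms(1) by (simp add: field_simps)
    then show ?thesis using assms(2) by (simp add: abs_mult)
  qed
  then show ?thesis
    unfolding numer_def using assms by (simp add: Max_cmult)
qed

lemma tail_dev_affine:
  assumes "t < T" "s \<le> T"
  shows "tail_dev T t s (\<lambda>s. c * x s + a * real s) = c * tail_dev T t s x"
proof -
  define k where "k = real (T - s) / real (T - t)"
  have "k * (real T - real t) = real T - real s" using assms by (simp add: k_def of_nat_diff)
  then have "a * (k * (real T - real t)) = a * (real T - real s)" by simp
  then show ?thesis
    unfolding tail_dev_def k_def[symmetric] by (simp add: algebra_simps)
qed

lemma denom_affine:
  assumes "t \<in> {2..T-2}" "c \<ge> 0"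
  shows "denom T t (\<lambda>s. c * x s + a * real s) = c * denom T t x"
proof -
  have "denom T t (\<lambda>s. c * x s + a * real s) = (MAX s\<in>{t..T-1}. c * \<bar>tail_dev T t s x\<bar>)"
    unfolding denom_def using assms
    by (intro arg_cong[where f = Max] image_cong refl) (subst tail_dev_affine, auto simp: abs_mult)
  then show ?thesis
    unfolding denom_def using assms by (subst (asm) Max_cmult) auto
qed

text \<open>
  Linear trends cancel in every deviation, and a common factor cancels in every quotient.
\<close>

lemma limit_ratio_affine:
  assumes "c > 0"
  shows "limit_ratio T (\<lambda>s. c * x s + a * real s) = limit_ratio T x"
  unfolding limit_ratio_eq using assms
  by (intro arg_cong[where f = Max] image_cong refl) (simp add: numer_affine denom_affine)

lemma limit_ratio_cong:
  assumes "\<And>s. s \<in> {1..T} \<Longrightarrow> x s = y s"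
  shows "limit_ratio T x = limit_ratio T y"
  unfolding limit_ratio_eq
proof (intro arg_cong[where f = Max] image_cong refl)
  fix t assume t: "t \<in> {2..T-2}"
  have "numer t x = numer t y"
    unfolding numer_def using t by (intro arg_cong[where f = Max] image_cong refl) (auto simp: assms)
  moreover have "denom T t x = denom T t y"
    unfolding denom_def tail_dev_def using t by (intro arg_cong[where f = Max] image_cong refl) (auto simp: assms)
  ultimately show "numer t x / denom T t x = numer t y / denom T t y" by simp
qed

text \<open>
  The reason why the bootstrap limit agrees with the limit under the null hypothesis.
\<close>

lemma limit_ratio_bridge: "limit_ratio T (bridge T x) = limit_ratio T x"
proof -
  have "bridge T x = (\<lambda>s. 1 * x s + (- x T / real T) * real s)"
    by (auto simp: bridge_def fun_eq_iff)
  then show ?thesis by (simp only: limit_ratio_affine[OF zero_less_one])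
qed

lemma cum_tail: "s \<le> T \<Longrightarrow> (\<Sum>r=s+1..T. x r) = cum x T - cum x s"
  unfolding cum_def using sum.ub_add_nat[of 1 s x "T - s"] by simp

lemma ratio_stat_limit_ratio:
  "ratio_stat T N y = limit_ratio T (\<lambda>s. \<Sum>i=1..N. cum (y i) s)"
proof -
  define V where "V s = (\<Sum>i=1..N. cum (y i) s)" for s
  have num: "(\<Sum>i=1..N. \<Sum>r=1..s. (y i r - mean_upto (y i) t)) = V s - real s / real t * V t" for s t
    unfolding V_def sum_distrib_left sum_subtractf[symmetric]
    by (intro sum.cong refl) (simp add: sum_subtractf cum_def mean_upto_def)
  have den: "(\<Sum>i=1..N. \<Sum>r=s+1..T. (y i r - mean_after T (y i) t)) = tail_dev T t s V" if "s \<le> T" "t \<le> T" for s t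
    unfolding V_def tail_dev_def sum_distrib_left sum_subtractf[symmetric]
    using that by (intro sum.cong refl) (simp add: sum_subtractf mean_after_def cum_tail[simplified])
  have "(MAX s\<in>{t..T-1}. \<bar>\<Sum>i=1..N. \<Sum>r=s+1..T. (y i r - mean_after T (y i) t)\<bar>) = denom T t V"
    if "t \<in> {2..T-2}" for t
    unfolding denom_def using that by (intro arg_cong[where f = Max] image_cong refl arg_cong[where f = abs] den) auto
  then show ?thesis
    unfolding ratio_stat_def limit_ratio_eq V_def[symmetric] num numer_def[symmetric] by simp
qed

lemma measurable_cum_vec [measurable]: "s \<le> T \<Longrightarrow> (\<lambda>x. cum x s) \<in> borel_measurable (vec_space T)"
  unfolding cum_def by (intro borel_measurable_sum measurable_component_singleton) auto

section \<open>Independent and identically distributed rows\<close>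

locale iid_rows = prob_space M for M :: "'a measure" +
  fixes T :: nat and X :: "nat \<Rightarrow> 'a \<Rightarrow> nat \<Rightarrow> real"
  assumes T_pos: "T \<ge> 1"
    and indep: "indep_vars (\<lambda>_. vec_space T) X {1..}"
    and ident: "\<And>i. i \<ge> 1 \<Longrightarrow> distr M (vec_space T) (X i) = distr M (vec_space T) (X 1)"
    and mean: "\<And>t. t \<in> {1..T} \<Longrightarrow> expectation (\<lambda>\<omega>. X 1 \<omega> t) = 0"
    and fourth: "\<And>t. t \<in> {1..T} \<Longrightarrow> integrable M (\<lambda>\<omega>. X 1 \<omega> t ^ 4)"
begin

definition cov :: "nat \<Rightarrow> nat \<Rightarrow> real" where
  "cov t v = expectation (\<lambda>\<omega>. X 1 \<omega> t * X 1 \<omega> v)"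

lemma rv_X: "i \<ge> 1 \<Longrightarrow> X i \<in> measurable M (vec_space T)"
  using indep by (auto simp: indep_vars_def)

lemma row_transfer:
  assumes f [measurable]: "f \<in> borel_measurable (vec_space T)" and i: "i \<ge> 1"
  shows "distr M borel (\<lambda>\<omega>. f (X i \<omega>)) = distr M borel (\<lambda>\<omega>. f (X 1 \<omega>))"
    and "integrable M (\<lambda>\<omega>. f (X i \<omega>) :: real) \<longleftrightarrow> integrable M (\<lambda>\<omega>. f (X 1 \<omega>))"
    and "expectation (\<lambda>\<omega>. f (X i \<omega>)) = expectation (\<lambda>\<omega>. f (X 1 \<omega>))"
    and "(AE \<omega> in M. f (X i \<omega>) = 0) \<longleftrightarrow> (AE \<omega> in M. f (X 1 \<omega>) = 0)"
proof -
  note [measurable] = rv_X[OF i] rv_X[of 1, simplified]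
  show "distr M borel (\<lambda>\<omega>. f (X i \<omega>)) = distr M borel (\<lambda>\<omega>. f (X 1 \<omega>))"
    using distr_distr[OF f rv_X[OF i]] distr_distr[OF f rv_X[of 1]] ident[OF i] by (simp add: comp_def)
  show "integrable M (\<lambda>\<omega>. f (X i \<omega>)) \<longleftrightarrow> integrable M (\<lambda>\<omega>. f (X 1 \<omega>))"
    using integrable_distr_eq[OF rv_X[OF i] f] integrable_distr_eq[OF rv_X[of 1] f] ident[OF i] by simp
  show "expectation (\<lambda>\<omega>. f (X i \<omega>)) = expectation (\<lambda>\<omega>. f (X 1 \<omega>))"
    using integral_distr[OF rv_X[OF i] f] integral_distr[OF rv_X[of 1] f] ident[OF i] by simp
  have P: "{x \<in> space (vec_space T). f x = 0} \<in> sets (vec_space T)" by measurable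
  show "(AE \<omega> in M. f (X i \<omega>) = 0) \<longleftrightarrow> (AE \<omega> in M. f (X 1 \<omega>) = 0)"
    using AE_distr_iff[OF rv_X[OF i] P] AE_distr_iff[OF rv_X[of 1] P] unfolding ident[OF i] by blast
qed

lemma indep_rows: "f \<in> borel_measurable (vec_space T) \<Longrightarrow> indep_vars (\<lambda>_. borel) (\<lambda>i \<omega>. f (X i \<omega>)) {1..}"
  by (rule indep_vars_compose2[OF indep])

lemma rv_coord: "t \<in> {1..T} \<Longrightarrow> random_variable borel (\<lambda>\<omega>. X 1 \<omega> t)"
  by (rule measurable_compose[OF rv_X measurable_component_singleton]) auto

lemma integrable_product_square:
  assumes t: "t \<in> {1..T}" "v \<in> {1..T}"
  shows "integrable M (\<lambda>\<omega>. (X 1 \<omega> t * X 1 \<omega> v)\<^sup>2)" "integrable M (\<lambda>\<omega>. X 1 \<omega> t * X 1 \<omega> v)"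
proof -
  note [measurable] = rv_coord[OF t(1)] rv_coord[OF t(2)]
  have *: "(x * y)\<^sup>2 \<le> x ^ 4 + y ^ 4" for x y :: real
    using zero_le_power2[of "x\<^sup>2 - y\<^sup>2"] zero_le_power2[of "x * y"] by (simp add: power2_eq_square power4_eq_xxxx algebra_simps)
  show sq: "integrable M (\<lambda>\<omega>. (X 1 \<omega> t * X 1 \<omega> v)\<^sup>2)"
    by (rule Bochner_Integration.integrable_bound[OF Bochner_Integration.integrable_add[OF fourth[OF t(1)] fourth[OF t(2)]]])
       (use * in \<open>auto intro!: AE_I2 order.trans[OF _ abs_ge_self] simp del: One_nat_def\<close>)
  show "integrable M (\<lambda>\<omega>. X 1 \<omega> t * X 1 \<omega> v)"
    by (rule square_integrable_imp_integrable[OF _ sq]) measurable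
qed

lemma integrable_coord: "t \<in> {1..T} \<Longrightarrow> integrable M (\<lambda>\<omega>. X 1 \<omega> t)"
  using integrable_power4_imp(2)[OF rv_coord fourth, of t 1] by simp

lemma rv_lin: "random_variable borel (\<lambda>\<omega>. lin T c (X 1 \<omega>))"
  by (rule measurable_compose[OF rv_X measurable_lin]) simp

lemma lin_fourth: "integrable M (\<lambda>\<omega>. lin T c (X 1 \<omega>) ^ 4)"
proof (rule Bochner_Integration.integrable_bound)
  show "integrable M (\<lambda>\<omega>. (\<Sum>t=1..T. \<bar>c t\<bar>) ^ 4 * (\<Sum>t=1..T. X 1 \<omega> t ^ 4))"
    by (intro integrable_mult_right Bochner_Integration.integrable_sum fourth)
  show "(\<lambda>\<omega>. lin T c (X 1 \<omega>) ^ 4) \<in> borel_measurable M" using rv_lin by measurable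
  show "AE \<omega> in M. norm (lin T c (X 1 \<omega>) ^ 4) \<le> norm ((\<Sum>t=1..T. \<bar>c t\<bar>) ^ 4 * (\<Sum>t=1..T. X 1 \<omega> t ^ 4))"
    using lin_power4_bound[of T c] by (intro AE_I2) (auto simp: power_abs intro!: order.trans[OF _ abs_ge_self])
qed

lemma lin_mean: "expectation (\<lambda>\<omega>. lin T c (X 1 \<omega>)) = 0"
proof -
  have "expectation (\<lambda>\<omega>. lin T c (X 1 \<omega>)) = (\<Sum>t=1..T. expectation (\<lambda>\<omega>. c t * X 1 \<omega> t))"
    unfolding lin_def by (intro Bochner_Integration.integral_sum integrable_mult_right integrable_coord)
  also have "\<dots> = 0" by (intro sum.neutral ballI) (simp add: mean del: One_nat_def)
  finally show ?thesis .
qed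

lemma lin_product:
  "expectation (\<lambda>\<omega>. lin T c (X 1 \<omega>) * lin T d (X 1 \<omega>)) = (\<Sum>t=1..T. \<Sum>v=1..T. c t * d v * cov t v)"
  "integrable M (\<lambda>\<omega>. lin T c (X 1 \<omega>) * lin T d (X 1 \<omega>))"
proof -
  have eq: "lin T c x * lin T d x = (\<Sum>t=1..T. \<Sum>v=1..T. c t * d v * (x t * x v))" for x
    by (simp add: lin_def sum_product mult_ac)
  show "integrable M (\<lambda>\<omega>. lin T c (X 1 \<omega>) * lin T d (X 1 \<omega>))"
    unfolding eq by (intro Bochner_Integration.integrable_sum integrable_mult_right integrable_product_square)
  have "expectation (\<lambda>\<omega>. lin T c (X 1 \<omega>) * lin T d (X 1 \<omega>)) =
      (\<Sum>t=1..T. expectation (\<lambda>\<omega>. \<Sum>v=1..T. c t * d v * (X 1 \<omega> t * X 1 \<omega> v)))"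
    unfolding eq by (intro Bochner_Integration.integral_sum Bochner_Integration.integrable_sum
      integrable_mult_right integrable_product_square)
  also have "\<dots> = (\<Sum>t=1..T. \<Sum>v=1..T. expectation (\<lambda>\<omega>. c t * d v * (X 1 \<omega> t * X 1 \<omega> v)))"
    by (intro sum.cong refl Bochner_Integration.integral_sum integrable_mult_right integrable_product_square)
  finally show "expectation (\<lambda>\<omega>. lin T c (X 1 \<omega>) * lin T d (X 1 \<omega>)) = (\<Sum>t=1..T. \<Sum>v=1..T. c t * d v * cov t v)"
    by (simp add: cov_def)
qed

lemma lin_square: "expectation (\<lambda>\<omega>. (lin T c (X 1 \<omega>))\<^sup>2) = quad T cov c"
  using lin_product(1)[of c c] by (simp add: power2_eq_square quad_def)

lemma quad_cov_nonneg: "0 \<le> quad T cov c"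
  unfolding lin_square[symmetric] by simp

text \<open>
  A centred variable of variance \<open>0\<close> vanishes almost surely, and the rows have the same law.
\<close>

lemma degenerate_rows:
  assumes "quad T cov c = 0" "i \<ge> 1"
  shows "AE \<omega> in M. lin T c (X i \<omega>) = 0"
proof -
  have "integrable M (\<lambda>\<omega>. (lin T c (X 1 \<omega>))\<^sup>2)"
    using lin_product(2)[of c c] by (simp add: power2_eq_square)
  then have "AE \<omega> in M. (lin T c (X 1 \<omega>))\<^sup>2 = 0"
    using assms(1) lin_square[of c] by (simp add: integral_nonneg_eq_0_iff_AE)
  then have "AE \<omega> in M. lin T c (X 1 \<omega>) = 0" by simp
  then show ?thesis using row_transfer(4)[OF measurable_lin assms(2)] by simp
qed

lemma emp_mean_rows_converge:
  assumes f: "f \<in> borel_measurable (vec_space T)" and int: "integrable M (\<lambda>\<omega>. (f (X 1 \<omega>))\<^sup>2)" and "d > 0"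
  shows "(\<lambda>N. prob {\<omega>\<in>space M. d \<le> \<bar>emp_mean N (\<lambda>j. f (X j \<omega>)) - expectation (\<lambda>\<omega>. f (X 1 \<omega>))\<bar>}) \<longlonglongrightarrow> 0"
proof (rule weak_law[OF indep_rows[OF f] _ _ _ \<open>d > 0\<close>])
  fix i :: nat assume i: "i \<ge> 1"
  have f2: "(\<lambda>x. (f x)\<^sup>2) \<in> borel_measurable (vec_space T)" using f by measurable
  show "integrable M (\<lambda>\<omega>. (f (X i \<omega>))\<^sup>2)" using row_transfer(2)[OF f2 i] int by simp
  show "expectation (\<lambda>\<omega>. f (X i \<omega>)) = expectation (\<lambda>\<omega>. f (X 1 \<omega>))" by (rule row_transfer[OF f i])
  show "expectation (\<lambda>\<omega>. (f (X i \<omega>))\<^sup>2) = expectation (\<lambda>\<omega>. (f (X 1 \<omega>))\<^sup>2)" by (rule row_transfer[OF f2 i])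
qed

text \<open>
  Markov's inequality, as the expectation of the empirical mean does not depend on \<open>N\<close>.
\<close>

lemma emp_mean_rows_bounded:
  assumes f [measurable]: "f \<in> borel_measurable (vec_space T)" and int: "integrable M (\<lambda>\<omega>. f (X 1 \<omega>))"
    and nonneg: "\<And>x. 0 \<le> f x" and d: "d > 0"
  shows "(\<lambda>N. prob {\<omega>\<in>space M. d * sqrt (real N) \<le> emp_mean N (\<lambda>j. f (X j \<omega>))}) \<longlonglongrightarrow> 0"
proof (rule tendsto_sandwich[where f = "\<lambda>_. 0"])
  define m where "m = expectation (\<lambda>\<omega>. f (X 1 \<omega>))"
  show "(\<lambda>N. m / d * (1 / sqrt (real N))) \<longlonglongrightarrow> 0"
  proof -
    have "(\<lambda>k. 1 / sqrt (real k)) \<longlonglongrightarrow> 0" by real_asymp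
    from tendsto_mult[OF tendsto_const[of "m / d"] this] show ?thesis by simp
  qed
  show "eventually (\<lambda>N. prob {\<omega>\<in>space M. d * sqrt (real N) \<le> emp_mean N (\<lambda>j. f (X j \<omega>))} \<le> m / d * (1 / sqrt (real N))) sequentially"
    using eventually_ge_at_top[of 1]
  proof eventually_elim
    case (elim N)
    have i: "integrable M (\<lambda>\<omega>. f (X j \<omega>))" "expectation (\<lambda>\<omega>. f (X j \<omega>)) = m" if "j \<in> {1..N}" for j
      using row_transfer(2,3)[OF f, of j] int that by (auto simp: m_def)
    have int: "integrable M (\<lambda>\<omega>. emp_mean N (\<lambda>j. f (X j \<omega>)))"
      unfolding emp_mean_def by (intro integrable_divide Bochner_Integration.integrable_sum i)
    have "expectation (\<lambda>\<omega>. emp_mean N (\<lambda>j. f (X j \<omega>))) = (\<Sum>j=1..N. expectation (\<lambda>\<omega>. f (X j \<omega>))) / real N"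
      unfolding emp_mean_def using i(1) by (subst integral_divide_zero, subst Bochner_Integration.integral_sum) auto
    also have "(\<Sum>j=1..N. expectation (\<lambda>\<omega>. f (X j \<omega>))) = (\<Sum>j=1..N. m)"
      by (intro sum.cong refl i(2))
    also have "\<dots> / real N = m" using elim by simp
    finally have e: "expectation (\<lambda>\<omega>. emp_mean N (\<lambda>j. f (X j \<omega>))) = m" .
    have "prob {\<omega>\<in>space M. d * sqrt (real N) \<le> emp_mean N (\<lambda>j. f (X j \<omega>))} \<le> m / (d * sqrt (real N))"
      unfolding e[symmetric]
      by (rule integral_Markov_inequality_measure[OF int, where A = "{}"]) (use elim d emp_mean_nonneg nonneg in auto)
    then show ?case by simp
  qed
qed auto

definition sample_sum :: "nat \<Rightarrow> 'a \<Rightarrow> nat \<Rightarrow> real" where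
  "sample_sum N \<omega> = (\<lambda>s\<in>{1..T}. (\<Sum>i=1..N. cum (X i \<omega>) s) / sqrt (real N))"

lemma measurable_sample_sum [measurable]: "sample_sum N \<in> measurable M (vec_space T)"
  unfolding sample_sum_def[abs_def]
proof (intro measurable_restrict borel_measurable_divide borel_measurable_sum)
  fix s i assume "s \<in> {1..T}" "i \<in> {1..N}"
  then show "(\<lambda>\<omega>. cum (X i \<omega>) s) \<in> borel_measurable M"
    by (intro measurable_compose[OF rv_X measurable_cum_vec]) auto
qed simp

lemma lin_sample_sum:
  "lin T u (sample_sum N \<omega>) = (\<Sum>i=1..N. lin T (cum_coeff T u) (X i \<omega>)) / sqrt (real N)"
proof -
  have "lin T u (sample_sum N \<omega>) = (\<Sum>s=1..T. \<Sum>i=1..N. u s * cum (X i \<omega>) s / sqrt (real N))"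
    unfolding lin_def sample_sum_def
    by (intro sum.cong refl) (simp add: sum_distrib_left sum_divide_distrib)
  also have "\<dots> = (\<Sum>i=1..N. \<Sum>s=1..T. u s * cum (X i \<omega>) s / sqrt (real N))" by (rule sum.swap)
  also have "\<dots> = (\<Sum>i=1..N. lin T u (cum (X i \<omega>)) / sqrt (real N))"
    unfolding lin_def by (simp add: sum_divide_distrib)
  finally show ?thesis by (simp add: lin_cum sum_divide_distrib)
qed

lemma sample_char_fun_limit:
  "(\<lambda>N. char_fun T (distr M (vec_space T) (sample_sum N)) u) \<longlonglongrightarrow> of_real (exp (- quad T cov (cum_coeff T u) / 2))"
proof -
  define c where "c = cum_coeff T u"
  define m where "m = expectation (\<lambda>\<omega>. lin T c (X 1 \<omega>) ^ 4)"
  define b where "b N = (1 + m) / sqrt (real N) + (quad T cov c)\<^sup>2 / real N" for N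
  have "cmod (char_fun T (distr M (vec_space T) (sample_sum N)) u - of_real (exp (- quad T cov c / 2))) \<le> b N" if N: "N \<ge> 1" for N
  proof -
    have "char_fun T (distr M (vec_space T) (sample_sum N)) u =
        char (distr M borel (\<lambda>\<omega>. lin T c (X 1 \<omega>))) (1 / sqrt (real N)) ^ N"
    proof (rule char_fun_indep_sum)
      show "indep_vars (\<lambda>_. borel) (\<lambda>i \<omega>. lin T c (X i \<omega>)) {1..N}"
        by (rule indep_vars_subset[OF indep_rows[OF measurable_lin]]) auto
      show "distr M borel (\<lambda>\<omega>. lin T c (X i \<omega>)) = distr M borel (\<lambda>\<omega>. lin T c (X 1 \<omega>))" if "i \<in> {1..N}" for i
        using that by (intro row_transfer[OF measurable_lin]) simp
    qed (simp_all add: lin_sample_sum c_def del: One_nat_def)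
    then show ?thesis
      using lyapunov_char_bound[OF rv_lin lin_fourth lin_mean N, of c] by (simp add: lin_square b_def m_def del: One_nat_def)
  qed
  then have "eventually (\<lambda>N. cmod (char_fun T (distr M (vec_space T) (sample_sum N)) u - of_real (exp (- quad T cov c / 2))) \<le> b N) sequentially"
    by (rule eventually_sequentiallyI)
  moreover have "b \<longlonglongrightarrow> 0"
  proof -
    have "(\<lambda>N. 1 / sqrt (real N)) \<longlonglongrightarrow> 0" "(\<lambda>N. 1 / real N) \<longlonglongrightarrow> 0" by real_asymp+
    then have "(\<lambda>N. (1 + m) * (1 / sqrt (real N)) + (quad T cov c)\<^sup>2 * (1 / real N)) \<longlonglongrightarrow> (1 + m) * 0 + (quad T cov c)\<^sup>2 * 0"
      by (intro tendsto_intros)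
    then show ?thesis by (simp add: b_def[abs_def])
  qed
  ultimately have "(\<lambda>N. char_fun T (distr M (vec_space T) (sample_sum N)) u - of_real (exp (- quad T cov c / 2))) \<longlonglongrightarrow> 0"
    by (rule Lim_null_comparison)
  then show ?thesis unfolding c_def by (rule Lim_null[THEN iffD2])
qed

end

section \<open>The bootstrap law\<close>

text \<open>
  The normalized partial sums of resampled and centred rows. Dividing by \<open>\<kappa>\<close>, which is the scale of the errors
  in the application, makes the limit independent of that scale.
\<close>

definition boot_sum ::
  "nat \<Rightarrow> nat \<Rightarrow> real \<Rightarrow> (nat \<Rightarrow> nat \<Rightarrow> real) \<Rightarrow> (nat \<Rightarrow> nat \<Rightarrow> real) \<Rightarrow> nat \<Rightarrow> real" where
  "boot_sum T N \<kappa> e e' =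
     (\<lambda>s\<in>{1..T}. (\<Sum>i=1..N. (cum (e' i) s - emp_mean N (\<lambda>j. cum (e j) s)) / \<kappa>) / sqrt (real N))"

definition boot_sum_law ::
  "nat \<Rightarrow> nat \<Rightarrow> real \<Rightarrow> (nat \<Rightarrow> nat \<Rightarrow> real) \<Rightarrow> (nat \<Rightarrow> real) measure" where
  "boot_sum_law T N \<kappa> e = distr (measure_pmf (bootstrap_rows N e)) (vec_space T) (boot_sum T N \<kappa> e)"

lemma measurable_boot_sum: "boot_sum T N \<kappa> e \<in> measurable (measure_pmf p) (vec_space T)"
  by (auto simp: measurable_pmf_measure1 space_PiM boot_sum_def)

lemma prob_space_boot_sum_law: "prob_space (boot_sum_law T N \<kappa> e)"
  unfolding boot_sum_law_def by (intro measure_pmf.prob_space_distr measurable_boot_sum)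

lemma sets_boot_sum_law: "sets (boot_sum_law T N \<kappa> e) = sets (vec_space T)"
  by (simp add: boot_sum_law_def)

lemma distr_map_pmf: "distr (measure_pmf (map_pmf f p)) borel g = distr (measure_pmf p) borel (\<lambda>x. g (f x))"
  by (simp add: map_pmf_rep_eq distr_distr comp_def)

lemma bootstrap_law_boot_sum_law:
  assumes "T \<ge> 4" "N \<ge> 1" "\<kappa> > 0"
  shows "bootstrap_law T N \<theta> y = distr (boot_sum_law T N \<kappa> (residual T \<theta> y)) borel (limit_ratio T)"
proof -
  define e where "e = residual T \<theta> y"
  have stat: "ratio_stat T N (\<lambda>i t. e' i t - (\<Sum>j=1..N. e j t) / real N) = limit_ratio T (boot_sum T N \<kappa> e e')" for e'
  proof -
    have cum: "cum (\<lambda>t. e' i t - (\<Sum>j=1..N. e j t) / real N) s = cum (e' i) s - emp_mean N (\<lambda>j. cum (e j) s)" for i s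
      unfolding cum_def emp_mean_def sum_subtractf sum_divide_distrib[symmetric] by (subst sum.swap) simp
    have "ratio_stat T N (\<lambda>i t. e' i t - (\<Sum>j=1..N. e j t) / real N) =
        limit_ratio T (\<lambda>s. \<Sum>i=1..N. cum (e' i) s - emp_mean N (\<lambda>j. cum (e j) s))"
      unfolding ratio_stat_limit_ratio cum ..
    also have "\<dots> = limit_ratio T (\<lambda>s. (\<kappa> * sqrt (real N)) * boot_sum T N \<kappa> e e' s + 0 * real s)"
      using assms by (intro limit_ratio_cong) (simp add: boot_sum_def sum_divide_distrib[symmetric])
    also have "\<dots> = limit_ratio T (boot_sum T N \<kappa> e e')"
      using assms by (intro limit_ratio_affine) simp
    finally show ?thesis .
  qed
  have "bootstrap_law T N \<theta> y = distr (measure_pmf (bootstrap_rows N e)) borel (\<lambda>e'. limit_ratio T (boot_sum T N \<kappa> e e'))"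
    unfolding bootstrap_law_def bootstrap_panel_def e_def[symmetric] distr_map_pmf stat ..
  also have "\<dots> = distr (boot_sum_law T N \<kappa> e) borel (limit_ratio T)"
    unfolding boot_sum_law_def
    by (subst distr_distr[OF measurable_limit_ratio[OF assms(1)] measurable_boot_sum]) (simp add: comp_def)
  finally show ?thesis by (simp add: e_def)
qed

lemma lin_boot_sum:
  "lin T u (boot_sum T N \<kappa> e e') =
    (\<Sum>i=1..N. lin T u (\<lambda>s. (cum (e' i) s - emp_mean N (\<lambda>j. cum (e j) s)) / \<kappa>)) / sqrt (real N)"
proof -
  have "lin T u (boot_sum T N \<kappa> e e') =
      (\<Sum>s=1..T. \<Sum>i=1..N. u s * ((cum (e' i) s - emp_mean N (\<lambda>j. cum (e j) s)) / \<kappa>) / sqrt (real N))"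
    unfolding lin_def boot_sum_def
    by (intro sum.cong refl) (simp add: sum_distrib_left sum_divide_distrib)
  also have "\<dots> = (\<Sum>i=1..N. \<Sum>s=1..T. u s * ((cum (e' i) s - emp_mean N (\<lambda>j. cum (e j) s)) / \<kappa>) / sqrt (real N))"
    by (rule sum.swap)
  finally show ?thesis unfolding lin_def sum_divide_distrib .
qed

context
  fixes T N :: nat and \<kappa> :: real and e x :: "nat \<Rightarrow> nat \<Rightarrow> real"
  assumes T: "T \<ge> 1" and N: "N \<ge> 1" and \<kappa>: "\<kappa> > 0"
    and rows: "\<And>j s. j \<in> {1..N} \<Longrightarrow> s \<in> {1..T} \<Longrightarrow> cum (e j) s = \<kappa> * bridge T (cum (x j)) s"
begin

text \<open>
  The rows \<open>e\<close> stand for residuals and \<open>x\<close> for errors: linear forms of the partial sums of a resampled residual row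
  are linear forms of errors, centred by their empirical mean, as in \<open>resampled_char_limit\<close>.
\<close>

lemma resampled_row:
  assumes j: "j \<in> {1..N}"
  defines "c \<equiv> \<lambda>u. cum_coeff T (bridge_coeff T u)"
  shows "lin T u (\<lambda>s. (cum (e j) s - emp_mean N (\<lambda>j. cum (e j) s)) / \<kappa>)
    = lin T (c u) (x j) - emp_mean N (\<lambda>j. lin T (c u) (x j))"
proof -
  have c: "lin T (c u) (x j) = lin T u (bridge T (cum (x j)))" for j
    using T by (simp add: c_def lin_cum lin_bridge)
  have "(cum (e j) s - emp_mean N (\<lambda>j. cum (e j) s)) / \<kappa> =
      bridge T (cum (x j)) s - emp_mean N (\<lambda>j. bridge T (cum (x j)) s)" if s: "s \<in> {1..T}" for s
  proof -
    have "emp_mean N (\<lambda>j. cum (e j) s) = emp_mean N (\<lambda>j. \<kappa> * bridge T (cum (x j)) s)"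
      unfolding emp_mean_def using s by (intro arg_cong2[where f = divide] sum.cong refl rows)
    then show ?thesis
      using \<kappa> rows[OF j s] by (simp add: emp_mean_cmult flip: right_diff_distrib)
  qed
  then have "lin T u (\<lambda>s. (cum (e j) s - emp_mean N (\<lambda>j. cum (e j) s)) / \<kappa>) =
      lin T u (\<lambda>s. bridge T (cum (x j)) s - emp_mean N (\<lambda>j. bridge T (cum (x j)) s))"
    unfolding lin_def by (intro sum.cong refl) simp
  also have "\<dots> = lin T u (bridge T (cum (x j))) - emp_mean N (\<lambda>j. lin T u (bridge T (cum (x j))))"
    unfolding emp_mean_lin by (simp add: lin_def right_diff_distrib sum_subtractf)
  finally show ?thesis by (simp add: c)
qed

lemma boot_sum_law_char_fun:
  defines "c \<equiv> \<lambda>u. cum_coeff T (bridge_coeff T u)"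
  shows "char_fun T (boot_sum_law T N \<kappa> e) u =
    char (distr (measure_pmf (pmf_of_set {1..N})) borel
      (\<lambda>j. lin T (c u) (x j) - emp_mean N (\<lambda>j. lin T (c u) (x j)))) (1 / sqrt (real N)) ^ N"
  unfolding boot_sum_law_def
proof (rule measure_pmf.char_fun_indep_sum)
  define h where "h row = lin T u (\<lambda>s. (cum row s - emp_mean N (\<lambda>j. cum (e j) s)) / \<kappa>)" for row
  show "prob_space.indep_vars (measure_pmf (bootstrap_rows N e)) (\<lambda>_. borel) (\<lambda>i e'. h (e' i)) {1..N}"
    unfolding bootstrap_rows_def
    by (rule prob_space.indep_vars_compose2[OF measure_pmf.prob_space_axioms indep_vars_Pi_pmf]) auto
  show "boot_sum T N \<kappa> e \<in> measurable (measure_pmf (bootstrap_rows N e)) (vec_space T)"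
    by (rule measurable_boot_sum)
  show "lin T u (boot_sum T N \<kappa> e e') = (\<Sum>i=1..N. h (e' i)) / sqrt (real N)" for e'
    by (simp add: lin_boot_sum h_def)
  fix i assume i: "i \<in> {1..N}"
  have "distr (measure_pmf (bootstrap_rows N e)) borel (\<lambda>e'. h (e' i)) =
      distr (measure_pmf (map_pmf (\<lambda>e'. e' i) (bootstrap_rows N e))) borel h"
    by (simp add: distr_map_pmf)
  also have "map_pmf (\<lambda>e'. e' i) (bootstrap_rows N e) = map_pmf e (pmf_of_set {1..N})"
    unfolding bootstrap_rows_def using i by (subst Pi_pmf_component) auto
  also have "distr (measure_pmf (map_pmf e (pmf_of_set {1..N}))) borel h = distr (measure_pmf (pmf_of_set {1..N})) borel (\<lambda>j. h (e j))"
    by (simp add: distr_map_pmf)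
  also have "\<dots> = distr (measure_pmf (pmf_of_set {1..N})) borel (\<lambda>j. lin T (c u) (x j) - emp_mean N (\<lambda>j. lin T (c u) (x j)))"
  proof (rule distr_cong_AE)
    have "set_pmf (pmf_of_set {1..N}) = {1..N}" using N by (intro set_pmf_of_set) auto
    then show "AE j in measure_pmf (pmf_of_set {1..N}). h (e j) = lin T (c u) (x j) - emp_mean N (\<lambda>j. lin T (c u) (x j))"
      unfolding h_def c_def by (intro AE_pmfI resampled_row) auto
  qed auto
  finally show "distr (measure_pmf (bootstrap_rows N e)) borel (\<lambda>e'. h (e' i)) =
    distr (measure_pmf (pmf_of_set {1..N})) borel (\<lambda>j. lin T (c u) (x j) - emp_mean N (\<lambda>j. lin T (c u) (x j)))" .
qed

text \<open>
  Resampling only reproduces given rows, so a linear form that vanishes on all of them vanishes on every resample.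
\<close>

lemma boot_sum_law_degenerate:
  assumes "\<And>j. j \<in> {1..N} \<Longrightarrow> lin T u (bridge T (cum (x j))) = 0"
  shows "AE z in boot_sum_law T N \<kappa> e. lin T u z = 0"
proof -
  have "AE e' in measure_pmf (bootstrap_rows N e). lin T u (boot_sum T N \<kappa> e e') = 0"
  proof (rule AE_pmfI)
    fix e' assume e': "e' \<in> set_pmf (bootstrap_rows N e)"
    have "lin T u (\<lambda>s. (cum (e' i) s - emp_mean N (\<lambda>j. cum (e j) s)) / \<kappa>) = 0" if i: "i \<in> {1..N}" for i
    proof -
      have "e' i \<in> e ` {1..N}"
        using e' i N by (auto simp: bootstrap_rows_def set_Pi_pmf PiE_dflt_def set_pmf_of_set)
      then obtain j where j: "j \<in> {1..N}" "e' i = e j" by auto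
      have "lin T (cum_coeff T (bridge_coeff T u)) (x j) = 0" if "j \<in> {1..N}" for j
        using assms[OF that] T by (simp add: lin_cum lin_bridge)
      then show ?thesis
        unfolding j(2) resampled_row[OF j(1)] using j(1) by (simp add: emp_mean_def)
    qed
    then show "lin T u (boot_sum T N \<kappa> e e') = 0" by (simp add: lin_boot_sum)
  qed
  moreover have P: "{z \<in> space (vec_space T). lin T u z = 0} \<in> sets (vec_space T)" by measurable
  ultimately show ?thesis
    unfolding boot_sum_law_def by (subst AE_distr_iff[OF measurable_boot_sum P])
qed

end

text \<open>
  If no change is estimated, the residuals are the deviations from the mean over the whole period, and their sums form a bridge.
\<close>

lemma cum_residual:
  assumes "s \<in> {1..T}"
  shows "cum (residual T T y j) s = bridge T (cum (y j)) s"
proof -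
  have "cum (residual T T y j) s = (\<Sum>r=1..s. y j r - mean_upto (y j) T)"
    unfolding cum_def using assms by (intro sum.cong refl) (auto simp: residual_def)
  then show ?thesis by (simp add: sum_subtractf bridge_def cum_def mean_upto_def)
qed

lemma bridge_affine:
  assumes "T \<ge> 1" shows "bridge T (\<lambda>s. c * x s + a * real s) s = c * bridge T x s"
  using assms by (simp add: bridge_def field_simps)

context prob_space begin

definition negligible_events :: "(nat \<Rightarrow> 'a set) \<Rightarrow> bool" where
  "negligible_events A \<longleftrightarrow> (\<forall>N. A N \<in> events) \<and> (\<lambda>N. prob (A N)) \<longlonglongrightarrow> 0"

lemma negligible_events_Un:
  assumes "negligible_events A" "negligible_events B"
  shows "negligible_events (\<lambda>N. A N \<union> B N)"
  unfolding negligible_events_def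
proof (intro conjI allI)
  have AB: "\<And>N. A N \<in> events" "\<And>N. B N \<in> events" using assms by (auto simp: negligible_events_def)
  show "A N \<union> B N \<in> events" for N using AB by simp
  have lim: "(\<lambda>N. prob (A N) + prob (B N)) \<longlonglongrightarrow> 0"
    using tendsto_add[of "\<lambda>N. prob (A N)" 0 _ "\<lambda>N. prob (B N)" 0] assms by (simp add: negligible_events_def)
  show "(\<lambda>N. prob (A N \<union> B N)) \<longlonglongrightarrow> 0"
    by (rule tendsto_sandwich[OF _ _ tendsto_const lim])
       (use AB in \<open>auto intro!: always_eventually measure_Un_le\<close>)
qed

lemma negligible_events_UN:
  assumes "finite I" "\<And>i. i \<in> I \<Longrightarrow> negligible_events (A i)"
  shows "negligible_events (\<lambda>N. \<Union>i\<in>I. A i N)"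
  using assms
proof (induction I rule: finite_induct)
  case empty
  then show ?case by (simp add: negligible_events_def)
next
  case (insert i I)
  then show ?case using negligible_events_Un[of "A i" "\<lambda>N. \<Union>i\<in>I. A i N"] by simp
qed

end

context iid_rows begin

text \<open>
  The realizations for which the empirical moments satisfy the assumptions of \<open>resampled_char_limit\<close> up to
  \<open>d\<close>. The last clause transfers the almost sure degeneracy of denominators to the rows at hand.
\<close>

definition typical :: "real \<Rightarrow> nat \<Rightarrow> 'a \<Rightarrow> bool" where
  "typical d N \<omega> \<longleftrightarrow>
    (\<forall>t\<in>{1..T}. \<bar>emp_mean N (\<lambda>j. X j \<omega> t)\<bar> \<le> d) \<and>
    (\<forall>t\<in>{1..T}. \<forall>v\<in>{1..T}. \<bar>emp_mean N (\<lambda>j. X j \<omega> t * X j \<omega> v) - cov t v\<bar> \<le> d) \<and>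
    (\<forall>t\<in>{1..T}. emp_mean N (\<lambda>j. X j \<omega> t ^ 4) \<le> d * sqrt (real N)) \<and>
    (\<forall>t\<in>{2..T-2}. \<forall>s\<in>{t..T-1}. quad T cov (cum_coeff T (bridge_coeff T (tail_coeff T t s))) = 0 \<longrightarrow>
      (\<forall>j\<in>{1..N}. lin T (tail_coeff T t s) (bridge T (cum (X j \<omega>))) = 0))"

lemma measurable_emp_mean_rows:
  "f \<in> borel_measurable (vec_space T) \<Longrightarrow> (\<lambda>\<omega>. emp_mean N (\<lambda>j. f (X j \<omega>))) \<in> borel_measurable M"
  unfolding emp_mean_def
  by (intro borel_measurable_divide borel_measurable_sum borel_measurable_const measurable_compose[OF rv_X]) auto

lemma atypical_negligible:
  assumes d: "d > 0"
  shows "\<exists>B. negligible_events B \<and> (\<forall>N. \<forall>\<omega>\<in>space M - B N. typical d N \<omega>)"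
proof -
  define A where "A t N = {\<omega>\<in>space M. d \<le> \<bar>emp_mean N (\<lambda>j. X j \<omega> t) - expectation (\<lambda>\<omega>. X 1 \<omega> t)\<bar>}" for t N
  define B where "B p N = {\<omega>\<in>space M. d \<le> \<bar>emp_mean N (\<lambda>j. X j \<omega> (fst p) * X j \<omega> (snd p)) - expectation (\<lambda>\<omega>. X 1 \<omega> (fst p) * X 1 \<omega> (snd p))\<bar>}" for p N
  define C where "C t N = {\<omega>\<in>space M. d * sqrt (real N) \<le> emp_mean N (\<lambda>j. X j \<omega> t ^ 4)}" for t N
  have c: "(\<lambda>x. x t) \<in> borel_measurable (vec_space T)" if "t \<in> {1..T}" for t
    using that by (rule measurable_component_singleton)
  have A: "negligible_events (A t)" if t: "t \<in> {1..T}" for t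
  proof -
    have "integrable M (\<lambda>\<omega>. (X 1 \<omega> t)\<^sup>2)"
      using integrable_product_square(2)[OF t t] by (simp add: power2_eq_square)
    from emp_mean_rows_converge[OF c[OF t] this d] show ?thesis
      unfolding negligible_events_def A_def
      using measurable_emp_mean_rows[OF c[OF t]] by (auto intro!: borel_measurable_le borel_measurable_const borel_measurable_abs borel_measurable_diff simp del: One_nat_def)
  qed
  have B: "negligible_events (B p)" if p: "p \<in> {1..T} \<times> {1..T}" for p
  proof -
    have p': "fst p \<in> {1..T}" "snd p \<in> {1..T}" using p by auto
    have m: "(\<lambda>x. x (fst p) * x (snd p)) \<in> borel_measurable (vec_space T)"
      by (intro borel_measurable_times c p')
    from emp_mean_rows_converge[OF m integrable_product_square(1)[OF p'] d] show ?thesis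
      unfolding negligible_events_def B_def
      using measurable_emp_mean_rows[OF m] by (auto intro!: borel_measurable_le borel_measurable_const borel_measurable_abs borel_measurable_diff simp del: One_nat_def)
  qed
  have C: "negligible_events (C t)" if t: "t \<in> {1..T}" for t
  proof -
    have m: "(\<lambda>x. x t ^ 4) \<in> borel_measurable (vec_space T)"
      by (intro borel_measurable_power c t)
    from emp_mean_rows_bounded[OF m fourth[OF t] _ d] show ?thesis
      unfolding negligible_events_def C_def
      using measurable_emp_mean_rows[OF m] by (auto intro!: borel_measurable_le borel_measurable_const)
  qed
  have "AE \<omega> in M. \<forall>t\<in>{2..T-2}. \<forall>s\<in>{t..T-1}. quad T cov (cum_coeff T (bridge_coeff T (tail_coeff T t s))) = 0 \<longrightarrow>
      (\<forall>j\<in>{1..}. lin T (tail_coeff T t s) (bridge T (cum (X j \<omega>))) = 0)"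
  proof (intro AE_ball_countable' AE_impI)
    fix t s j assume *: "quad T cov (cum_coeff T (bridge_coeff T (tail_coeff T t s))) = 0" "j \<in> {1::nat..}"
    show "AE \<omega> in M. lin T (tail_coeff T t s) (bridge T (cum (X j \<omega>))) = 0"
      using degenerate_rows[OF *(1), of j] *(2) T_pos by (simp add: lin_cum lin_bridge)
  qed auto
  then obtain Z where Z: "Z \<in> null_sets M" "{\<omega>\<in>space M. \<not> (\<forall>t\<in>{2..T-2}. \<forall>s\<in>{t..T-1}. quad T cov (cum_coeff T (bridge_coeff T (tail_coeff T t s))) = 0 \<longrightarrow>
      (\<forall>j\<in>{1..}. lin T (tail_coeff T t s) (bridge T (cum (X j \<omega>))) = 0))} \<subseteq> Z"
    unfolding eventually_ae_filter by blast
  have Zn: "negligible_events (\<lambda>_. Z)"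
    using Z(1) by (auto simp: negligible_events_def measure_def dest: null_setsD1)
  define Bad where "Bad N = ((\<Union>t\<in>{1..T}. A t N) \<union> (\<Union>p\<in>{1..T}\<times>{1..T}. B p N)) \<union> ((\<Union>t\<in>{1..T}. C t N) \<union> Z)" for N
  have "negligible_events Bad"
    unfolding Bad_def by (intro negligible_events_Un negligible_events_UN A B C Zn) auto
  moreover have "typical d N \<omega>" if w: "\<omega> \<in> space M - Bad N" for N \<omega>
    unfolding typical_def
  proof (intro conjI ballI impI)
    fix t assume t: "t \<in> {1..T}"
    show "\<bar>emp_mean N (\<lambda>j. X j \<omega> t)\<bar> \<le> d"
    proof -
      have "\<omega> \<notin> A t N" using w t unfolding Bad_def by blast
      then show ?thesis using w mean[OF t] by (auto simp: A_def simp del: One_nat_def)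
    qed
    show "emp_mean N (\<lambda>j. X j \<omega> t ^ 4) \<le> d * sqrt (real N)"
    proof -
      have "\<omega> \<notin> C t N" using w t unfolding Bad_def by blast
      then show ?thesis using w by (auto simp: C_def)
    qed
    fix v assume v: "v \<in> {1..T}"
    show "\<bar>emp_mean N (\<lambda>j. X j \<omega> t * X j \<omega> v) - cov t v\<bar> \<le> d"
    proof -
      have "\<omega> \<notin> B (t, v) N" using w t v unfolding Bad_def by blast
      then show ?thesis using w by (auto simp: B_def cov_def simp del: One_nat_def)
    qed
  next
    fix t s j
    assume "t \<in> {2..T-2}" "s \<in> {t..T-1}" "quad T cov (cum_coeff T (bridge_coeff T (tail_coeff T t s))) = 0" "j \<in> {1..N}"
    then show "lin T (tail_coeff T t s) (bridge T (cum (X j \<omega>))) = 0"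
      using w Z(2) unfolding Bad_def by fastforce
  qed
  ultimately show ?thesis by blast
qed

text \<open>
  Uniformity over the typical realizations is proved by contradiction: otherwise there is a sequence
  of realizations, typical for a tolerance tending to \<open>0\<close> and sample sizes tending to infinity, whose conditional laws stay
  away from the limit, in contradiction to the deterministic limit theorem along this sequence.
  This avoids any measurability question for the conditional laws.
\<close>

lemma bootstrap_limit_on_typical:
  fixes e :: "nat \<Rightarrow> 'a \<Rightarrow> nat \<Rightarrow> nat \<Rightarrow> real"
  assumes T: "T \<ge> 4" and \<kappa>: "\<kappa> > 0"
    and G: "gaussian_law T q G" and q: "\<And>u. q u = quad T cov (cum_coeff T (bridge_coeff T u))"
    and e: "\<And>N \<omega> j s. \<omega> \<in> space M \<Longrightarrow> j \<in> {1..N} \<Longrightarrow> s \<in> {1..T} \<Longrightarrow>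
      cum (e N \<omega> j) s = \<kappa> * bridge T (cum (X j \<omega>)) s"
    and cont: "isCont (cdf (distr G borel (limit_ratio T))) x" and \<eta>: "\<eta> > 0"
  shows "\<exists>d>0. \<exists>N0\<ge>1. \<forall>N\<ge>N0. \<forall>\<omega>\<in>space M. typical d N \<omega> \<longrightarrow>
    \<bar>cdf (distr (boot_sum_law T N \<kappa> (e N \<omega>)) borel (limit_ratio T)) x - cdf (distr G borel (limit_ratio T)) x\<bar> \<le> \<eta>"
proof (rule ccontr)
  assume contra: "\<not> ?thesis"
  define far where "far N \<omega> \<longleftrightarrow> \<bar>cdf (distr (boot_sum_law T N \<kappa> (e N \<omega>)) borel (limit_ratio T)) x - cdf (distr G borel (limit_ratio T)) x\<bar> > \<eta>" for N \<omega>
  have "\<exists>N \<omega>. N \<ge> Suc n \<and> \<omega> \<in> space M \<and> typical (1 / real (Suc n)) N \<omega> \<and> far N \<omega>" for n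
  proof (rule ccontr)
    assume "\<nexists>N \<omega>. N \<ge> Suc n \<and> \<omega> \<in> space M \<and> typical (1 / real (Suc n)) N \<omega> \<and> far N \<omega>"
    then have "\<forall>N\<ge>Suc n. \<forall>\<omega>\<in>space M. typical (1 / real (Suc n)) N \<omega> \<longrightarrow>
        \<bar>cdf (distr (boot_sum_law T N \<kappa> (e N \<omega>)) borel (limit_ratio T)) x - cdf (distr G borel (limit_ratio T)) x\<bar> \<le> \<eta>"
      unfolding far_def not_less[symmetric] by blast
    moreover have "1 / real (Suc n) > 0" "Suc n \<ge> 1" by simp_all
    ultimately show False using contra by blast
  qed
  then obtain N w where Nw: "\<And>n. N n \<ge> Suc n" "\<And>n. w n \<in> space M" "\<And>n. typical (1 / real (Suc n)) (N n) (w n)" "\<And>n. far (N n) (w n)"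
    by metis
  have N1: "N n \<ge> 1" for n using Nw(1)[of n] by simp
  have Ninf: "filterlim N at_top sequentially"
    by (rule filterlim_at_top_mono[OF filterlim_ident]) (use Suc_leD[OF Nw(1)] in \<open>auto intro!: always_eventually\<close>)
  have d0: "(\<lambda>n. 1 / real (Suc n)) \<longlonglongrightarrow> 0" by real_asymp
  define P where "P n = boot_sum_law T (N n) \<kappa> (e (N n) (w n))" for n
  have rows: "cum (e (N n) (w n) j) s = \<kappa> * bridge T (cum (X j (w n))) s" if "j \<in> {1..N n}" "s \<in> {1..T}" for n j s
    by (rule e[OF Nw(2) that])
  have cfP: "char_fun T (P n) u = char (distr (measure_pmf (pmf_of_set {1..N n})) borel
      (\<lambda>j. lin T (cum_coeff T (bridge_coeff T u)) (X j (w n)) -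
        emp_mean (N n) (\<lambda>j. lin T (cum_coeff T (bridge_coeff T u)) (X j (w n))))) (1 / sqrt (real (N n))) ^ N n" for n u
    unfolding P_def by (rule boot_sum_law_char_fun[OF T_pos N1 \<kappa> rows])
  have "weak_conv_m (\<lambda>n. distr (P n) borel (limit_ratio T)) (distr G borel (limit_ratio T))"
  proof (rule limit_ratio_weak_conv[OF T _ _ G])
    show "prob_space (P n)" "sets (P n) = sets (vec_space T)" for n
      by (simp_all only: P_def prob_space_boot_sum_law sets_boot_sum_law)
    show "(\<lambda>n. char_fun T (P n) u) \<longlonglongrightarrow> char_fun T G u" for u
      unfolding cfP char_fun_gaussian[OF G] q
    proof (rule resampled_char_limit[OF N1 Ninf])
      fix t assume t: "t \<in> {1..T}"
      show "(\<lambda>n. emp_mean (N n) (\<lambda>j. X j (w n) t)) \<longlonglongrightarrow> 0"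
        using Nw(3) t by (intro Lim_null_comparison[OF _ d0] always_eventually allI) (auto simp: typical_def)
      show "(\<lambda>n. emp_mean (N n) (\<lambda>j. X j (w n) t ^ 4) / sqrt (real (N n))) \<longlonglongrightarrow> 0"
      proof (intro Lim_null_comparison[OF _ d0] always_eventually allI)
        fix n
        have "0 \<le> emp_mean (N n) (\<lambda>j. X j (w n) t ^ 4)" by (intro emp_mean_nonneg) simp
        moreover have "emp_mean (N n) (\<lambda>j. X j (w n) t ^ 4) \<le> 1 / real (Suc n) * sqrt (real (N n))"
          using Nw(3)[of n] t by (auto simp: typical_def)
        ultimately show "norm (emp_mean (N n) (\<lambda>j. X j (w n) t ^ 4) / sqrt (real (N n))) \<le> 1 / real (Suc n)"
          using N1[of n] by (simp add: divide_le_eq)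
      qed
      fix v assume v: "v \<in> {1..T}"
      show "(\<lambda>n. emp_mean (N n) (\<lambda>j. X j (w n) t * X j (w n) v)) \<longlonglongrightarrow> cov t v"
        by (rule Lim_null[THEN iffD2], intro Lim_null_comparison[OF _ d0] always_eventually allI)
           (use Nw(3) t v in \<open>auto simp: typical_def\<close>)
    qed
    fix k t s assume ts: "t \<in> {2..T-2}" "s \<in> {t..T-1}" and q0: "q (tail_coeff T t s) = 0"
    have "AE z in P k. lin T (tail_coeff T t s) z = 0"
      unfolding P_def
      by (rule boot_sum_law_degenerate[OF T_pos N1 \<kappa> rows])
         (use Nw(3)[of k] ts q0 in \<open>auto simp: typical_def q\<close>)
    then show "AE z in P k. tail_dev T t s z = 0" by (simp add: lin_tail_coeff[OF ts])
  qed
  then have "(\<lambda>n. cdf (distr (P n) borel (limit_ratio T)) x) \<longlonglongrightarrow> cdf (distr G borel (limit_ratio T)) x"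
    using cont by (auto simp: weak_conv_m_def weak_conv_def)
  then have "eventually (\<lambda>n. dist (cdf (distr (P n) borel (limit_ratio T)) x) (cdf (distr G borel (limit_ratio T)) x) < \<eta>) sequentially"
    using \<eta> by (rule tendstoD)
  then obtain n where "dist (cdf (distr (P n) borel (limit_ratio T)) x) (cdf (distr G borel (limit_ratio T)) x) < \<eta>"
    by (auto simp: eventually_sequentially)
  then show False using Nw(4)[of n] by (simp add: far_def P_def dist_real_def)
qed

text \<open>
  The Gram matrix of linear forms of a row has as quadratic form the second moments of their linear combinations.
\<close>

lemma quad_gram:
  assumes C: "\<And>t v. t \<in> {1..T} \<Longrightarrow> v \<in> {1..T} \<Longrightarrow> C t v = expectation (\<lambda>\<omega>. lin T (a t) (X 1 \<omega>) * lin T (a v) (X 1 \<omega>))"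
  shows "quad T C u = expectation (\<lambda>\<omega>. (lin T u (\<lambda>t. lin T (a t) (X 1 \<omega>)))\<^sup>2)"
proof -
  have "expectation (\<lambda>\<omega>. (lin T u (\<lambda>t. lin T (a t) (X 1 \<omega>)))\<^sup>2) =
      expectation (\<lambda>\<omega>. \<Sum>t=1..T. \<Sum>v=1..T. u t * u v * (lin T (a t) (X 1 \<omega>) * lin T (a v) (X 1 \<omega>)))"
    by (simp add: lin_def[of T u] power2_eq_square sum_product mult_ac)
  also have "\<dots> = (\<Sum>t=1..T. expectation (\<lambda>\<omega>. \<Sum>v=1..T. u t * u v * (lin T (a t) (X 1 \<omega>) * lin T (a v) (X 1 \<omega>))))"
    by (intro Bochner_Integration.integral_sum Bochner_Integration.integrable_sum integrable_mult_right lin_product(2))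
  also have "\<dots> = (\<Sum>t=1..T. \<Sum>v=1..T. expectation (\<lambda>\<omega>. u t * u v * (lin T (a t) (X 1 \<omega>) * lin T (a v) (X 1 \<omega>))))"
    by (intro sum.cong refl Bochner_Integration.integral_sum integrable_mult_right lin_product(2))
  also have "\<dots> = quad T C u"
    unfolding quad_def by (intro sum.cong refl) (simp add: C del: One_nat_def)
  finally show ?thesis ..
qed

definition cum_moment :: "nat \<Rightarrow> nat \<Rightarrow> real" where
  "cum_moment t v = expectation (\<lambda>\<omega>. cum (X 1 \<omega>) t * cum (X 1 \<omega>) v)"

lemma cum_lin: "t \<le> T \<Longrightarrow> cum x t = lin T (\<lambda>r. if r \<le> t then 1 else 0) x"
  unfolding cum_def lin_def by (intro sum.mono_neutral_cong_left) auto

lemma cum_product_integrable: "t \<le> T \<Longrightarrow> v \<le> T \<Longrightarrow> integrable M (\<lambda>\<omega>. cum (X 1 \<omega>) t * cum (X 1 \<omega>) v)"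
  unfolding cum_lin by (rule lin_product)

lemma cum_mean: "t \<le> T \<Longrightarrow> expectation (\<lambda>\<omega>. cum (X 1 \<omega>) t) = 0"
  unfolding cum_lin by (rule lin_mean)

lemma cum_moment_sym: "cum_moment t v = cum_moment v t"
  by (simp add: cum_moment_def mult.commute)

lemma quad_partial_sums:
  assumes "\<And>t v. t \<in> {1..T} \<Longrightarrow> v \<in> {1..T} \<Longrightarrow> C t v = cum_moment t v"
  shows "quad T C u = quad T cov (cum_coeff T u)"
proof -
  have "quad T C u = expectation (\<lambda>\<omega>. (lin T u (\<lambda>t. lin T (\<lambda>r. if r \<le> t then 1 else 0) (X 1 \<omega>)))\<^sup>2)"
    by (rule quad_gram) (simp add: assms cum_moment_def cum_lin del: One_nat_def)
  also have "\<dots> = expectation (\<lambda>\<omega>. (lin T u (cum (X 1 \<omega>)))\<^sup>2)"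
    by (intro Bochner_Integration.integral_cong refl arg_cong[where f = "\<lambda>y. y\<^sup>2"])
       (simp add: lin_def[of T u] cum_lin)
  finally show ?thesis by (simp add: lin_cum lin_square del: One_nat_def)
qed

lemma bridge_moment:
  assumes t: "t \<le> T" and v: "v \<le> T"
  shows "expectation (\<lambda>\<omega>. bridge T (cum (X 1 \<omega>)) t * bridge T (cum (X 1 \<omega>)) v) =
    cum_moment t v - real v / real T * cum_moment t T - real t / real T * cum_moment v T
    + real t * real v / (real T)\<^sup>2 * cum_moment T T"
proof -
  have eq: "bridge T x t * bridge T x v = x t * x v - real v / real T * (x t * x T) - real t / real T * (x v * x T)
    + real t * real v / (real T)\<^sup>2 * (x T * x T)" for x
    by (simp add: bridge_def algebra_simps power2_eq_square)
  show ?thesis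
    unfolding eq cum_moment_def using cum_product_integrable t v
    by (simp del: One_nat_def)
qed

lemma quad_bridge:
  assumes "\<And>t v. t \<in> {1..T} \<Longrightarrow> v \<in> {1..T} \<Longrightarrow>
    C t v = expectation (\<lambda>\<omega>. bridge T (cum (X 1 \<omega>)) t * bridge T (cum (X 1 \<omega>)) v)"
  shows "quad T C u = quad T cov (cum_coeff T (bridge_coeff T u))"
proof -
  define a where "a t r = (if r \<le> t then 1 else 0) - real t / real T" for t r :: nat
  have a: "bridge T (cum x) t = lin T (a t) x" if "t \<le> T" for x t
  proof -
    have "bridge T (cum x) t = lin T (\<lambda>r. if r \<le> t then 1 else 0) x - real t / real T * (\<Sum>r=1..T. x r)"
      unfolding bridge_def cum_lin[OF that] by (simp add: cum_def)
    then show ?thesis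
      by (simp add: lin_def a_def left_diff_distrib sum_subtractf sum_distrib_left)
  qed
  have "quad T C u = expectation (\<lambda>\<omega>. (lin T u (\<lambda>t. lin T (a t) (X 1 \<omega>)))\<^sup>2)"
    by (rule quad_gram) (simp add: assms a del: One_nat_def)
  also have "\<dots> = expectation (\<lambda>\<omega>. (lin T u (bridge T (cum (X 1 \<omega>))))\<^sup>2)"
    by (intro Bochner_Integration.integral_cong refl arg_cong[where f = "\<lambda>y. y\<^sup>2"])
       (simp add: lin_def[of T u] a)
  finally show ?thesis using T_pos by (simp add: lin_cum lin_bridge lin_square del: One_nat_def)
qed

end

section \<open>The limits of the statistic and of its bootstrap version\<close>

lemma weak_conv_m_const:
  assumes "real_distribution A" "real_distribution B" "weak_conv_m (\<lambda>_. A) B"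
  shows "A = B"
proof (rule Levy_uniqueness[OF assms(1,2)])
  show "char A = char B"
  proof
    fix t
    have "(\<lambda>_ :: nat. char A t) \<longlonglongrightarrow> char B t" using assms by (intro levy_continuity1)
    then show "char A t = char B t" by (simp add: LIMSEQ_const_iff)
  qed
qed

theorem theorem5:
  fixes M :: "'a measure"
    and T \<tau> :: nat
    and \<mu> \<delta> \<rho> :: "nat \<Rightarrow> real"
    and \<sigma> :: real
    and \<epsilon> Y :: "nat \<Rightarrow> nat \<Rightarrow> 'a \<Rightarrow> real"
    and tau_hat :: "nat \<Rightarrow> (nat \<Rightarrow> nat \<Rightarrow> real) \<Rightarrow> nat"
  assumes "prob_space M"
    and "T \<ge> 4"
    and "\<sigma> > 0"
    and errors: "panel_errors M T \<rho> \<epsilon>"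
    and model: "Y = panel_obs \<mu> \<delta> \<tau> \<sigma> \<epsilon>"
    and H0: "\<tau> = T"
    and estimator: "\<And>N. tau_hat N \<in> measurable (panel_space T N) (count_space {1..T})"
    and consistent:
      "(\<lambda>N. measure M {\<omega> \<in> space M. tau_hat N (panel_data T N Y \<omega>) = \<tau>}) \<longlonglongrightarrow> 1"
    and fourth_moment: "\<And>t. t \<in> {1..T} \<Longrightarrow> integrable M (\<lambda>\<omega>. \<epsilon> 1 t \<omega> ^ 4)"
  defines "\<Lambda> \<equiv> Lambda_cov (cum_var M \<epsilon>) (cum_cov M \<epsilon>)"
    and "\<Gamma> \<equiv> Gamma_cov (cum_var M \<epsilon>) (cum_cov M \<epsilon>) T"
  shows "(\<exists>L. centred_normal T \<Lambda> L) \<and> (\<exists>G. centred_normal T \<Gamma> G) \<and>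
    (\<forall>L G. centred_normal T \<Lambda> L \<longrightarrow> centred_normal T \<Gamma> G \<longrightarrow>
       weak_conv_m (\<lambda>N. distr M borel (\<lambda>\<omega>. ratio_stat T N (panel_data T N Y \<omega>)))
         (distr L borel (limit_ratio T)) \<and>
       weak_conv_in_prob M
         (\<lambda>N \<omega>. bootstrap_law T N (tau_hat N (panel_data T N Y \<omega>)) (panel_data T N Y \<omega>))
         (distr G borel (limit_ratio T)) \<and>
       distr L borel (limit_ratio T) = distr G borel (limit_ratio T))"
proof -
  interpret prob_space M by fact
  note T = \<open>T \<ge> 4\<close> and \<sigma> = \<open>\<sigma> > 0\<close>
  define X where "X = error_vector T \<epsilon>"
  have X_eps: "X i \<omega> t = \<epsilon> i t \<omega>" if "t \<in> {1..T}" for i t \<omega>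
    using that by (simp add: X_def error_vector_def)
  interpret iid_rows M T X
  proof
    show "T \<ge> 1" using T by simp
    show "indep_vars (\<lambda>_. vec_space T) X {1..}"
      using errors unfolding panel_errors_def X_def by blast
    show "distr M (vec_space T) (X i) = distr M (vec_space T) (X 1)" if "i \<ge> 1" for i
      using errors that unfolding panel_errors_def X_def by blast
    show "expectation (\<lambda>\<omega>. X 1 \<omega> t) = 0" if "t \<in> {1..T}" for t
      unfolding X_eps[OF that] using errors that unfolding panel_errors_def by blast
    show "integrable M (\<lambda>\<omega>. X 1 \<omega> t ^ 4)" if "t \<in> {1..T}" for t
      unfolding X_eps[OF that] by (rule fourth_moment[OF that])
  qed
  have cum_eps: "cum (X i \<omega>) t = (\<Sum>s=1..t. \<epsilon> i s \<omega>)" if "t \<le> T" for i t \<omega>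
    unfolding cum_def using that by (intro sum.cong refl X_eps) auto

  \<comment> \<open>The matrices \<Lambda> and \<Gamma> are the second moments of the partial sums and of their bridges.\<close>
  have var: "cum_var M \<epsilon> t = cum_moment t t" if t: "t \<le> T" for t
    using cum_mean[OF t] by (simp add: cum_var_def cum_moment_def power2_eq_square cum_eps[OF t] del: One_nat_def)
  have cov: "cum_cov M \<epsilon> t v = cum_moment t v - cum_moment t t" if tv: "t \<le> v" "v \<le> T" for t v
  proof -
    have t: "t \<le> T" using tv by simp
    have tail: "(\<Sum>u=t+1..v. \<epsilon> 1 u \<omega>) = cum (X 1 \<omega>) v - cum (X 1 \<omega>) t" for \<omega>
      unfolding cum_tail[OF tv(1), symmetric] using tv by (intro sum.cong refl X_eps[symmetric]) auto
    have int: "integrable M (\<lambda>\<omega>. cum (X 1 \<omega>) r)" if "r \<le> T" for r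
      unfolding cum_lin[OF that] using integrable_power4_imp(2)[OF rv_lin lin_fourth, of 1] by simp
    have "cum_cov M \<epsilon> t v = expectation (\<lambda>\<omega>. cum (X 1 \<omega>) t * (cum (X 1 \<omega>) v - cum (X 1 \<omega>) t))"
      unfolding cum_cov_def covariance_def tail cum_eps[OF t, symmetric]
      using cum_mean[OF t] cum_mean[OF tv(2)] int[OF t] int[OF tv(2)] by (simp del: One_nat_def)
    then show ?thesis
      using cum_product_integrable[OF t tv(2)] cum_product_integrable[OF t t]
      by (simp add: right_diff_distrib cum_moment_def del: One_nat_def)
  qed
  have Lam: "\<Lambda> t v = cum_moment t v" if "t \<in> {1..T}" "v \<in> {1..T}" for t v
    using that var cov cum_moment_sym[of t v] by (auto simp: \<Lambda>_def Lambda_cov_def)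
  have Gam: "\<Gamma> t v = expectation (\<lambda>\<omega>. bridge T (cum (X 1 \<omega>)) t * bridge T (cum (X 1 \<omega>)) v)"
    if tv: "t \<in> {1..T}" "v \<in> {1..T}" for t v
  proof (cases "t = T \<or> v = T")
    case True
    have "bridge T x T = 0" for x using T by (simp add: bridge_def)
    then show ?thesis using True by (auto simp: \<Gamma>_def Gamma_cov_def)
  next
    case False
    have rR: "cum_var M \<epsilon> r + cum_cov M \<epsilon> r v = cum_moment r v" if "r \<le> v" "v \<le> T" for r v
      using that var[of r] cov[of r v] by simp
    have le: "t \<le> T" "v \<le> T" using tv by auto
    note facts = bridge_moment[OF le] rR[of t T, OF le(1) order_refl] rR[of v T, OF le(2) order_refl] var[OF order_refl]
    consider "t = v" | "t < v" | "v < t" by linarith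
    then show ?thesis
    proof cases
      case 1
      then show ?thesis
        using False facts var[OF le(1)]
        by (simp add: \<Gamma>_def Gamma_cov_def power2_eq_square algebra_simps del: One_nat_def)
    next
      case 2
      then show ?thesis
        using False facts rR[of t v] le
        by (simp add: \<Gamma>_def Gamma_cov_def Gamma_upper_def del: One_nat_def)
    next
      case 3
      then show ?thesis
        using False facts rR[of v t] le unfolding cum_moment_sym[of t v]
        by (simp add: \<Gamma>_def Gamma_cov_def Gamma_upper_def mult.commute[of "real v"] del: One_nat_def)
    qed
  qed
  have quadLam: "quad T \<Lambda> u = quad T cov (cum_coeff T u)" for u
    by (rule quad_partial_sums[OF Lam])
  have quadGam: "quad T \<Gamma> u = quad T cov (cum_coeff T (bridge_coeff T u))" for u
    by (rule quad_bridge[OF Gam])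
  have symLam: "\<Lambda> t v = \<Lambda> v t" if "t \<in> {1..T}" "v \<in> {1..T}" for t v
    using Lam[OF that] Lam[OF that(2,1)] cum_moment_sym[of t v] by simp
  have symGam: "\<Gamma> t v = \<Gamma> v t" if "t \<in> {1..T}" "v \<in> {1..T}" for t v
    unfolding Gam[OF that] Gam[OF that(2,1)] by (simp add: mult.commute)

  have "\<exists>L. centred_normal T \<Lambda> L"
    using gaussian_law_exists[of T \<Lambda>] gaussian_law_centred_normal[of T \<Lambda>] symLam quad_cov_nonneg
    by (auto simp: quadLam)
  moreover have "\<exists>G. centred_normal T \<Gamma> G"
    using gaussian_law_exists[of T \<Gamma>] gaussian_law_centred_normal[of T \<Gamma>] symGam quad_cov_nonneg
    by (auto simp: quadGam)
  moreover have "weak_conv_m (\<lambda>N. distr M borel (\<lambda>\<omega>. ratio_stat T N (panel_data T N Y \<omega>)))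
         (distr L borel (limit_ratio T)) \<and>
       weak_conv_in_prob M
         (\<lambda>N \<omega>. bootstrap_law T N (tau_hat N (panel_data T N Y \<omega>)) (panel_data T N Y \<omega>))
         (distr G borel (limit_ratio T)) \<and>
       distr L borel (limit_ratio T) = distr G borel (limit_ratio T)"
    if LG: "centred_normal T \<Lambda> L" "centred_normal T \<Gamma> G" for L G
  proof (intro conjI)
    have L: "gaussian_law T (quad T \<Lambda>) L" and G: "gaussian_law T (quad T \<Gamma>) G"
      using LG by (auto intro: centred_normal_gaussian_law)
    have panel: "cum (panel_data T N Y \<omega> i) s = \<sigma> * cum (X i \<omega>) s + \<mu> i * real s"
      if "i \<in> {1..N}" "s \<le> T" for N \<omega> i s
    proof -
      have "cum (panel_data T N Y \<omega> i) s = (\<Sum>r=1..s. \<mu> i + \<sigma> * X i \<omega> r)"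
        unfolding cum_def using that X_eps
        by (intro sum.cong refl) (auto simp: panel_data_def model panel_obs_def H0)
      then show ?thesis by (simp add: sum.distrib cum_def sum_distrib_left)
    qed

    show "weak_conv_m (\<lambda>N. distr M borel (\<lambda>\<omega>. ratio_stat T N (panel_data T N Y \<omega>))) (distr L borel (limit_ratio T))"
    proof -
      have stat: "ratio_stat T N (panel_data T N Y \<omega>) = limit_ratio T (sample_sum N \<omega>)" if N: "N \<ge> 1" for N \<omega>
      proof -
        have "ratio_stat T N (panel_data T N Y \<omega>) =
            limit_ratio T (\<lambda>s. (\<sigma> * sqrt (real N)) * sample_sum N \<omega> s + (\<Sum>i=1..N. \<mu> i) * real s)"
          unfolding ratio_stat_limit_ratio
        proof (rule limit_ratio_cong)
          fix s assume s: "s \<in> {1..T}"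
          have "(\<Sum>i=1..N. cum (panel_data T N Y \<omega> i) s) = (\<Sum>i=1..N. \<sigma> * cum (X i \<omega>) s + \<mu> i * real s)"
            using s by (intro sum.cong refl panel) auto
          also have "\<dots> = \<sigma> * (\<Sum>i=1..N. cum (X i \<omega>) s) + (\<Sum>i=1..N. \<mu> i) * real s"
            by (simp add: sum.distrib sum_distrib_left sum_distrib_right)
          finally show "(\<Sum>i=1..N. cum (panel_data T N Y \<omega> i) s) =
              (\<sigma> * sqrt (real N)) * sample_sum N \<omega> s + (\<Sum>i=1..N. \<mu> i) * real s"
            using s N by (simp add: sample_sum_def)
        qed
        also have "\<dots> = limit_ratio T (sample_sum N \<omega>)"
          using \<sigma> N by (intro limit_ratio_affine) simp
        finally show ?thesis .
      qed
      have "weak_conv_m (\<lambda>N. distr (distr M (vec_space T) (sample_sum N)) borel (limit_ratio T)) (distr L borel (limit_ratio T))"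
      proof (rule limit_ratio_weak_conv[OF T _ _ L])
        show "prob_space (distr M (vec_space T) (sample_sum N))" for N
          by (rule prob_space_distr[OF measurable_sample_sum])
        show "(\<lambda>N. char_fun T (distr M (vec_space T) (sample_sum N)) u) \<longlonglongrightarrow> char_fun T L u" for u
          unfolding char_fun_gaussian[OF L] quadLam by (rule sample_char_fun_limit)
        fix N t s assume ts: "t \<in> {2..T-2}" "s \<in> {t..T-1}" and q0: "quad T \<Lambda> (tail_coeff T t s) = 0"
        have "AE \<omega> in M. \<forall>i\<in>{1..N}. lin T (cum_coeff T (tail_coeff T t s)) (X i \<omega>) = 0"
          using q0 by (intro AE_ball_countable' degenerate_rows) (auto simp: quadLam)
        then have "AE \<omega> in M. lin T (tail_coeff T t s) (sample_sum N \<omega>) = 0"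
          by eventually_elim (simp add: lin_sample_sum)
        moreover have P: "{z \<in> space (vec_space T). lin T (tail_coeff T t s) z = 0} \<in> sets (vec_space T)"
          by measurable
        ultimately have "AE z in distr M (vec_space T) (sample_sum N). lin T (tail_coeff T t s) z = 0"
          by (subst AE_distr_iff[OF measurable_sample_sum P])
        then show "AE z in distr M (vec_space T) (sample_sum N). tail_dev T t s z = 0"
          by (simp add: lin_tail_coeff[OF ts])
      qed simp
      moreover have "distr (distr M (vec_space T) (sample_sum N)) borel (limit_ratio T) =
          distr M borel (\<lambda>\<omega>. ratio_stat T N (panel_data T N Y \<omega>))" if "N \<ge> 1" for N
        by (subst distr_distr[OF measurable_limit_ratio[OF T] measurable_sample_sum]) (simp add: comp_def stat[OF that])
      ultimately show ?thesis
        unfolding weak_conv_m_def weak_conv_def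
        by (auto elim!: Lim_transform_eventually intro!: eventually_sequentiallyI[of 1])
    qed

    show "weak_conv_in_prob M
         (\<lambda>N \<omega>. bootstrap_law T N (tau_hat N (panel_data T N Y \<omega>)) (panel_data T N Y \<omega>))
         (distr G borel (limit_ratio T))"
      unfolding weak_conv_in_prob_def
    proof (intro allI impI)
      fix x \<eta> :: real
      assume cont: "isCont (cdf (distr G borel (limit_ratio T))) x" and \<eta>: "\<eta> > 0"
      define e where "e N \<omega> = residual T T (panel_data T N Y \<omega>)" for N \<omega>
      define K where "K N \<omega> = bootstrap_law T N (tau_hat N (panel_data T N Y \<omega>)) (panel_data T N Y \<omega>)" for N \<omega>
      have rows: "cum (e N \<omega> j) s = \<sigma> * bridge T (cum (X j \<omega>)) s" if "j \<in> {1..N}" "s \<in> {1..T}" for N \<omega> j s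
      proof -
        have "cum (e N \<omega> j) s = bridge T (\<lambda>s. \<sigma> * cum (X j \<omega>) s + \<mu> j * real s) s"
          unfolding e_def cum_residual[OF that(2)] using that panel[OF that(1)] by (simp add: bridge_def)
        then show ?thesis using T by (simp add: bridge_affine)
      qed
      \<comment> \<open>Outside of the atypical realizations and of a wrong estimate of the change point, the
        conditional distribution function at x is within \<eta> of the limit.\<close>
      obtain d N0 where d: "d > 0" and N0: "N0 \<ge> 1"
        and close: "\<And>N \<omega>. N \<ge> N0 \<Longrightarrow> \<omega> \<in> space M \<Longrightarrow> typical d N \<omega> \<Longrightarrow>
          \<bar>cdf (distr (boot_sum_law T N \<sigma> (e N \<omega>)) borel (limit_ratio T)) x - cdf (distr G borel (limit_ratio T)) x\<bar> \<le> \<eta>"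
        using bootstrap_limit_on_typical[of \<sigma> "quad T \<Gamma>" G e, OF T \<sigma> G quadGam _ cont \<eta>] rows by blast
      obtain B where B: "negligible_events B" "\<And>N \<omega>. \<omega> \<in> space M - B N \<Longrightarrow> typical d N \<omega>"
        using atypical_negligible[OF d] by blast
      have data: "panel_data T N Y \<in> measurable M (panel_space T N)" for N
        unfolding panel_data_def[abs_def]
      proof (intro measurable_restrict)
        fix i t assume it: "i \<in> {1..N}" "t \<in> {1..T}"
        have "(\<lambda>\<omega>. X i \<omega> t) \<in> borel_measurable M"
          using it by (intro measurable_compose[OF rv_X measurable_component_singleton]) auto
        then show "Y i t \<in> borel_measurable M"
          unfolding X_eps[OF it(2)] model panel_obs_def[abs_def] by measurable
      qed
      have right: "{\<omega> \<in> space M. tau_hat N (panel_data T N Y \<omega>) = T} \<in> events" for N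
      proof -
        have "(\<lambda>\<omega>. tau_hat N (panel_data T N Y \<omega>)) \<in> measurable M (count_space {1..T})"
          by (rule measurable_compose[OF data estimator])
        from measurable_sets[OF this, of "{T}"] show ?thesis
          using T by (simp add: vimage_def Int_def conj_commute)
      qed
      show "(\<lambda>N. prob {\<omega> \<in> space M. \<eta> < \<bar>cdf (K N \<omega>) x - cdf (distr G borel (limit_ratio T)) x\<bar>}) \<longlonglongrightarrow> 0"
      proof (rule tendsto_sandwich[where f = "\<lambda>_. 0"])
        have "(\<lambda>N. 1 - prob {\<omega> \<in> space M. tau_hat N (panel_data T N Y \<omega>) = T}) \<longlonglongrightarrow> 1 - 1"
          using consistent unfolding H0 by (intro tendsto_intros)
        then show "(\<lambda>N. prob (B N) + (1 - prob {\<omega> \<in> space M. tau_hat N (panel_data T N Y \<omega>) = T})) \<longlonglongrightarrow> 0"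
          using tendsto_add[of "\<lambda>N. prob (B N)" 0] B(1) by (force simp: negligible_events_def)
        show "eventually (\<lambda>N. prob {\<omega> \<in> space M. \<eta> < \<bar>cdf (K N \<omega>) x - cdf (distr G borel (limit_ratio T)) x\<bar>}
            \<le> prob (B N) + (1 - prob {\<omega> \<in> space M. tau_hat N (panel_data T N Y \<omega>) = T})) sequentially"
          using eventually_ge_at_top[of N0]
        proof eventually_elim
          case (elim N)
          let ?W = "space M - {\<omega> \<in> space M. tau_hat N (panel_data T N Y \<omega>) = T}"
          have BN: "B N \<in> events" using B(1) by (simp add: negligible_events_def)
          have "{\<omega> \<in> space M. \<eta> < \<bar>cdf (K N \<omega>) x - cdf (distr G borel (limit_ratio T)) x\<bar>} \<subseteq> B N \<union> ?W"
          proof safe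
            fix \<omega> assume w: "\<omega> \<in> space M" "\<omega> \<notin> B N" "tau_hat N (panel_data T N Y \<omega>) = T"
              and far: "\<eta> < \<bar>cdf (K N \<omega>) x - cdf (distr G borel (limit_ratio T)) x\<bar>"
            have "K N \<omega> = distr (boot_sum_law T N \<sigma> (e N \<omega>)) borel (limit_ratio T)"
              unfolding K_def w(3) e_def using elim N0 by (intro bootstrap_law_boot_sum_law T \<sigma>) simp
            then show False using close[OF elim w(1) B(2)] w far by simp
          qed
          then have "prob {\<omega> \<in> space M. \<eta> < \<bar>cdf (K N \<omega>) x - cdf (distr G borel (limit_ratio T)) x\<bar>} \<le> prob (B N \<union> ?W)"
            using BN right by (intro finite_measure_mono) auto
          also have "\<dots> \<le> prob (B N) + prob ?W"
            using BN right by (intro measure_Un_le) auto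
          finally show ?case using prob_compl[OF right] by simp
        qed
      qed auto
    qed

    show "distr L borel (limit_ratio T) = distr G borel (limit_ratio T)"
    proof -
      have Lp: "prob_space L" "sets L = sets (vec_space T)" using L by (auto simp: gaussian_law_def)
      have Gp: "prob_space G" "sets G = sets (vec_space T)" using G by (auto simp: gaussian_law_def)
      interpret L: prob_space L by (rule Lp)
      \<comment> \<open>The bridge of L has the characteristic function of G, and the ratio does not see the difference
        between L and its bridge.\<close>
      define br where "br x = (\<lambda>s\<in>{1..T}. bridge T x s)" for x
      have brm: "br \<in> measurable L (vec_space T)"
        unfolding br_def[abs_def] bridge_def measurable_cong_sets[OF Lp(2) refl]
        using T by (intro measurable_restrict borel_measurable_diff borel_measurable_times borel_measurable_const measurable_component_singleton) auto
      define L' where "L' = distr L (vec_space T) br"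
      have lrm: "limit_ratio T \<in> borel_measurable p" if "sets p = sets (vec_space T)" for p
        using measurable_limit_ratio[OF T] that by (simp cong: measurable_cong_sets)
      have eq: "distr L' borel (limit_ratio T) = distr L borel (limit_ratio T)"
      proof -
        have "limit_ratio T (br x) = limit_ratio T x" for x
          using limit_ratio_cong[of T "br x" "bridge T x"] by (simp add: br_def limit_ratio_bridge)
        then show ?thesis
          unfolding L'_def by (subst distr_distr[OF measurable_limit_ratio[OF T] brm]) (simp add: comp_def)
      qed
      have lin_br: "lin T u (br x) = lin T (bridge_coeff T u) x" for u x
      proof -
        have "lin T u (br x) = lin T u (bridge T x)" unfolding lin_def br_def by (intro sum.cong refl) simp
        then show ?thesis using T by (simp add: lin_bridge)
      qed
      have quad_br: "quad T \<Lambda> (bridge_coeff T u) = quad T \<Gamma> u" for u by (simp add: quadLam quadGam)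
      have "weak_conv_m (\<lambda>_. distr L' borel (limit_ratio T)) (distr G borel (limit_ratio T))"
      proof (rule limit_ratio_weak_conv[OF T _ _ G])
        show L'p: "prob_space L'" unfolding L'_def by (rule L.prob_space_distr[OF brm])
        show L's: "sets L' = sets (vec_space T)" by (simp add: L'_def)
        show "(\<lambda>_. char_fun T L' u) \<longlonglongrightarrow> char_fun T G u" for u
        proof -
          have ml: "(\<lambda>x. iexp (lin T u x)) \<in> borel_measurable (vec_space T)" by measurable
          have "char_fun T L' u = (\<integral>x. iexp (lin T u (br x)) \<partial>L)"
            unfolding char_fun_integral[OF L's] unfolding L'_def by (rule integral_distr[OF brm ml])
          also have "\<dots> = char_fun T L (bridge_coeff T u)" unfolding lin_br char_fun_integral[OF Lp(2)] ..
          finally show ?thesis by (simp add: char_fun_gaussian[OF L] char_fun_gaussian[OF G] quad_br)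
        qed
        fix t s assume ts: "t \<in> {2..T-2}" "s \<in> {t..T-1}" and q0: "quad T \<Gamma> (tail_coeff T t s) = 0"
        have P: "{z \<in> space (vec_space T). lin T (tail_coeff T t s) z = 0} \<in> sets (vec_space T)"
          by measurable
        have "AE x in L. lin T (tail_coeff T t s) (br x) = 0"
          using gaussian_degenerate[OF L, of "bridge_coeff T (tail_coeff T t s)"] q0 by (simp add: lin_br quad_br)
        then have "AE z in L'. lin T (tail_coeff T t s) z = 0"
          unfolding L'_def by (subst AE_distr_iff[OF brm P])
        then show "AE z in L'. tail_dev T t s z = 0" by (simp add: lin_tail_coeff[OF ts])
      qed
      then have "distr L' borel (limit_ratio T) = distr G borel (limit_ratio T)"
        using Lp Gp unfolding eq
        by (intro weak_conv_m_const prob_space.real_distribution_distr lrm)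
      then show ?thesis by (simp add: eq)
    qed
  qed
  ultimately show ?thesis by blast
qed

end
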